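(* Let $\Omega$ be a finite set of size $D$, let $k$ be an integer with $0\le k\le D$, and let $x_0\in\binom\Omega k$. (i) If $k\neq\frac D2$, then the $\mathcal H$-module $\mathbb C^{\binom\Omega k}(x_0)$ is isomorphic to $$\bigoplus_{(i,j)\in\mathbf P(k)} m_i(D-k)\,m_j(k)\cdot(L_{D-k-2i}\otimes L_{k-2j})(D-2k),$$ and the irreducible $\mathcal H$-modules $(L_{D-k-2i}\otimes L_{k-2j})(D-2k)$ for $(i,j)\in\mathbf P(k)$ are mutually non-isomorphic. (ii) If $k=\frac D2$, then $\mathbb C^{\binom\Omega k}(x_0)$ is isomorphic to the direct sum of $$\bigoplus_{i=0}^{\lfloor D/4\rfloor} m_i(\tfrac D2)^2\cdot(L_{\frac D2-2i}\otimes L_{\frac D2-2i})(0)\quad\text{and}\quad\bigoplus_{i=0}^{\lfloor D/4\rfloor}\bigoplus_{j=i+1}^{\lfloor D/4\rfloor}2\,m_i(\tfrac D2)\,m_j(\tfrac D2)\cdot(L_{\frac D2-2i}\otimes L_{\frac D2-2j})(0),$$ and the irreducible $\mathcal H$-modules $(L_{\frac D2-2i}\otimes L_{\frac D2-2i})(0)$ ($0\le i\le\lfloor D/4\rfloor$) and $(L_{\frac D2-2i}\otimes L_{\frac D2-2j})(0)$ ($0\le i\le\lfloor D/4\rfloor$, $i+1\le j\le\lfloor D/4\rfloor$) are mutually non-isomorphic.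
   Context: All algebras are unital associative over $\mathbb C$. $U(\mathfrak{sl}_2)$ is generated by $E,F,H$ with $[H,E]=2E$, $[H,F]=-2F$, $[E,F]=H$; $\Lambda=EF+FE+\frac{H^2}{2}$; $\Delta$ is the algebra homomorphism $U(\mathfrak{sl}_2)\to U(\mathfrak{sl}_2)^{\otimes2}$, $\Delta(X)=X\otimes1+1\otimes X$ ($X=E,F,H$). $L_n$ ($n\in\mathbb N$) is the $U(\mathfrak{sl}_2)$-module with basis $v_0,\dots,v_n$, $Ev_i=iv_{i-1}$, $Ev_0=0$, $Fv_i=(n-i)v_{i+1}$, $Fv_n=0$, $Hv_i=(n-2i)v_i$. The universal Hahn algebra $\mathcal H$ is generated by $A,B,C$ with $[A,B]=C$ and each of $[C,A]+2A^2+B$, $[B,C]+4BA+2C$ central. $\natural:\mathcal H\to U(\mathfrak{sl}_2)^{\otimes 2}$ is the algebra homomorphism $A\mapsto\frac{H\otimes1-1\otimes H}{4}$, $B\mapsto\frac{\Delta(\Lambda)}2$, $C\mapsto E\otimes F-F\otimes E$; $U(\mathfrak{sl}_2)^{\otimes2}$-modules are $\mathcal H$-modules via $\natural$. For such a module $V$ and $\theta\in\mathbb C$, $V(\theta)=\{v\in V:\Delta(H)v=\theta v\}$ (an $\mathcal H$-submodule). For a finite set $S$, $\mathbb C^{2^S}$ has basis $2^S$ and is a $U(\mathfrak{sl}_2)$-module via $Ex=\sum_{y\subseteq x,|y|=|x|-1}y$, $Fx=\sum_{y\supseteq x,|y|=|x|+1}y$, $Hx=(|S|-2|x|)x$. Via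 the linear isomorphism $\iota(x_0):\mathbb C^{2^\Omega}\to\mathbb C^{2^{\Omega\setminus x_0}}\otimes\mathbb C^{2^{x_0}}$, $x\mapsto(x\setminus x_0)\otimes(x\cap x_0)$, $\mathbb C^{2^\Omega}$ becomes a $U(\mathfrak{sl}_2)^{\otimes2}$-module, hence an $\mathcal H$-module, denoted $\mathbb C^{2^\Omega}(x_0)$. $\binom{\Omega}{k}$ is the set of $k$-subsets of $\Omega$; the span $\mathbb C^{\binom\Omega k}$ equals $\mathbb C^{2^\Omega}(x_0)(D-2k)$ and this $\mathcal H$-submodule is denoted $\mathbb C^{\binom\Omega k}(x_0)$. For integers $0\le i\le\lfloor n/2\rfloor$, $m_i(n)=\frac{n-2i+1}{n-i+1}\binom ni$. $r\cdot V$ denotes the direct sum of $r$ copies of $V$. $\mathbf P(k)=\{(i,j)\in\mathbb Z^2: 0\le i\le\frac{D-k}2,\ 0\le j\le\min\{D-k-i,k-i,\frac k2\}\}$. *)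

theory Defs
  imports Complex_Main "HOL-Library.Poly_Mapping" "HOL-Library.Product_Plus"
begin

section \<open>Complex vector spaces and algebras\<close>

class cvector = ab_group_add +
  fixes scaleC :: "complex \<Rightarrow> 'a \<Rightarrow> 'a"  (infixr \<open>*\<^sub>C\<close> 75)
  assumes scaleC_add_right: "a *\<^sub>C (x + y) = a *\<^sub>C x + a *\<^sub>C y"
    and scaleC_add_left: "(a + b) *\<^sub>C x = a *\<^sub>C x + b *\<^sub>C x"
    and scaleC_scaleC [simp]: "a *\<^sub>C b *\<^sub>C x = (a * b) *\<^sub>C x"
    and scaleC_one [simp]: "1 *\<^sub>C x = x"

global_interpretation cvec: vector_space "scaleC :: complex \<Rightarrow> 'a \<Rightarrow> 'a :: cvector"
  by unfold_locales (simp_all add: scaleC_add_right scaleC_add_left)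

text \<open>The class \<open>ring_1\<close> is not used since it demands \<open>0 \<noteq> 1\<close>, which may fail
  in an algebra given by generators and relations.\<close>

class calgebra = cvector + ring + monoid_mult +
  assumes mult_scaleC_left [simp]: "(a *\<^sub>C x) * y = a *\<^sub>C (x * y)"
    and mult_scaleC_right [simp]: "x * (a *\<^sub>C y) = a *\<^sub>C (x * y)"

instantiation poly_mapping :: (type, cvector) cvector
begin

lift_definition scaleC_poly_mapping :: "complex \<Rightarrow> ('a \<Rightarrow>\<^sub>0 'b) \<Rightarrow> ('a \<Rightarrow>\<^sub>0 'b)"
  is "\<lambda>c f x. c *\<^sub>C f x"
  by (rule finite_subset[rotated]) auto

instance
  by standard (transfer, simp add: scaleC_add_right scaleC_add_left)+

end

instantiation complex :: cvector
begin

definition scaleC_complex :: "complex \<Rightarrow> complex \<Rightarrow> complex" where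
  "scaleC_complex c x = c * x"

instance
  by standard (simp_all add: scaleC_complex_def algebra_simps)

end

instantiation prod :: (cvector, cvector) cvector
begin

definition scaleC_prod :: "complex \<Rightarrow> 'a \<times> 'b \<Rightarrow> 'a \<times> 'b" where
  "scaleC_prod c v = (c *\<^sub>C fst v, c *\<^sub>C snd v)"

instance
  by standard (simp_all add: scaleC_prod_def scaleC_add_right scaleC_add_left plus_prod_def)

end

definition alg_hom :: "('a::calgebra \<Rightarrow> 'b::calgebra) \<Rightarrow> bool" where
  "alg_hom f \<longleftrightarrow> f 1 = 1 \<and> (\<forall>x y. f (x + y) = f x + f y) \<and> (\<forall>x y. f (x * y) = f x * f y)
     \<and> (\<forall>c x. f (c *\<^sub>C x) = c *\<^sub>C f x)"


section \<open>Algebras given by generators and relations\<close>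

datatype 'g aexp = Gen 'g | Scal complex | Add "'g aexp" "'g aexp" | Mul "'g aexp" "'g aexp"

class presentation =
  fixes defrel :: "'a aexp \<Rightarrow> 'a aexp \<Rightarrow> bool"

text \<open>The least congruence on expressions in the generators that contains the defining relations
  and the axioms of unital associative \<open>\<complex>\<close>-algebras.\<close>

inductive acong :: "'g::presentation aexp \<Rightarrow> 'g aexp \<Rightarrow> bool" where
  rel: "defrel p q \<Longrightarrow> acong p q"
| refl: "acong p p"
| sym: "acong p q \<Longrightarrow> acong q p"
| trans: "acong p q \<Longrightarrow> acong q r \<Longrightarrow> acong p r"
| add: "acong p p' \<Longrightarrow> acong q q' \<Longrightarrow> acong (Add p q) (Add p' q')"
| mul: "acong p p' \<Longrightarrow> acong q q' \<Longrightarrow> acong (Mul p q) (Mul p' q')"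
| add_assoc: "acong (Add (Add p q) r) (Add p (Add q r))"
| add_comm: "acong (Add p q) (Add q p)"
| add_zero: "acong (Add (Scal 0) p) p"
| add_inv: "acong (Add (Mul (Scal (-1)) p) p) (Scal 0)"
| mul_assoc: "acong (Mul (Mul p q) r) (Mul p (Mul q r))"
| mul_one: "acong (Mul (Scal 1) p) p"
| distrib_left: "acong (Mul p (Add q r)) (Add (Mul p q) (Mul p r))"
| distrib_right: "acong (Mul (Add p q) r) (Add (Mul p r) (Mul q r))"
| scal_add: "acong (Scal (a + b)) (Add (Scal a) (Scal b))"
| scal_mul: "acong (Scal (a * b)) (Mul (Scal a) (Scal b))"
| scal_central: "acong (Mul p (Scal a)) (Mul (Scal a) p)"

text \<open>The algebra generated by the elements of \<open>'g\<close> subject to the relations \<open>defrel\<close>.\<close>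

quotient_type (overloaded) 'g palg = "'g::presentation aexp" / acong
  by (intro equivpI reflpI sympI transpI) (auto intro: acong.refl acong.sym acong.trans)

lift_definition gen :: "'g::presentation \<Rightarrow> 'g palg" is Gen .

instantiation palg :: (presentation) calgebra
begin

lift_definition zero_palg :: "'a palg" is "Scal 0" .
lift_definition one_palg :: "'a palg" is "Scal 1" .
lift_definition plus_palg :: "'a palg \<Rightarrow> 'a palg \<Rightarrow> 'a palg" is Add by (rule acong.add)
lift_definition times_palg :: "'a palg \<Rightarrow> 'a palg \<Rightarrow> 'a palg" is Mul by (rule acong.mul)
lift_definition scaleC_palg :: "complex \<Rightarrow> 'a palg \<Rightarrow> 'a palg" is "\<lambda>c. Mul (Scal c)"
  by (rule acong.mul[OF acong.refl])
definition uminus_palg :: "'a palg \<Rightarrow> 'a palg" where "uminus_palg x = (-1) *\<^sub>C x"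
definition minus_palg :: "'a palg \<Rightarrow> 'a palg \<Rightarrow> 'a palg" where "minus_palg x y = x + (-1) *\<^sub>C y"

instance
proof
  fix x y z :: "'a palg" and a b :: complex
  show "x + y + z = x + (y + z)" by transfer (rule acong.add_assoc)
  show "x + y = y + x" by transfer (rule acong.add_comm)
  show "0 + x = x" by transfer (rule acong.add_zero)
  show "- x + x = 0" unfolding uminus_palg_def by transfer (rule acong.add_inv)
  show "x - y = x + - y" by (simp add: uminus_palg_def minus_palg_def)
  show "x * y * z = x * (y * z)" by transfer (rule acong.mul_assoc)
  show "(x + y) * z = x * z + y * z" by transfer (rule acong.distrib_right)
  show "x * (y + z) = x * y + x * z" by transfer (rule acong.distrib_left)
  show "1 * x = x" by transfer (rule acong.mul_one)
  show "x * 1 = x" by transfer (blast intro: acong.mul_one acong.scal_central acong.trans)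
  show "a *\<^sub>C (x + y) = a *\<^sub>C x + a *\<^sub>C y" by transfer (rule acong.distrib_left)
  show "(a + b) *\<^sub>C x = a *\<^sub>C x + b *\<^sub>C x"
    by transfer (blast intro: acong.intros)
  show "a *\<^sub>C b *\<^sub>C x = (a * b) *\<^sub>C x"
    by transfer (metis acong.sym acong.trans acong.mul_assoc acong.mul acong.refl acong.scal_mul)
  show "1 *\<^sub>C x = x" by transfer (rule acong.mul_one)
  show "(a *\<^sub>C x) * y = a *\<^sub>C (x * y)" by transfer (rule acong.mul_assoc)
  show "x * (a *\<^sub>C y) = a *\<^sub>C (x * y)"
    by transfer (metis acong.sym acong.trans acong.mul_assoc acong.mul acong.refl acong.scal_central)
qed

end

primrec aeval :: "('g \<Rightarrow> 'a::calgebra) \<Rightarrow> 'g aexp \<Rightarrow> 'a" where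
  "aeval \<phi> (Gen g) = \<phi> g"
| "aeval \<phi> (Scal c) = c *\<^sub>C 1"
| "aeval \<phi> (Add p q) = aeval \<phi> p + aeval \<phi> q"
| "aeval \<phi> (Mul p q) = aeval \<phi> p * aeval \<phi> q"

text \<open>The homomorphism with prescribed values on the generators; independent of the
  chosen representative as soon as these values satisfy the defining relations.\<close>

definition palg_lift :: "('g::presentation \<Rightarrow> 'a::calgebra) \<Rightarrow> 'g palg \<Rightarrow> 'a" where
  "palg_lift \<phi> u = aeval \<phi> (rep_palg u)"

lemma aeval_cong:
  assumes "acong p q" and "\<And>p q. defrel p q \<Longrightarrow> aeval \<phi> p = aeval \<phi> q"
  shows "aeval \<phi> p = aeval \<phi> q"
  using assms(1)
  by induction (simp_all add: assms(2) algebra_simps scaleC_add_left)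

lemma acong_rep: "acong (rep_palg (abs_palg p)) p"
  by (rule Quotient3_rep_abs[OF Quotient3_palg]) (rule acong.refl)

lemma palg_lift_abs:
  assumes "\<And>p q. defrel p q \<Longrightarrow> aeval \<phi> p = aeval \<phi> q"
  shows "palg_lift \<phi> (abs_palg p) = aeval \<phi> p"
  unfolding palg_lift_def by (rule aeval_cong[OF acong_rep assms])

lemma palg_lift:
  assumes "\<And>p q. defrel p q \<Longrightarrow> aeval \<phi> p = aeval \<phi> q"
  shows "alg_hom (palg_lift \<phi>)" "palg_lift \<phi> (gen g) = \<phi> g"
proof -
  note L = palg_lift_abs[OF assms]
  show "palg_lift \<phi> (gen g) = \<phi> g"
    by (simp add: gen.abs_eq L)
  have 1: "palg_lift \<phi> 1 = 1" by (simp add: one_palg.abs_eq L)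
  have 2: "palg_lift \<phi> (x + y) = palg_lift \<phi> x + palg_lift \<phi> y" for x y
    by (induction x rule: palg.abs_induct, induction y rule: palg.abs_induct)
      (simp add: plus_palg.abs_eq L)
  have 3: "palg_lift \<phi> (x * y) = palg_lift \<phi> x * palg_lift \<phi> y" for x y
    by (induction x rule: palg.abs_induct, induction y rule: palg.abs_induct)
      (simp add: times_palg.abs_eq L)
  have 4: "palg_lift \<phi> (c *\<^sub>C x) = c *\<^sub>C palg_lift \<phi> x" for c x
    by (induction x rule: palg.abs_induct) (simp add: scaleC_palg.abs_eq L)
  show "alg_hom (palg_lift \<phi>)"
    unfolding alg_hom_def using 1 2 3 4 by blast
qed

abbreviation asub :: "'g aexp \<Rightarrow> 'g aexp \<Rightarrow> 'g aexp" where
  "asub p q \<equiv> Add p (Mul (Scal (-1)) q)"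

abbreviation acomm :: "'g aexp \<Rightarrow> 'g aexp \<Rightarrow> 'g aexp" where
  "acomm p q \<equiv> asub (Mul p q) (Mul q p)"

lemma abs_palg_simps:
  "abs_palg (Gen g) = gen g"
  "abs_palg (Scal c) = c *\<^sub>C 1"
  "abs_palg (Add p q) = abs_palg p + abs_palg q"
  "abs_palg (Mul p q) = abs_palg p * abs_palg q"
  subgoal by (simp add: gen.abs_eq)
  subgoal
  proof -
    have "acong (Scal c) (Mul (Scal c) (Scal 1))" using acong.scal_mul[of c 1] by simp
    then show ?thesis
      by (simp add: one_palg.abs_eq scaleC_palg.abs_eq palg.abs_eq_iff)
  qed
  by (simp_all add: plus_palg.abs_eq times_palg.abs_eq)

lemma defrel_abs: "defrel p q \<Longrightarrow> abs_palg p = abs_palg q"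
  by (simp add: palg.abs_eq_iff acong.rel)


section \<open>Tensor product of algebras\<close>

datatype ('a, 'b) tgen = TGen 'a 'b

inductive tensor_rel ::
  "('a::calgebra, 'b::calgebra) tgen aexp \<Rightarrow> ('a, 'b) tgen aexp \<Rightarrow> bool" where
  "tensor_rel (Gen (TGen (a + a') b)) (Add (Gen (TGen a b)) (Gen (TGen a' b)))"
| "tensor_rel (Gen (TGen a (b + b'))) (Add (Gen (TGen a b)) (Gen (TGen a b')))"
| "tensor_rel (Gen (TGen (c *\<^sub>C a) b)) (Mul (Scal c) (Gen (TGen a b)))"
| "tensor_rel (Gen (TGen a (c *\<^sub>C b))) (Mul (Scal c) (Gen (TGen a b)))"
| "tensor_rel (Mul (Gen (TGen a b)) (Gen (TGen a' b'))) (Gen (TGen (a * a') (b * b')))"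
| "tensor_rel (Gen (TGen 1 1)) (Scal 1)"

instantiation tgen :: (calgebra, calgebra) presentation
begin
definition defrel_tgen :: "('a, 'b) tgen aexp \<Rightarrow> ('a, 'b) tgen aexp \<Rightarrow> bool" where
  "defrel_tgen = tensor_rel"
instance ..
end

type_synonym ('a, 'b) tensor_alg = "('a, 'b) tgen palg"

definition tens :: "'a::calgebra \<Rightarrow> 'b::calgebra \<Rightarrow> ('a, 'b) tensor_alg"  (infixr \<open>\<otimes>\<^sub>a\<close> 72) where
  "a \<otimes>\<^sub>a b = gen (TGen a b)"

lemma tens_simps:
  fixes a a' :: "'a::calgebra" and b b' :: "'b::calgebra"
  shows "(a + a') \<otimes>\<^sub>a b = a \<otimes>\<^sub>a b + a' \<otimes>\<^sub>a b"
  "a \<otimes>\<^sub>a (b + b') = a \<otimes>\<^sub>a b + a \<otimes>\<^sub>a b'"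
  "(c *\<^sub>C a) \<otimes>\<^sub>a b = c *\<^sub>C (a \<otimes>\<^sub>a b)"
  "a \<otimes>\<^sub>a (c *\<^sub>C b) = c *\<^sub>C (a \<otimes>\<^sub>a b)"
  "(a \<otimes>\<^sub>a b) * (a' \<otimes>\<^sub>a b') = (a * a') \<otimes>\<^sub>a (b * b')"
  "(1::'a) \<otimes>\<^sub>a (1::'b) = 1"
proof -
  have D: "tensor_rel p q \<Longrightarrow> abs_palg p = abs_palg q" for p q :: "('a, 'b) tgen aexp"
    by (simp add: defrel_abs defrel_tgen_def)
  note [simp] = abs_palg_simps tens_def
  show "(a + a') \<otimes>\<^sub>a b = a \<otimes>\<^sub>a b + a' \<otimes>\<^sub>a b" using D[OF tensor_rel.intros(1)] by simp
  show "a \<otimes>\<^sub>a (b + b') = a \<otimes>\<^sub>a b + a \<otimes>\<^sub>a b'" using D[OF tensor_rel.intros(2)] by simp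
  show "(c *\<^sub>C a) \<otimes>\<^sub>a b = c *\<^sub>C (a \<otimes>\<^sub>a b)" using D[OF tensor_rel.intros(3)] by simp
  show "a \<otimes>\<^sub>a (c *\<^sub>C b) = c *\<^sub>C (a \<otimes>\<^sub>a b)" using D[OF tensor_rel.intros(4)] by simp
  show "(a \<otimes>\<^sub>a b) * (a' \<otimes>\<^sub>a b') = (a * a') \<otimes>\<^sub>a (b * b')" using D[OF tensor_rel.intros(5)] by simp
  show "(1::'a) \<otimes>\<^sub>a (1::'b) = 1" using D[OF tensor_rel.intros(6)] by simp
qed


section \<open>The algebra \<open>U(sl\<^sub>2)\<close> and the universal Hahn algebra\<close>

datatype sl2_gen = GE | GF | GH

instantiation sl2_gen :: presentation
begin
definition defrel_sl2_gen :: "sl2_gen aexp \<Rightarrow> sl2_gen aexp \<Rightarrow> bool" where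
  "defrel_sl2_gen p q \<longleftrightarrow> (p, q) \<in>
     {(acomm (Gen GH) (Gen GE), Mul (Scal 2) (Gen GE)),
      (acomm (Gen GH) (Gen GF), Mul (Scal (-2)) (Gen GF)),
      (acomm (Gen GE) (Gen GF), Gen GH)}"
instance ..
end

type_synonym usl2 = "sl2_gen palg"
type_synonym usl2_2 = "(usl2, usl2) tensor_alg"

abbreviation UE :: usl2 where "UE \<equiv> gen GE"
abbreviation UF :: usl2 where "UF \<equiv> gen GF"
abbreviation UH :: usl2 where "UH \<equiv> gen GH"

lemma sl2_rels: "UH * UE - UE * UH = 2 *\<^sub>C UE" "UH * UF - UF * UH = (-2) *\<^sub>C UF" "UE * UF - UF * UE = UH"
  using defrel_abs[of "acomm (Gen GH) (Gen GE)" "Mul (Scal 2) (Gen GE)"]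
    defrel_abs[of "acomm (Gen GH) (Gen GF)" "Mul (Scal (-2)) (Gen GF)"]
    defrel_abs[of "acomm (Gen GE) (Gen GF)" "Gen GH"]
  by (simp_all add: defrel_sl2_gen_def abs_palg_simps)

definition Casimir :: usl2  (\<open>\<Lambda>\<close>) where
  "\<Lambda> = UE * UF + UF * UE + (1/2) *\<^sub>C UH ^ 2"

definition comul :: "usl2 \<Rightarrow> usl2_2"  (\<open>\<Delta>\<close>) where
  "\<Delta> = palg_lift (\<lambda>g. gen g \<otimes>\<^sub>a 1 + 1 \<otimes>\<^sub>a gen g)"

datatype hahn_gen = GA | GB | GC

definition hahn_alpha :: "hahn_gen aexp" where
  "hahn_alpha = Add (Add (acomm (Gen GC) (Gen GA)) (Mul (Scal 2) (Mul (Gen GA) (Gen GA)))) (Gen GB)"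

definition hahn_beta :: "hahn_gen aexp" where
  "hahn_beta = Add (Add (acomm (Gen GB) (Gen GC)) (Mul (Scal 4) (Mul (Gen GB) (Gen GA))))
     (Mul (Scal 2) (Gen GC))"

inductive hahn_rel :: "hahn_gen aexp \<Rightarrow> hahn_gen aexp \<Rightarrow> bool" where
  "hahn_rel (acomm (Gen GA) (Gen GB)) (Gen GC)"
| "hahn_rel (Mul hahn_alpha p) (Mul p hahn_alpha)"
| "hahn_rel (Mul hahn_beta p) (Mul p hahn_beta)"

instantiation hahn_gen :: presentation
begin
definition defrel_hahn_gen :: "hahn_gen aexp \<Rightarrow> hahn_gen aexp \<Rightarrow> bool" where
  "defrel_hahn_gen = hahn_rel"
instance ..
end

type_synonym hahn = "hahn_gen palg"

primrec natural_gen :: "hahn_gen \<Rightarrow> usl2_2" where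
  "natural_gen GA = (1/4) *\<^sub>C (UH \<otimes>\<^sub>a 1 - 1 \<otimes>\<^sub>a UH)"
| "natural_gen GB = (1/2) *\<^sub>C \<Delta> \<Lambda>"
| "natural_gen GC = UE \<otimes>\<^sub>a UF - UF \<otimes>\<^sub>a UE"

definition natural :: "hahn \<Rightarrow> usl2_2"  (\<open>\<natural>\<close>) where
  "\<natural> = palg_lift natural_gen"


lemma hahn_identities:
  fixes e1 f1 h1 e2 f2 h2 :: "'a::calgebra"
  assumes r1: "h1 * e1 = e1 * h1 + (e1 + e1)" "h1 * f1 = f1 * h1 - (f1 + f1)" "e1 * f1 = f1 * e1 + h1"
    and r2: "h2 * e2 = e2 * h2 + (e2 + e2)" "h2 * f2 = f2 * h2 - (f2 + f2)" "e2 * f2 = f2 * e2 + h2"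
    and c: "e2 * e1 = e1 * e2" "e2 * f1 = f1 * e2" "e2 * h1 = h1 * e2"
       "f2 * e1 = e1 * f2" "f2 * f1 = f1 * f2" "f2 * h1 = h1 * f2"
       "h2 * e1 = e1 * h2" "h2 * f1 = f1 * h2" "h2 * h1 = h1 * h2"
  defines "a \<equiv> h1 - h2" and "k1 \<equiv> 2 *\<^sub>C (e1 * f1 + f1 * e1) + h1 * h1"
    and "k2 \<equiv> 2 *\<^sub>C (e2 * f2 + f2 * e2) + h2 * h2" and "h \<equiv> h1 + h2"
    and "b \<equiv> 2 *\<^sub>C ((e1 + e2) * (f1 + f2) + (f1 + f2) * (e1 + e2)) + (h1 + h2) * (h1 + h2)"
    and "cc \<equiv> e1 * f2 - f1 * e2"
  shows "a * b - b * a = 16 *\<^sub>C cc"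
    and "2 *\<^sub>C (cc * a - a * cc) + a * a + 2 *\<^sub>C b = h * h + 2 *\<^sub>C (k1 + k2)"
    and "b * cc - cc * b + b * a + 8 *\<^sub>C cc = (k1 - k2) * h"
    and "\<forall>x\<in>{a, b, cc}. h * x = x * h"
    and "\<forall>x\<in>{a, b, cc}. k1 * x = x * k1"
    and "\<forall>x\<in>{a, b, cc}. k2 * x = x * k2"
proof -
  have A: "u * v = w \<Longrightarrow> u * (v * z) = w * z" for u v w z :: 'a
    by (simp add: mult.assoc[symmetric])
  have e1h1: "e1 * h1 = h1 * e1 - (e1 + e1)" "e2 * h2 = h2 * e2 - (e2 + e2)"
    using r1(1) r2(1) by simp_all
  have sc: "numeral (Num.Bit0 n) *\<^sub>C u = numeral n *\<^sub>C u + numeral n *\<^sub>C u" for n and u :: 'a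
    by (simp only: numeral_Bit0 scaleC_add_left)
  note R = e1h1 r1(2,3) r2(2,3) c
  note N = R R[THEN A]
  note defs = a_def k1_def k2_def h_def b_def cc_def
  show "a * b - b * a = 16 *\<^sub>C cc"
    unfolding defs by (simp add: N algebra_simps sc)
  show "2 *\<^sub>C (cc * a - a * cc) + a * a + 2 *\<^sub>C b = h * h + 2 *\<^sub>C (k1 + k2)"
    unfolding defs by (simp add: N algebra_simps sc)
  show "b * cc - cc * b + b * a + 8 *\<^sub>C cc = (k1 - k2) * h"
    unfolding defs by (simp add: N algebra_simps sc)
  show "\<forall>x\<in>{a, b, cc}. h * x = x * h"
    unfolding defs by (simp add: N algebra_simps sc)
  show "\<forall>x\<in>{a, b, cc}. k1 * x = x * k1"
    unfolding defs by (simp add: N algebra_simps sc)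
  show "\<forall>x\<in>{a, b, cc}. k2 * x = x * k2"
    unfolding defs by (simp add: N algebra_simps sc)
qed


lemma sl2_rewrite:
  "UH * UE = UE * UH + (UE + UE)" "UH * UF = UF * UH - (UF + UF)" "UE * UF = UF * UE + UH"
  using sl2_rels by (simp_all add: algebra_simps flip: scaleC_add_left[of 1 1, simplified])

lemma tens_zero: "a \<otimes>\<^sub>a 0 = 0" "0 \<otimes>\<^sub>a b = 0"
  using tens_simps(3)[of 0 0 b] tens_simps(4)[of a 0 0] by simp_all

lemma tens_diff:
  "(a - a') \<otimes>\<^sub>a b = a \<otimes>\<^sub>a b - a' \<otimes>\<^sub>a b" "a \<otimes>\<^sub>a (b - b') = a \<otimes>\<^sub>a b - a \<otimes>\<^sub>a b'"
  subgoal using tens_simps(1)[of "a - a'" a' b] by (simp add: algebra_simps)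
  subgoal using tens_simps(2)[of a "b - b'" b'] by (simp add: algebra_simps)
  done

lemma comul_hom: "alg_hom \<Delta>" "\<Delta> (gen g) = gen g \<otimes>\<^sub>a 1 + 1 \<otimes>\<^sub>a gen g"
proof -
  define \<phi> :: "sl2_gen \<Rightarrow> usl2_2" where "\<phi> = (\<lambda>g. gen g \<otimes>\<^sub>a 1 + 1 \<otimes>\<^sub>a gen g)"
  have two: "2 *\<^sub>C x = x + x" for x :: usl2_2
    by (simp flip: scaleC_add_left[of 1 1, simplified])
  have "aeval \<phi> p = aeval \<phi> q" if "defrel p q" for p q
    using that unfolding defrel_sl2_gen_def
    by (auto simp: \<phi>_def algebra_simps tens_simps tens_diff sl2_rewrite two)
  then show "alg_hom \<Delta>" "\<Delta> (gen g) = gen g \<otimes>\<^sub>a 1 + 1 \<otimes>\<^sub>a gen g"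
    unfolding comul_def \<phi>_def[symmetric] using palg_lift[of \<phi>] by (auto simp: \<phi>_def)
qed

lemma natural_hom:
  "alg_hom \<natural>" "\<natural> (gen g) = natural_gen g" "\<Delta> UH * \<natural> u = \<natural> u * \<Delta> UH"
proof -
  let ?e1 = "UE \<otimes>\<^sub>a 1 :: usl2_2" and ?f1 = "UF \<otimes>\<^sub>a 1 :: usl2_2" and ?h1 = "UH \<otimes>\<^sub>a 1 :: usl2_2"
  let ?e2 = "1 \<otimes>\<^sub>a UE :: usl2_2" and ?f2 = "1 \<otimes>\<^sub>a UF :: usl2_2" and ?h2 = "1 \<otimes>\<^sub>a UH :: usl2_2"
  have r1: "?h1 * ?e1 = ?e1 * ?h1 + (?e1 + ?e1)" "?h1 * ?f1 = ?f1 * ?h1 - (?f1 + ?f1)"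
      "?e1 * ?f1 = ?f1 * ?e1 + ?h1"
    and r2: "?h2 * ?e2 = ?e2 * ?h2 + (?e2 + ?e2)" "?h2 * ?f2 = ?f2 * ?h2 - (?f2 + ?f2)"
      "?e2 * ?f2 = ?f2 * ?e2 + ?h2"
    by (simp_all add: tens_simps tens_diff sl2_rewrite)
  have c: "?e2 * ?e1 = ?e1 * ?e2" "?e2 * ?f1 = ?f1 * ?e2" "?e2 * ?h1 = ?h1 * ?e2"
       "?f2 * ?e1 = ?e1 * ?f2" "?f2 * ?f1 = ?f1 * ?f2" "?f2 * ?h1 = ?h1 * ?f2"
       "?h2 * ?e1 = ?e1 * ?h2" "?h2 * ?f1 = ?f1 * ?h2" "?h2 * ?h1 = ?h1 * ?h2"
    by (simp_all add: tens_simps)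
  note I = hahn_identities[OF r1 r2 c]
  define a where "a = ?h1 - ?h2"
  define k1 where "k1 = 2 *\<^sub>C (?e1 * ?f1 + ?f1 * ?e1) + ?h1 * ?h1"
  define k2 where "k2 = 2 *\<^sub>C (?e2 * ?f2 + ?f2 * ?e2) + ?h2 * ?h2"
  define h where "h = ?h1 + ?h2"
  define b where "b = 2 *\<^sub>C ((?e1 + ?e2) * (?f1 + ?f2) + (?f1 + ?f2) * (?e1 + ?e2))
      + (?h1 + ?h2) * (?h1 + ?h2)"
  define cc where "cc = ?e1 * ?f2 - ?f1 * ?e2"
  note I = I[folded a_def k1_def k2_def h_def b_def cc_def]
  have gA: "natural_gen GA = (1/4) *\<^sub>C a" by (simp add: a_def)
  have "\<Delta> \<Lambda> = (?e1 + ?e2) * (?f1 + ?f2) + (?f1 + ?f2) * (?e1 + ?e2)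
      + (1/2) *\<^sub>C ((?h1 + ?h2) * (?h1 + ?h2))"
    using comul_hom unfolding Casimir_def alg_hom_def by (simp add: power2_eq_square)
  then have gB: "natural_gen GB = (1/4) *\<^sub>C b" by (simp add: b_def scaleC_add_right)
  have gC: "natural_gen GC = cc" by (simp add: cc_def tens_simps)
  have alpha: "aeval natural_gen hahn_alpha = (1/8) *\<^sub>C (h * h + 2 *\<^sub>C (k1 + k2))"
    unfolding I(2)[symmetric] hahn_alpha_def aeval.simps gA gB gC
    by (simp add: algebra_simps scaleC_add_right cvec.scale_right_diff_distrib)
  have beta: "aeval natural_gen hahn_beta = (1/4) *\<^sub>C ((k1 - k2) * h)"
    unfolding I(3)[symmetric] hahn_beta_def aeval.simps gA gB gC
    by (simp add: algebra_simps scaleC_add_right cvec.scale_right_diff_distrib)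
  have gens: "z * aeval natural_gen p = aeval natural_gen p * z"
    if z: "\<forall>x\<in>{a, b, cc}. z * x = x * z" for z p
  proof (induction p)
    case (Gen g)
    then show ?case using z by (cases g) (simp_all only: aeval.simps gA gB gC, simp_all)
  next
    case (Mul p q)
    then show ?case by (metis aeval.simps(4) mult.assoc)
  qed (simp_all add: algebra_simps)
  have comm: "(x * y) * u = u * (x * y)" if "x * u = u * x" "y * u = u * y" for x y u :: usl2_2
    using that by (metis mult.assoc)
  have "aeval natural_gen p = aeval natural_gen q" if "defrel p q" for p q
    using that unfolding defrel_hahn_gen_def
  proof cases
    case 1
    then show ?thesis using I(1)
      by (simp only: aeval.simps gA gB gC) (simp flip: cvec.scale_right_diff_distrib)
  next
    case (2 r)
    have "(1/8) *\<^sub>C (h * h + 2 *\<^sub>C (k1 + k2)) * x = x * (1/8) *\<^sub>C (h * h + 2 *\<^sub>C (k1 + k2))"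
      if "x \<in> {a, b, cc}" for x
      using I(4-6)[rule_format, OF that] comm[of h x h] by (simp add: algebra_simps)
    then show ?thesis using 2 gens[of _ r] by (simp add: alpha del: mult_scaleC_left mult_scaleC_right)
  next
    case (3 r)
    have "(1/4) *\<^sub>C ((k1 - k2) * h) * x = x * (1/4) *\<^sub>C ((k1 - k2) * h)"
      if "x \<in> {a, b, cc}" for x
      using I(4-6)[rule_format, OF that] comm[of "k1 - k2" x h]
      by (simp add: left_diff_distrib right_diff_distrib mult.assoc)
    then show ?thesis using 3 gens[of _ r] by (simp add: beta del: mult_scaleC_left mult_scaleC_right)
  qed
  then show "alg_hom \<natural>" "\<natural> (gen g) = natural_gen g"
    unfolding natural_def using palg_lift[of natural_gen] by auto
  have "\<Delta> UH = h" by (simp add: h_def comul_hom)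
  then show "\<Delta> UH * \<natural> u = \<natural> u * \<Delta> UH"
    unfolding natural_def palg_lift_def using gens I(4) by simp
qed


section \<open>Modules\<close>

text \<open>A module over an algebra is a subspace of the type \<open>'v\<close> together with an action;
  the values of the action outside the carrier are irrelevant.\<close>

record ('a, 'v) cmodule =
  mcarrier :: "'v set"
  act :: "'a \<Rightarrow> 'v \<Rightarrow> 'v"

definition lin_on :: "'v::cvector set \<Rightarrow> ('v \<Rightarrow> 'w::cvector) \<Rightarrow> bool" where
  "lin_on V f \<longleftrightarrow> (\<forall>v\<in>V. \<forall>w\<in>V. f (v + w) = f v + f w) \<and> (\<forall>c. \<forall>v\<in>V. f (c *\<^sub>C v) = c *\<^sub>C f v)"

definition is_module :: "('a::calgebra, 'v::cvector) cmodule \<Rightarrow> bool" where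
  "is_module M \<longleftrightarrow> cvec.subspace (mcarrier M) \<and>
     (\<forall>a. act M a ` mcarrier M \<subseteq> mcarrier M \<and> lin_on (mcarrier M) (act M a)) \<and>
     (\<forall>v\<in>mcarrier M. act M 1 v = v \<and>
        (\<forall>a b. act M (a + b) v = act M a v + act M b v) \<and>
        (\<forall>a b. act M (a * b) v = act M a (act M b v)) \<and>
        (\<forall>c a. act M (c *\<^sub>C a) v = c *\<^sub>C act M a v))"

lemma is_moduleD:
  assumes "is_module M"
  shows "cvec.subspace (mcarrier M)"
    and "v \<in> mcarrier M \<Longrightarrow> act M a v \<in> mcarrier M"
    and "lin_on (mcarrier M) (act M a)"
    and "v \<in> mcarrier M \<Longrightarrow> w \<in> mcarrier M \<Longrightarrow> act M a (v + w) = act M a v + act M a w"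
    and "v \<in> mcarrier M \<Longrightarrow> act M a (c *\<^sub>C v) = c *\<^sub>C act M a v"
    and "v \<in> mcarrier M \<Longrightarrow> act M 1 v = v"
    and "v \<in> mcarrier M \<Longrightarrow> act M (a + b) v = act M a v + act M b v"
    and "v \<in> mcarrier M \<Longrightarrow> act M (a * b) v = act M a (act M b v)"
    and "v \<in> mcarrier M \<Longrightarrow> act M (c *\<^sub>C a) v = c *\<^sub>C act M a v"
  using assms by (auto simp: is_module_def lin_on_def image_subset_iff)

lemma is_moduleI:
  assumes "cvec.subspace (mcarrier M)"
    and "\<And>a v. v \<in> mcarrier M \<Longrightarrow> act M a v \<in> mcarrier M"
    and "\<And>a v w. v \<in> mcarrier M \<Longrightarrow> w \<in> mcarrier M \<Longrightarrow> act M a (v + w) = act M a v + act M a w"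
    and "\<And>a c v. v \<in> mcarrier M \<Longrightarrow> act M a (c *\<^sub>C v) = c *\<^sub>C act M a v"
    and "\<And>v. v \<in> mcarrier M \<Longrightarrow> act M 1 v = v"
    and "\<And>a b v. v \<in> mcarrier M \<Longrightarrow> act M (a + b) v = act M a v + act M b v"
    and "\<And>a b v. v \<in> mcarrier M \<Longrightarrow> act M (a * b) v = act M a (act M b v)"
    and "\<And>a c v. v \<in> mcarrier M \<Longrightarrow> act M (c *\<^sub>C a) v = c *\<^sub>C act M a v"
  shows "is_module M"
  unfolding is_module_def lin_on_def image_subset_iff
  by (intro conjI allI ballI) (rule assms; assumption)+

definition submodule :: "'v::cvector set \<Rightarrow> ('a, 'v) cmodule \<Rightarrow> bool" where
  "submodule W M \<longleftrightarrow> cvec.subspace W \<and> W \<subseteq> mcarrier M \<and> (\<forall>a. act M a ` W \<subseteq> W)"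

definition irreducible_module :: "('a::calgebra, 'v::cvector) cmodule \<Rightarrow> bool" where
  "irreducible_module M \<longleftrightarrow> is_module M \<and> mcarrier M \<noteq> {0} \<and>
     (\<forall>W. submodule W M \<longrightarrow> W = {0} \<or> W = mcarrier M)"

definition mod_iso :: "('a, 'v::cvector) cmodule \<Rightarrow> ('a, 'w::cvector) cmodule \<Rightarrow> bool"  (infix \<open>\<cong>\<^sub>m\<close> 50) where
  "M \<cong>\<^sub>m N \<longleftrightarrow> (\<exists>f. bij_betw f (mcarrier M) (mcarrier N) \<and> lin_on (mcarrier M) f \<and>
     (\<forall>a. \<forall>v\<in>mcarrier M. f (act M a v) = act N a (f v)))"

definition dsum :: "'i set \<Rightarrow> ('i \<Rightarrow> ('a, 'v::cvector) cmodule) \<Rightarrow> ('a, 'i \<Rightarrow>\<^sub>0 'v) cmodule" where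
  "dsum I M = \<lparr>mcarrier = {f. Poly_Mapping.keys f \<subseteq> I \<and> (\<forall>i\<in>I. Poly_Mapping.lookup f i \<in> mcarrier (M i))},
     act = (\<lambda>a. Poly_Mapping.mapp (\<lambda>i. act (M i) a))\<rparr>"

definition dsum2 :: "('a, 'v) cmodule \<Rightarrow> ('a, 'w) cmodule \<Rightarrow> ('a, 'v \<times> 'w) cmodule"  (infixr \<open>\<oplus>\<^sub>m\<close> 65) where
  "M \<oplus>\<^sub>m N = \<lparr>mcarrier = mcarrier M \<times> mcarrier N, act = (\<lambda>a. map_prod (act M a) (act N a))\<rparr>"

definition copies :: "nat \<Rightarrow> ('a, 'v::cvector) cmodule \<Rightarrow> ('a, nat \<Rightarrow>\<^sub>0 'v) cmodule" where
  "copies r M = dsum {..<r} (\<lambda>_. M)"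

primrec oeval :: "('g \<Rightarrow> 'v \<Rightarrow> 'v::cvector) \<Rightarrow> 'g aexp \<Rightarrow> 'v \<Rightarrow> 'v" where
  "oeval \<phi> (Gen g) v = \<phi> g v"
| "oeval \<phi> (Scal c) v = c *\<^sub>C v"
| "oeval \<phi> (Add p q) v = oeval \<phi> p v + oeval \<phi> q v"
| "oeval \<phi> (Mul p q) v = oeval \<phi> p (oeval \<phi> q v)"

text \<open>The module over a presented algebra on which the generators act by the given operators;
  independent of the chosen representative as soon as these operators satisfy the defining
  relations on the carrier.\<close>

definition gen_module :: "'v set \<Rightarrow> ('g \<Rightarrow> 'v \<Rightarrow> 'v) \<Rightarrow> ('g::presentation palg, 'v::cvector) cmodule" where
  "gen_module V \<phi> = \<lparr>mcarrier = V, act = (\<lambda>u. oeval \<phi> (rep_palg u))\<rparr>"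

locale lin_operators =
  fixes V :: "'v::cvector set" and \<phi> :: "'g::presentation \<Rightarrow> 'v \<Rightarrow> 'v"
  assumes sub: "cvec.subspace V"
    and closed: "\<And>g v. v \<in> V \<Longrightarrow> \<phi> g v \<in> V"
    and lin: "\<And>g. lin_on V (\<phi> g)"
begin

lemma oeval_closed: "v \<in> V \<Longrightarrow> oeval \<phi> p v \<in> V"
  by (induction p arbitrary: v) (auto intro: closed cvec.subspace_add cvec.subspace_scale sub)

lemma oeval_lin: "lin_on V (oeval \<phi> p)"
proof (induction p)
  case (Gen g)
  then show ?case using lin by (simp add: lin_on_def)
next
  case (Mul p q)
  then show ?case using oeval_closed by (simp add: lin_on_def)
qed (auto simp: lin_on_def scaleC_add_right algebra_simps)

end

locale operators = lin_operators +
  assumes rels: "\<And>p q v. defrel p q \<Longrightarrow> v \<in> V \<Longrightarrow> oeval \<phi> p v = oeval \<phi> q v"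
begin

lemma oeval_cong:
  assumes "acong p q" "v \<in> V"
  shows "oeval \<phi> p v = oeval \<phi> q v"
  using assms
proof (induction arbitrary: v)
  case (rel p q)
  then show ?case by (rule rels)
next
  case (mul p p' q q')
  then show ?case by (simp add: oeval_closed)
next
  case (distrib_left p q r)
  then show ?case using oeval_lin by (simp add: lin_on_def oeval_closed)
next
  case (scal_central p a)
  then show ?case using oeval_lin by (simp add: lin_on_def oeval_closed)
qed (simp_all add: algebra_simps scaleC_add_left)

lemma act_abs: "v \<in> V \<Longrightarrow> act (gen_module V \<phi>) (abs_palg p) v = oeval \<phi> p v"
  unfolding gen_module_def by (simp add: oeval_cong[OF acong_rep])

lemma act_gen: "v \<in> V \<Longrightarrow> act (gen_module V \<phi>) (gen g) v = \<phi> g v"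
  by (simp add: gen.abs_eq act_abs)

lemma is_module: "is_module (gen_module V \<phi>)"
proof -
  let ?M = "gen_module V \<phi>"
  have V: "mcarrier ?M = V" by (simp add: gen_module_def)
  have 0: "act ?M a v \<in> V" if "v \<in> V" for a v
    by (simp add: gen_module_def oeval_closed that)
  have l: "lin_on V (act ?M a)" for a
    by (simp add: gen_module_def oeval_lin)
  have 1: "act ?M 1 v = v" if "v \<in> V" for v
    using that by (simp add: one_palg.abs_eq act_abs)
  have 2: "act ?M (a + b) v = act ?M a v + act ?M b v" if "v \<in> V" for a b v
    using that by (induction a rule: palg.abs_induct, induction b rule: palg.abs_induct)
      (simp add: plus_palg.abs_eq act_abs)
  have 3: "act ?M (a * b) v = act ?M a (act ?M b v)" if "v \<in> V" for a b v
    using that by (induction a rule: palg.abs_induct, induction b rule: palg.abs_induct)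
      (simp add: times_palg.abs_eq act_abs oeval_closed)
  have 4: "act ?M (c *\<^sub>C a) v = c *\<^sub>C act ?M a v" if "v \<in> V" for c a v
    using that by (induction a rule: palg.abs_induct) (simp add: scaleC_palg.abs_eq act_abs)
  show ?thesis
    unfolding is_module_def V using sub 0 l 1 2 3 4 by blast
qed

end


section \<open>Vector spaces with a basis\<close>

text \<open>The space \<open>'b \<Rightarrow>\<^sub>0 complex\<close> has basis \<open>bvec x\<close>. Tensor products of such spaces
  are realised on pairs of basis elements.\<close>

abbreviation bvec :: "'b \<Rightarrow> ('b \<Rightarrow>\<^sub>0 complex)" where
  "bvec x \<equiv> Poly_Mapping.single x 1"

definition free_on :: "'b set \<Rightarrow> ('b \<Rightarrow>\<^sub>0 complex) set" where
  "free_on X = {v. Poly_Mapping.keys v \<subseteq> X}"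

definition lin_ext :: "('b \<Rightarrow> 'v::cvector) \<Rightarrow> ('b \<Rightarrow>\<^sub>0 complex) \<Rightarrow> 'v" where
  "lin_ext f v = (\<Sum>x\<in>Poly_Mapping.keys v. Poly_Mapping.lookup v x *\<^sub>C f x)"

lift_definition tvec :: "('b \<Rightarrow>\<^sub>0 complex) \<Rightarrow> ('c \<Rightarrow>\<^sub>0 complex) \<Rightarrow> ('b \<times> 'c \<Rightarrow>\<^sub>0 complex)"  (infixr \<open>\<otimes>\<^sub>v\<close> 72)
  is "\<lambda>v w (x, y). v x * w y"
proof -
  fix v :: "'b \<Rightarrow> complex" and w :: "'c \<Rightarrow> complex"
  assume "finite {x. v x \<noteq> 0}" "finite {y. w y \<noteq> 0}"
  then have "finite ({x. v x \<noteq> 0} \<times> {y. w y \<noteq> 0})" by simp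
  then show "finite {xy. (case xy of (x, y) \<Rightarrow> v x * w y) \<noteq> 0}"
    by (rule finite_subset[rotated]) auto
qed

lemma lin_ext_superset:
  assumes "finite A" "Poly_Mapping.keys v \<subseteq> A"
  shows "lin_ext f v = (\<Sum>x\<in>A. Poly_Mapping.lookup v x *\<^sub>C f x)"
  unfolding lin_ext_def using assms
  by (intro sum.mono_neutral_left) (auto simp: in_keys_iff)

lemma lin_ext_add: "lin_ext f (v + w) = lin_ext f v + lin_ext f w"
proof -
  let ?A = "Poly_Mapping.keys v \<union> Poly_Mapping.keys w"
  have "Poly_Mapping.keys (v + w) \<subseteq> ?A" by (rule Poly_Mapping.keys_add)
  then show ?thesis
    by (simp add: lin_ext_superset[of ?A] lookup_add scaleC_add_left sum.distrib)
qed

lemma keys_scaleC: "Poly_Mapping.keys (c *\<^sub>C v) \<subseteq> Poly_Mapping.keys v"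
  by (auto simp: in_keys_iff scaleC_poly_mapping.rep_eq)

lemma lin_ext_scale: "lin_ext f (c *\<^sub>C v) = c *\<^sub>C lin_ext f v"
  using keys_scaleC[of c v]
  by (simp add: lin_ext_superset[of "Poly_Mapping.keys v"] scaleC_poly_mapping.rep_eq
      cvec.scale_sum_right scaleC_complex_def)

lemma lin_ext_zero: "lin_ext f 0 = 0"
  by (simp add: lin_ext_def)

lemma lin_ext_sum: "lin_ext f (\<Sum>i\<in>I. v i) = (\<Sum>i\<in>I. lin_ext f (v i))"
  by (induction I rule: infinite_finite_induct) (simp_all add: lin_ext_add lin_ext_zero)

lemma lin_ext_bvec: "lin_ext f (bvec x) = f x"
  by (simp add: lin_ext_def)

lemmas lin_ext_simps = lin_ext_add lin_ext_scale lin_ext_zero lin_ext_sum lin_ext_bvec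

lemma lin_on_lin_ext: "lin_on V (lin_ext f)"
  by (simp add: lin_on_def lin_ext_add lin_ext_scale)

lemma free_on_subspace: "cvec.subspace (free_on X)"
  unfolding cvec.subspace_def free_on_def
  using Poly_Mapping.keys_add keys_scaleC by fastforce

lemma bvec_free_on: "bvec x \<in> free_on X \<longleftrightarrow> x \<in> X"
  by (simp add: free_on_def)

lemma lin_ext_expand: "lin_ext bvec v = v"
proof (rule poly_mapping_eqI)
  fix y
  show "Poly_Mapping.lookup (lin_ext bvec v) y = Poly_Mapping.lookup v y"
    by (simp add: lin_ext_def Poly_Mapping.lookup_sum scaleC_poly_mapping.rep_eq lookup_single
        scaleC_complex_def when_def in_keys_iff if_distrib cong: if_cong)
qed

lemma lin_on_expand:
  assumes "lin_on (free_on X) f" "v \<in> free_on X"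
  shows "f v = lin_ext (\<lambda>x. f (bvec x)) v"
proof -
  note S = free_on_subspace[of X]
  have f0: "f 0 = 0"
    using assms(1) cvec.subspace_0[OF S] unfolding lin_on_def by (metis cvec.scale_zero_left)
  have "f (\<Sum>x\<in>A. Poly_Mapping.lookup v x *\<^sub>C bvec x) =
      (\<Sum>x\<in>A. Poly_Mapping.lookup v x *\<^sub>C f (bvec x))" if "finite A" "A \<subseteq> X" for A
    using that
  proof induction
    case (insert x A)
    have "(\<Sum>x\<in>A. Poly_Mapping.lookup v x *\<^sub>C bvec x) \<in> free_on X"
      using insert by (intro cvec.subspace_sum[OF S] cvec.subspace_scale[OF S]) (auto simp: bvec_free_on)
    then show ?case
      using insert assms(1) by (simp add: lin_on_def bvec_free_on cvec.subspace_scale[OF S])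
  qed (simp add: f0)
  from this[of "Poly_Mapping.keys v"] show ?thesis
    using assms(2) lin_ext_expand[of v] by (simp add: lin_ext_def free_on_def)
qed

lemma lin_on_eqI:
  assumes "lin_on (free_on X) f" "lin_on (free_on X) g" "\<And>x. x \<in> X \<Longrightarrow> f (bvec x) = g (bvec x)"
    and "v \<in> free_on X"
  shows "f v = g v"
  using assms(3,4) lin_on_expand[OF assms(1,4)] lin_on_expand[OF assms(2,4)]
  by (auto simp: lin_ext_def free_on_def intro!: sum.cong)

lemma lin_ext_closed:
  assumes "cvec.subspace V" "\<And>x. x \<in> X \<Longrightarrow> f x \<in> V" "v \<in> free_on X"
  shows "lin_ext f v \<in> V"
  unfolding lin_ext_def
  using assms(2,3) by (intro cvec.subspace_sum[OF assms(1)] cvec.subspace_scale[OF assms(1)])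
    (auto simp: free_on_def)

lemma operators_free_on:
  assumes "\<And>g x. x \<in> X \<Longrightarrow> \<psi> g x \<in> free_on X"
    and "\<And>p q x. defrel p q \<Longrightarrow> x \<in> X \<Longrightarrow>
      oeval (\<lambda>g. lin_ext (\<psi> g)) p (bvec x) = oeval (\<lambda>g. lin_ext (\<psi> g)) q (bvec x)"
  shows "operators (free_on X) (\<lambda>g. lin_ext (\<psi> g))"
proof -
  interpret lin_operators "free_on X" "\<lambda>g. lin_ext (\<psi> g)"
    by unfold_locales
      (auto intro: free_on_subspace lin_on_lin_ext lin_ext_closed[OF free_on_subspace] assms(1))
  show ?thesis
    by unfold_locales (blast intro: lin_on_eqI oeval_lin assms(2))
qed

lemma bvec_tvec: "bvec x \<otimes>\<^sub>v bvec y = bvec (x, y)"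
  by (rule poly_mapping_eqI) (auto simp: tvec.rep_eq lookup_single when_def split: prod.splits)

lemma tvec_simps:
  "(v + v') \<otimes>\<^sub>v w = v \<otimes>\<^sub>v w + v' \<otimes>\<^sub>v w"
  "v \<otimes>\<^sub>v (w + w') = v \<otimes>\<^sub>v w + v \<otimes>\<^sub>v w'"
  "(c *\<^sub>C v) \<otimes>\<^sub>v w = c *\<^sub>C (v \<otimes>\<^sub>v w)"
  "v \<otimes>\<^sub>v (c *\<^sub>C w) = c *\<^sub>C (v \<otimes>\<^sub>v w)"
  "0 \<otimes>\<^sub>v w = 0"
  "v \<otimes>\<^sub>v 0 = 0"
  by (rule poly_mapping_eqI, simp add: tvec.rep_eq lookup_add scaleC_poly_mapping.rep_eq
      scaleC_complex_def algebra_simps split: prod.splits)+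

lemma tvec_sum:
  "(\<Sum>i\<in>I. v i) \<otimes>\<^sub>v w = (\<Sum>i\<in>I. v i \<otimes>\<^sub>v w)"
  "u \<otimes>\<^sub>v (\<Sum>i\<in>I. z i) = (\<Sum>i\<in>I. u \<otimes>\<^sub>v z i)"
  by (induction I rule: infinite_finite_induct) (simp_all add: tvec_simps)

lemma keys_tvec: "Poly_Mapping.keys (v \<otimes>\<^sub>v w) = Poly_Mapping.keys v \<times> Poly_Mapping.keys w"
  by (auto simp: in_keys_iff tvec.rep_eq)

lemma span_tvec:
  "cvec.span {v \<otimes>\<^sub>v w | v w. v \<in> free_on X \<and> w \<in> free_on Y} = free_on (X \<times> Y)" (is "cvec.span ?T = _")
proof
  show "cvec.span ?T \<subseteq> free_on (X \<times> Y)"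
    by (rule cvec.span_minimal[OF _ free_on_subspace]) (auto simp: free_on_def keys_tvec)
  show "free_on (X \<times> Y) \<subseteq> cvec.span ?T"
  proof
    fix t assume t: "t \<in> free_on (X \<times> Y)"
    have "bvec z \<in> cvec.span ?T" if "z \<in> X \<times> Y" for z
    proof -
      have "bvec z = bvec (fst z) \<otimes>\<^sub>v bvec (snd z)" by (simp add: bvec_tvec)
      moreover have "bvec (fst z) \<in> free_on X" "bvec (snd z) \<in> free_on Y"
        using that by (auto simp: bvec_free_on)
      ultimately show ?thesis by (intro cvec.span_base) blast
    qed
    from lin_ext_closed[where f = bvec, OF cvec.subspace_span this t] show "t \<in> cvec.span ?T"
      by (simp add: lin_ext_expand)
  qed
qed

text \<open>The operator \<open>a \<otimes>\<^sub>a b\<close> is determined by its values on the basis, so this is meant for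
  modules \<open>M\<close>, \<open>N\<close> whose carriers are of the form \<open>free_on X\<close>.\<close>

definition tensor_module ::
  "('a::calgebra, 'x \<Rightarrow>\<^sub>0 complex) cmodule \<Rightarrow> ('b::calgebra, 'y \<Rightarrow>\<^sub>0 complex) cmodule
    \<Rightarrow> (('a, 'b) tensor_alg, 'x \<times> 'y \<Rightarrow>\<^sub>0 complex) cmodule"  (infixr \<open>\<otimes>\<^sub>m\<close> 72) where
  "M \<otimes>\<^sub>m N = gen_module (cvec.span {v \<otimes>\<^sub>v w | v w. v \<in> mcarrier M \<and> w \<in> mcarrier N})
     (\<lambda>g. case g of TGen a b \<Rightarrow> lin_ext (\<lambda>(x, y). act M a (bvec x) \<otimes>\<^sub>v act N b (bvec y)))"


lemma tensor_module:
  fixes M :: "('a::calgebra, 'x \<Rightarrow>\<^sub>0 complex) cmodule" and N :: "('b::calgebra, 'y \<Rightarrow>\<^sub>0 complex) cmodule"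
  assumes M: "is_module M" "mcarrier M = free_on X" and N: "is_module N" "mcarrier N = free_on Y"
  shows "mcarrier (M \<otimes>\<^sub>m N) = free_on (X \<times> Y)" "is_module (M \<otimes>\<^sub>m N)"
    and "v \<in> free_on X \<Longrightarrow> w \<in> free_on Y \<Longrightarrow> act (M \<otimes>\<^sub>m N) (a \<otimes>\<^sub>a b) (v \<otimes>\<^sub>v w) = act M a v \<otimes>\<^sub>v act N b w"
proof -
  define \<psi> where "\<psi> = (\<lambda>g :: ('a, 'b) tgen. case g of TGen a b \<Rightarrow>
    (\<lambda>(x, y). act M a (bvec x) \<otimes>\<^sub>v act N b (bvec y)))"
  have eq: "M \<otimes>\<^sub>m N = gen_module (free_on (X \<times> Y)) (\<lambda>g. lin_ext (\<psi> g))"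
    unfolding tensor_module_def M N span_tvec \<psi>_def
    by (rule arg_cong2[of _ _ _ _ gen_module]) (auto simp: fun_eq_iff split: tgen.splits)
  have Mc: "act M a v \<in> free_on X" if "v \<in> free_on X" for a v
    using M that unfolding is_module_def by auto
  have Nc: "act N b w \<in> free_on Y" if "w \<in> free_on Y" for b w
    using N that unfolding is_module_def by auto
  have Ml: "lin_on (free_on X) (act M a)" for a
    using M unfolding is_module_def by auto
  have Nl: "lin_on (free_on Y) (act N b)" for b
    using N unfolding is_module_def by auto
  have Mm: "act M 1 v = v" "act M (a + a') v = act M a v + act M a' v"
    "act M (a * a') v = act M a (act M a' v)" "act M (c *\<^sub>C a) v = c *\<^sub>C act M a v"
    if "v \<in> free_on X" for a a' v c
    using M that unfolding is_module_def by auto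
  have Nm: "act N 1 v = v" "act N (a + a') v = act N a v + act N a' v"
    "act N (a * a') v = act N a (act N a' v)" "act N (c *\<^sub>C a) v = c *\<^sub>C act N a v"
    if "v \<in> free_on Y" for a a' v c
    using N that unfolding is_module_def by auto
  have pure: "lin_ext (\<psi> (TGen a b)) (v \<otimes>\<^sub>v w) = act M a v \<otimes>\<^sub>v act N b w"
    if "v \<in> free_on X" "w \<in> free_on Y" for a b v w
  proof -
    have "lin_ext (\<psi> (TGen a b)) (v \<otimes>\<^sub>v w) =
        lin_ext (\<lambda>x. act M a (bvec x)) v \<otimes>\<^sub>v lin_ext (\<lambda>y. act N b (bvec y)) w"
      by (simp add: lin_ext_def tvec_sum(1) tvec_simps(3))
        (simp add: keys_tvec \<psi>_def sum.cartesian_product tvec_sum(2) tvec_simps(4)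
          tvec.rep_eq split_beta cvec.scale_sum_right)
    then show ?thesis
      by (simp add: lin_on_expand[OF Ml that(1), symmetric] lin_on_expand[OF Nl that(2), symmetric])
  qed
  interpret operators "free_on (X \<times> Y)" "\<lambda>g. lin_ext (\<psi> g)"
  proof (rule operators_free_on)
    show "\<psi> g z \<in> free_on (X \<times> Y)" if "z \<in> X \<times> Y" for g z
      using that Mc[of "bvec (fst z)"] Nc[of "bvec (snd z)"]
      by (cases g) (fastforce simp: \<psi>_def free_on_def keys_tvec)
  next
    fix p q :: "('a, 'b) tgen aexp" and z
    assume "defrel p q" "z \<in> X \<times> Y"
    moreover obtain x y where z: "z = (x, y)" by (cases z)
    ultimately have x: "bvec x \<in> free_on X" and y: "bvec y \<in> free_on Y"
      by (auto simp: bvec_free_on)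
    show "oeval (\<lambda>g. lin_ext (\<psi> g)) p (bvec z) = oeval (\<lambda>g. lin_ext (\<psi> g)) q (bvec z)"
      using \<open>defrel p q\<close> unfolding defrel_tgen_def z bvec_tvec[symmetric]
      by cases (simp_all add: pure x y Mm Nm Mc Nc tvec_simps)
  qed
  show "mcarrier (M \<otimes>\<^sub>m N) = free_on (X \<times> Y)" by (simp add: eq gen_module_def)
  show "is_module (M \<otimes>\<^sub>m N)" unfolding eq by (rule is_module)
  show "act (M \<otimes>\<^sub>m N) (a \<otimes>\<^sub>a b) (v \<otimes>\<^sub>v w) = act M a v \<otimes>\<^sub>v act N b w"
    if "v \<in> free_on X" "w \<in> free_on Y"
  proof -
    have "v \<otimes>\<^sub>v w \<in> free_on (X \<times> Y)"
      using that by (auto simp: free_on_def keys_tvec)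
    then show ?thesis
      using pure[OF that, of a b] by (simp add: eq tens_def act_gen)
  qed
qed


section \<open>The modules \<open>L\<^sub>n\<close> and the subset modules\<close>

primrec L_op :: "nat \<Rightarrow> sl2_gen \<Rightarrow> nat \<Rightarrow> (nat \<Rightarrow>\<^sub>0 complex)" where
  "L_op n GE i = (if i = 0 then 0 else of_nat i *\<^sub>C bvec (i - 1))"
| "L_op n GF i = (if i = n then 0 else (of_nat n - of_nat i) *\<^sub>C bvec (i + 1))"
| "L_op n GH i = (of_nat n - 2 * of_nat i) *\<^sub>C bvec i"

definition L_mod :: "nat \<Rightarrow> (usl2, nat \<Rightarrow>\<^sub>0 complex) cmodule" where
  "L_mod n = gen_module (free_on {0..n}) (\<lambda>g. lin_ext (L_op n g))"

lemma L_operators: "operators (free_on {0..n}) (\<lambda>g. lin_ext (L_op n g))"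
proof (rule operators_free_on)
  show "L_op n g i \<in> free_on {0..n}" if "i \<in> {0..n}" for g i
    using that cvec.subspace_0[OF free_on_subspace]
    by (cases g) (auto simp: bvec_free_on intro!: cvec.subspace_scale[OF free_on_subspace])
next
  fix p q :: "sl2_gen aexp" and i
  assume "defrel p q" "i \<in> {0..n}"
  then show "oeval (\<lambda>g. lin_ext (L_op n g)) p (bvec i) = oeval (\<lambda>g. lin_ext (L_op n g)) q (bvec i)"
    unfolding defrel_sl2_gen_def
    by (auto simp: lin_ext_simps of_nat_diff algebra_simps simp flip: scaleC_add_left
        cvec.scale_left_diff_distrib) (simp flip: cvec.scale_minus_left)
qed

lemma L_module: "is_module (L_mod n)" "mcarrier (L_mod n) = free_on {0..n}"
  unfolding L_mod_def using operators.is_module[OF L_operators] by (simp_all add: gen_module_def)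

lemma L_act: "i \<le> n \<Longrightarrow> act (L_mod n) (gen g) (bvec i) = L_op n g i"
  unfolding L_mod_def using operators.act_gen[OF L_operators, of "bvec i" n g]
  by (simp add: bvec_free_on lin_ext_bvec)

primrec cube_op :: "'a set \<Rightarrow> sl2_gen \<Rightarrow> 'a set \<Rightarrow> ('a set \<Rightarrow>\<^sub>0 complex)" where
  "cube_op S GE x = (\<Sum>y | y \<subseteq> x \<and> card x = card y + 1. bvec y)"
| "cube_op S GF x = (\<Sum>y | x \<subseteq> y \<and> y \<subseteq> S \<and> card y = card x + 1. bvec y)"
| "cube_op S GH x = (of_nat (card S) - 2 * of_nat (card x)) *\<^sub>C bvec x"

definition cube :: "'a set \<Rightarrow> (usl2, 'a set \<Rightarrow>\<^sub>0 complex) cmodule" where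
  "cube S = gen_module (free_on (Pow S)) (\<lambda>g. lin_ext (cube_op S g))"

lemma cube_op_E: "finite x \<Longrightarrow> cube_op S GE x = (\<Sum>a\<in>x. bvec (x - {a}))"
proof -
  assume x: "finite x"
  have "{y. y \<subseteq> x \<and> card x = card y + 1} = (\<lambda>a. x - {a}) ` x"
  proof (intro equalityI subsetI)
    fix y assume y: "y \<in> {y. y \<subseteq> x \<and> card x = card y + 1}"
    then have "card (x - y) = 1" using x finite_subset[of y x] by (simp add: card_Diff_subset)
    then obtain a where "x - y = {a}" by (auto simp: card_1_singleton_iff)
    then show "y \<in> (\<lambda>a. x - {a}) ` x" using y by blast
  next
    fix y assume "y \<in> (\<lambda>a. x - {a}) ` x"
    then show "y \<in> {y. y \<subseteq> x \<and> card x = card y + 1}" using x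
      by (auto simp: card_Suc_Diff1 simp del: card_Diff_singleton card_Diff_insert)
  qed
  moreover have "inj_on (\<lambda>a. x - {a}) x" by (auto simp: inj_on_def)
  ultimately show ?thesis by (simp add: sum.reindex)
qed

lemma cube_op_F:
  assumes S: "finite S" and x: "x \<subseteq> S"
  shows "cube_op S GF x = (\<Sum>b\<in>S - x. bvec (insert b x))"
proof -
  have fx: "finite x" using assms finite_subset by blast
  have "{y. x \<subseteq> y \<and> y \<subseteq> S \<and> card y = card x + 1} = (\<lambda>b. insert b x) ` (S - x)"
  proof (intro equalityI subsetI)
    fix y assume y: "y \<in> {y. x \<subseteq> y \<and> y \<subseteq> S \<and> card y = card x + 1}"
    then have "card (y - x) = 1" using fx by (simp add: card_Diff_subset)
    then obtain a where "y - x = {a}" by (auto simp: card_1_singleton_iff)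
    then show "y \<in> (\<lambda>b. insert b x) ` (S - x)" using y by blast
  next
    fix y assume "y \<in> (\<lambda>b. insert b x) ` (S - x)"
    then show "y \<in> {y. x \<subseteq> y \<and> y \<subseteq> S \<and> card y = card x + 1}" using fx x by auto
  qed
  moreover have "inj_on (\<lambda>b. insert b x) (S - x)" by (auto simp: inj_on_def)
  ultimately show ?thesis by (simp add: sum.reindex)
qed

lemma cube_operators:
  assumes S: "finite S"
  shows "operators (free_on (Pow S)) (\<lambda>g. lin_ext (cube_op S g))"
proof (rule operators_free_on)
  show "cube_op S g x \<in> free_on (Pow S)" if "x \<in> Pow S" for g x
    using that
    by (cases g) (auto simp: bvec_free_on intro!: cvec.subspace_scale[OF free_on_subspace]
        cvec.subspace_sum[OF free_on_subspace])
next
  fix p q :: "sl2_gen aexp" and x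
  let ?o = "oeval (\<lambda>g. lin_ext (cube_op S g))"
  assume pq: "defrel p q" and "x \<in> Pow S"
  then have x: "x \<subseteq> S" and fx: "finite x" using S finite_subset by auto
  have fd: "finite (x - A)" "finite (insert a x)" for A a using fx by auto
  let ?s = "of_nat (card S) :: complex" and ?x = "of_nat (card x) :: complex"
  have E1: "cube_op S GH (x - {a}) = (?s - 2 * ?x + 2) *\<^sub>C bvec (x - {a})" if "a \<in> x" for a
    using that fx card_Suc_Diff1[OF fx that] by (simp add: algebra_simps flip: of_nat_Suc)
  have F1: "cube_op S GH (insert b x) = (?s - 2 * ?x - 2) *\<^sub>C bvec (insert b x)" if "b \<in> S - x" for b
    using that fx by (simp add: algebra_simps)
  have EF: "lin_ext (cube_op S GE) (cube_op S GF x) = (?s - ?x) *\<^sub>C bvec x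
      + (\<Sum>b\<in>S - x. \<Sum>a\<in>x. bvec (insert b (x - {a})))"
  proof -
    have "cube_op S GE (insert b x) = bvec x + (\<Sum>a\<in>x. bvec (insert b (x - {a})))" if "b \<in> S - x" for b
    proof -
      have "(\<Sum>a\<in>x. bvec (insert b x - {a})) = (\<Sum>a\<in>x. bvec (insert b (x - {a})))"
        using that by (intro sum.cong) (auto intro!: arg_cong[of _ _ bvec])
      moreover have "insert b x - {b} = x" using that by auto
      ultimately show ?thesis using that fx by (simp add: cube_op_E fd del: cube_op.simps)
    qed
    then have "lin_ext (cube_op S GE) (cube_op S GF x) =
       (\<Sum>b\<in>S - x. bvec x + (\<Sum>a\<in>x. bvec (insert b (x - {a}))))"
      by (simp add: cube_op_F[OF S x] lin_ext_simps del: cube_op.simps)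
    moreover have "(\<Sum>b\<in>S - x. bvec x) = (?s - ?x) *\<^sub>C bvec x"
      using x fx S card_mono[OF S x]
      by (intro poly_mapping_eqI)
        (simp add: Poly_Mapping.lookup_sum card_Diff_subset of_nat_diff scaleC_poly_mapping.rep_eq
          scaleC_complex_def)
    ultimately show ?thesis by (simp add: sum.distrib)
  qed
  have FE: "lin_ext (cube_op S GF) (cube_op S GE x) = ?x *\<^sub>C bvec x
      + (\<Sum>b\<in>S - x. \<Sum>a\<in>x. bvec (insert b (x - {a})))"
  proof -
    have "cube_op S GF (x - {a}) = bvec x + (\<Sum>b\<in>S - x. bvec (insert b (x - {a})))" if "a \<in> x" for a
    proof -
      have "S - (x - {a}) = insert a (S - x)" "insert a (x - {a}) = x" "x - {a} \<subseteq> S"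
        using that x by auto
      then show ?thesis using that S by (simp add: cube_op_F del: cube_op.simps)
    qed
    then have "lin_ext (cube_op S GF) (cube_op S GE x) =
       (\<Sum>a\<in>x. bvec x + (\<Sum>b\<in>S - x. bvec (insert b (x - {a}))))"
      by (simp add: cube_op_E[OF fx] lin_ext_simps del: cube_op.simps)
    moreover have "(\<Sum>a\<in>x. bvec x) = ?x *\<^sub>C bvec x"
      by (intro poly_mapping_eqI)
        (simp add: Poly_Mapping.lookup_sum scaleC_poly_mapping.rep_eq scaleC_complex_def)
    ultimately show ?thesis
      by (simp add: sum.distrib sum.swap[of _ "S - x" x])
  qed
  have HE: "lin_ext (cube_op S GH) (cube_op S GE x) = (?s - 2 * ?x + 2) *\<^sub>C cube_op S GE x"
    using E1 by (simp add: cube_op_E[OF fx] lin_ext_simps cvec.scale_sum_right del: cube_op.simps)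
  have HF: "lin_ext (cube_op S GH) (cube_op S GF x) = (?s - 2 * ?x - 2) *\<^sub>C cube_op S GF x"
    using F1 by (simp add: cube_op_F[OF S x] lin_ext_simps cvec.scale_sum_right del: cube_op.simps)
  have Hx: "cube_op S GH x = (?s - 2 * ?x) *\<^sub>C bvec x" by simp
  show "?o p (bvec x) = ?o q (bvec x)"
    using pq unfolding defrel_sl2_gen_def
    by (auto simp: lin_ext_bvec EF FE HE HF Hx lin_ext_scale algebra_simps simp del: cube_op.simps
        simp flip: scaleC_add_left cvec.scale_left_diff_distrib)
qed

lemma cube_module:
  assumes "finite S"
  shows "is_module (cube S)" "mcarrier (cube S) = free_on (Pow S)"
    and "x \<subseteq> S \<Longrightarrow> act (cube S) (gen g) (bvec x) = cube_op S g x"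
  unfolding cube_def
  using operators.is_module[OF cube_operators[OF assms]]
    operators.act_gen[OF cube_operators[OF assms], of "bvec x" g]
  by (simp_all add: gen_module_def bvec_free_on lin_ext_bvec)

definition iota :: "'a set \<Rightarrow> ('a set \<Rightarrow>\<^sub>0 complex) \<Rightarrow> ('a set \<times> 'a set \<Rightarrow>\<^sub>0 complex)"  (\<open>\<iota>\<close>) where
  "\<iota> x0 = lin_ext (\<lambda>x. bvec (x - x0, x \<inter> x0))"

definition transport :: "'v set \<Rightarrow> ('v \<Rightarrow> 'w) \<Rightarrow> ('a, 'w) cmodule \<Rightarrow> ('a, 'v) cmodule" where
  "transport V f N = \<lparr>mcarrier = V, act = (\<lambda>a v. inv_into V f (act N a (f v)))\<rparr>"

lemma transport_module:
  assumes V: "cvec.subspace V" and N: "is_module N" and f: "lin_on V f" "bij_betw f V (mcarrier N)"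
  shows "is_module (transport V f N)"
    and "v \<in> V \<Longrightarrow> f (act (transport V f N) a v) = act N a (f v)"
proof -
  let ?M = "transport V f N"
  note D = is_moduleD[OF N]
  have C: "mcarrier ?M = V" by (simp add: transport_def)
  have fN: "f v \<in> mcarrier N" if "v \<in> V" for v using f(2) that by (auto simp: bij_betw_def)
  have inj: "v = w" if "f v = f w" "v \<in> V" "w \<in> V" for v w
    using f(2) that by (auto simp: bij_betw_def inj_on_def)
  have eq: "f (act ?M a v) = act N a (f v)" "act ?M a v \<in> V" if "v \<in> V" for a v
  proof -
    have "act N a (f v) \<in> f ` V" using D(2)[OF fN[OF that]] f(2) by (simp add: bij_betw_def)
    then show "f (act ?M a v) = act N a (f v)" "act ?M a v \<in> V"
      unfolding transport_def by (simp_all add: f_inv_into_f inv_into_into)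
  qed
  show "v \<in> V \<Longrightarrow> f (act ?M a v) = act N a (f v)" by (rule eq)
  have cl: "v \<in> V \<Longrightarrow> w \<in> V \<Longrightarrow> v + w \<in> V" "v \<in> V \<Longrightarrow> c *\<^sub>C v \<in> V" for c v w
    using V by (simp_all add: cvec.subspace_add cvec.subspace_scale)
  have fl: "v \<in> V \<Longrightarrow> w \<in> V \<Longrightarrow> f (v + w) = f v + f w" "v \<in> V \<Longrightarrow> f (c *\<^sub>C v) = c *\<^sub>C f v" for c v w
    using f(1) by (simp_all add: lin_on_def)
  show "is_module ?M"
    by (rule is_moduleI; unfold C; (rule V | (rule inj; simp add: eq cl fl D fN)
        | (simp add: eq)))
qed

lemma iota_bij:
  assumes "x0 \<subseteq> \<Omega>"
  shows "bij_betw (\<iota> x0) (free_on (Pow \<Omega>)) (free_on (Pow (\<Omega> - x0) \<times> Pow x0))"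
proof (rule bij_betw_byWitness[where f' = "lin_ext (\<lambda>(y, z). bvec (y \<union> z))"])
  let ?g = "lin_ext (\<lambda>(y, z). bvec (y \<union> z)) :: _ \<Rightarrow> 'a set \<Rightarrow>\<^sub>0 complex"
  have l: "lin_on V (\<lambda>v. ?g (\<iota> x0 v))" "lin_on W (\<lambda>v. \<iota> x0 (?g v))" "lin_on U (\<lambda>v. v)" for V W and U :: "'b::cvector set"
    by (simp_all add: lin_on_def iota_def lin_ext_simps)
  show "\<forall>v\<in>free_on (Pow \<Omega>). ?g (\<iota> x0 v) = v"
  proof
    fix v assume v: "v \<in> free_on (Pow \<Omega>)"
    have "?g (\<iota> x0 (bvec x)) = bvec x" for x
    proof -
      have "(x - x0) \<union> (x \<inter> x0) = x" by auto
      then show ?thesis by (simp add: iota_def lin_ext_simps)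
    qed
    from lin_on_eqI[where f = "\<lambda>v. ?g (\<iota> x0 v)" and g = "\<lambda>v. v", OF l(1) l(3) this v]
    show "?g (\<iota> x0 v) = v" .
  qed
  show "\<forall>v\<in>free_on (Pow (\<Omega> - x0) \<times> Pow x0). \<iota> x0 (?g v) = v"
  proof
    fix v assume v: "v \<in> free_on (Pow (\<Omega> - x0) \<times> Pow x0)"
    have "\<iota> x0 (?g (bvec p)) = bvec p" if "p \<in> Pow (\<Omega> - x0) \<times> Pow x0" for p
    proof -
      have "(fst p \<union> snd p) - x0 = fst p" "(fst p \<union> snd p) \<inter> x0 = snd p" using that by auto
      then show ?thesis by (simp add: iota_def lin_ext_simps split_beta)
    qed
    from lin_on_eqI[where f = "\<lambda>v. \<iota> x0 (?g v)" and g = "\<lambda>v. v", OF l(2) l(3) this v]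
    show "\<iota> x0 (?g v) = v" .
  qed
  show "\<iota> x0 ` free_on (Pow \<Omega>) \<subseteq> free_on (Pow (\<Omega> - x0) \<times> Pow x0)"
    unfolding iota_def
    by (intro image_subsetI lin_ext_closed[where X = "Pow \<Omega>"] free_on_subspace) (auto simp: bvec_free_on)
  show "?g ` free_on (Pow (\<Omega> - x0) \<times> Pow x0) \<subseteq> free_on (Pow \<Omega>)"
    using assms
    by (intro image_subsetI lin_ext_closed[where X = "Pow (\<Omega> - x0) \<times> Pow x0"] free_on_subspace)
      (auto simp: bvec_free_on, blast+)
qed

definition cube_at :: "'a set \<Rightarrow> 'a set \<Rightarrow> (usl2_2, 'a set \<Rightarrow>\<^sub>0 complex) cmodule" where
  "cube_at \<Omega> x0 = transport (free_on (Pow \<Omega>)) (\<iota> x0) (cube (\<Omega> - x0) \<otimes>\<^sub>m cube x0)"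

definition via_natural :: "(usl2_2, 'v) cmodule \<Rightarrow> (hahn, 'v) cmodule" where
  "via_natural M = \<lparr>mcarrier = mcarrier M, act = (\<lambda>a. act M (\<natural> a))\<rparr>"

definition weight_module :: "(usl2_2, 'v::cvector) cmodule \<Rightarrow> complex \<Rightarrow> (hahn, 'v) cmodule" where
  "weight_module M \<theta> = (via_natural M)\<lparr>mcarrier := {v \<in> mcarrier M. act M (\<Delta> UH) v = \<theta> *\<^sub>C v}\<rparr>"

lemma weight_module_is_module:
  assumes M: "is_module M"
  shows "is_module (weight_module M \<theta>)"
proof -
  note D = is_moduleD[OF M]
  let ?W = "{v \<in> mcarrier M. act M (\<Delta> UH) v = \<theta> *\<^sub>C v}"
  have c: "mcarrier (weight_module M \<theta>) = ?W"
    and a: "act (weight_module M \<theta>) = (\<lambda>a. act M (\<natural> a))"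
    by (simp_all add: weight_module_def via_natural_def)
  have h: "\<natural> 1 = 1" "\<natural> (a + b) = \<natural> a + \<natural> b" "\<natural> (a * b) = \<natural> a * \<natural> b" "\<natural> (c *\<^sub>C a) = c *\<^sub>C \<natural> a" for a b c
    using natural_hom(1) unfolding alg_hom_def by auto
  have comm: "act M (\<Delta> UH) (act M (\<natural> a) v) = act M (\<natural> a) (act M (\<Delta> UH) v)" if "v \<in> mcarrier M" for a v
    using D(8)[OF that, of "\<Delta> UH" "\<natural> a"] D(8)[OF that, of "\<natural> a" "\<Delta> UH"] natural_hom(3)[of a] by simp
  have 0: "0 \<in> mcarrier M" using D(1) by (rule cvec.subspace_0)
  have "act M (\<Delta> UH) 0 = 0" using D(5)[OF 0, of "\<Delta> UH" 0] by simp
  then have "cvec.subspace ?W"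
    using 0 D(1) by (intro cvec.subspaceI)
      (auto simp: D scaleC_add_right mult.commute intro: cvec.subspace_add cvec.subspace_scale)
  then show ?thesis
    by (intro is_moduleI; unfold c a) (auto simp: D h comm)
qed

definition ksubsets :: "'a set \<Rightarrow> nat \<Rightarrow> 'a set set" where
  "ksubsets \<Omega> k = {x. x \<subseteq> \<Omega> \<and> card x = k}"

definition ksubset_module :: "'a set \<Rightarrow> nat \<Rightarrow> 'a set \<Rightarrow> (hahn, 'a set \<Rightarrow>\<^sub>0 complex) cmodule" where
  "ksubset_module \<Omega> k x0 = (via_natural (cube_at \<Omega> x0))\<lparr>mcarrier := free_on (ksubsets \<Omega> k)\<rparr>"

lemma cube_at_module:
  assumes "finite \<Omega>" "x0 \<subseteq> \<Omega>"
  shows "is_module (cube_at \<Omega> x0)" "mcarrier (cube_at \<Omega> x0) = free_on (Pow \<Omega>)"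
    and "v \<in> free_on (Pow \<Omega>) \<Longrightarrow>
      \<iota> x0 (act (cube_at \<Omega> x0) a v) = act (cube (\<Omega> - x0) \<otimes>\<^sub>m cube x0) a (\<iota> x0 v)"
proof -
  have f: "finite (\<Omega> - x0)" "finite x0" using assms finite_subset by auto
  note T = tensor_module[OF cube_module(1,2)[OF f(1)] cube_module(1,2)[OF f(2)]]
  have l: "lin_on V (\<iota> x0)" for V unfolding iota_def by (rule lin_on_lin_ext)
  note M = transport_module[OF free_on_subspace T(2) l iota_bij[OF assms(2), folded T(1)]]
  show "is_module (cube_at \<Omega> x0)" unfolding cube_at_def by (rule M(1))
  show "mcarrier (cube_at \<Omega> x0) = free_on (Pow \<Omega>)" by (simp add: cube_at_def transport_def)
  show "v \<in> free_on (Pow \<Omega>) \<Longrightarrow>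
      \<iota> x0 (act (cube_at \<Omega> x0) a v) = act (cube (\<Omega> - x0) \<otimes>\<^sub>m cube x0) a (\<iota> x0 v)"
    unfolding cube_at_def by (rule M(2))
qed

lemma ksubset_module_eq_weight:
  assumes "finite \<Omega>" "x0 \<subseteq> \<Omega>"
  shows "ksubset_module \<Omega> k x0 = weight_module (cube_at \<Omega> x0) (of_nat (card \<Omega>) - 2 * of_nat k)"
proof -
  let ?M = "cube_at \<Omega> x0" and ?T = "cube (\<Omega> - x0) \<otimes>\<^sub>m cube x0"
  let ?w = "\<lambda>x :: 'a set. of_nat (card \<Omega>) - 2 * of_nat (card x) :: complex"
  note M = cube_at_module[OF assms]
  have f: "finite (\<Omega> - x0)" "finite x0" using assms finite_subset by auto
  note T = tensor_module[OF cube_module(1,2)[OF f(1)] cube_module(1,2)[OF f(2)]]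
  have b: "act ?M (\<Delta> UH) (bvec x) = ?w x *\<^sub>C bvec x" if x: "x \<subseteq> \<Omega>" for x
  proof -
    have fx: "finite x" using x assms finite_subset by blast
    let ?y = "x - x0" and ?z = "x \<inter> x0"
    have yz: "?y \<subseteq> \<Omega> - x0" "?z \<subseteq> x0" using x by auto
    have y: "bvec ?y \<in> free_on (Pow (\<Omega> - x0))" and z: "bvec ?z \<in> free_on (Pow x0)"
      using yz by (auto simp: bvec_free_on)
    have yz': "bvec ?y \<otimes>\<^sub>v bvec ?z \<in> free_on (Pow (\<Omega> - x0) \<times> Pow x0)"
      using yz by (auto simp: bvec_free_on bvec_tvec)
    have c1: "card (\<Omega> - x0) + card x0 = card \<Omega>"
      using assms f by (metis card_Diff_subset card_mono le_add_diff_inverse2)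
    have c2: "card ?y + card ?z = card x"
      using fx by (metis Int_commute add.commute card_Int_Diff)
    have w: "(of_nat (card (\<Omega> - x0)) - 2 * of_nat (card ?y)) + (of_nat (card x0) - 2 * of_nat (card ?z)) = ?w x"
      unfolding c1[symmetric] c2[symmetric] by simp
    have 1: "act (cube S) 1 v = v" if "finite S" "v \<in> free_on (Pow S)" for S :: "'a set" and v
      using is_moduleD(6)[OF cube_module(1)[OF that(1)]] that by (simp add: cube_module(2))
    have "act ?T (\<Delta> UH) (bvec ?y \<otimes>\<^sub>v bvec ?z) =
        act ?T (UH \<otimes>\<^sub>a 1) (bvec ?y \<otimes>\<^sub>v bvec ?z) + act ?T (1 \<otimes>\<^sub>a UH) (bvec ?y \<otimes>\<^sub>v bvec ?z)"
      unfolding comul_hom(2) by (rule is_moduleD(7)[OF T(2)]) (simp add: T(1) yz')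
    also have "\<dots> = ?w x *\<^sub>C (bvec ?y \<otimes>\<^sub>v bvec ?z)"
      unfolding T(3)[OF y z] 1[OF f(1) y] 1[OF f(2) z]
        cube_module(3)[OF f(1) yz(1)] cube_module(3)[OF f(2) yz(2)]
      by (simp add: tvec_simps flip: scaleC_add_left w)
    finally have "\<iota> x0 (act ?M (\<Delta> UH) (bvec x)) = \<iota> x0 (?w x *\<^sub>C bvec x)"
      using M(3)[of "bvec x" "\<Delta> UH"] x
      by (simp add: bvec_free_on iota_def lin_ext_simps bvec_tvec)
    moreover have "act ?M (\<Delta> UH) (bvec x) \<in> free_on (Pow \<Omega>)"
      using is_moduleD(2)[OF M(1)] x by (simp add: M(2) bvec_free_on)
    moreover have "?w x *\<^sub>C bvec x \<in> free_on (Pow \<Omega>)"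
      using x by (intro cvec.subspace_scale[OF free_on_subspace]) (simp add: bvec_free_on)
    ultimately show ?thesis
      using iota_bij[OF assms(2)] unfolding bij_betw_def inj_on_def by blast
  qed
  have lin: "act ?M (\<Delta> UH) v = lin_ext (\<lambda>x. ?w x *\<^sub>C bvec x) v" if "v \<in> free_on (Pow \<Omega>)" for v
    using is_moduleD(3)[OF M(1), of "\<Delta> UH"] b unfolding M(2)
    by (intro lin_on_eqI[OF _ lin_on_lin_ext _ that]) (auto simp: lin_ext_bvec)
  have look: "Poly_Mapping.lookup (lin_ext (\<lambda>x. ?w x *\<^sub>C bvec x) v) x = ?w x * Poly_Mapping.lookup v x" for v x
    by (simp add: lin_ext_def Poly_Mapping.lookup_sum scaleC_poly_mapping.rep_eq lookup_single
        scaleC_complex_def when_def in_keys_iff if_distrib cong: if_cong)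
  have "free_on (ksubsets \<Omega> k) = {v \<in> mcarrier ?M. act ?M (\<Delta> UH) v = (of_nat (card \<Omega>) - 2 * of_nat k) *\<^sub>C v}"
    unfolding M(2)
  proof (intro set_eqI)
    fix v
    have "act ?M (\<Delta> UH) v = (of_nat (card \<Omega>) - 2 * of_nat k) *\<^sub>C v \<longleftrightarrow>
        (\<forall>x\<in>Poly_Mapping.keys v. card x = k)" if "v \<in> free_on (Pow \<Omega>)"
      unfolding lin[OF that] poly_mapping_eq_iff fun_eq_iff look
      by (auto simp: scaleC_poly_mapping.rep_eq scaleC_complex_def in_keys_iff)
    then show "v \<in> free_on (ksubsets \<Omega> k) \<longleftrightarrow> v \<in> {v \<in> free_on (Pow \<Omega>).
        act ?M (\<Delta> UH) v = (of_nat (card \<Omega>) - 2 * of_nat k) *\<^sub>C v}"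
      by (auto simp: free_on_def ksubsets_def)
  qed
  then show ?thesis
    unfolding ksubset_module_def weight_module_def by simp
qed

definition LL :: "nat \<Rightarrow> nat \<Rightarrow> complex \<Rightarrow> (hahn, nat \<times> nat \<Rightarrow>\<^sub>0 complex) cmodule" where
  "LL m n \<theta> = weight_module (L_mod m \<otimes>\<^sub>m L_mod n) \<theta>"

text \<open>For \<open>2 * i \<le> n\<close> the number under the floor is an integer.\<close>

definition mult_m :: "nat \<Rightarrow> nat \<Rightarrow> nat" where
  "mult_m i n = nat \<lfloor>(real n - 2 * real i + 1) / (real n - real i + 1) * real (n choose i)\<rfloor>"

lemma mult_m_exact:
  assumes "2 * i \<le> n"
  shows "real (mult_m i n) = (real n - 2 * real i + 1) / (real n - real i + 1) * real (n choose i)"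
proof -
  have "\<exists>d. (real n - 2 * real i + 1) / (real n - real i + 1) * real (n choose i) = real d"
  proof (cases i)
    case 0
    then show ?thesis by (auto intro: exI[of _ 1])
  next
    case (Suc j)
    have "Suc j * (n choose Suc j) = (n - j) * (n choose j)"
      using binomial_absorb_comp[of n j] binomial_absorption[of j n] by simp
    then have "real (Suc j) * real (n choose Suc j) = real (n - j) * real (n choose j)"
      by (metis of_nat_mult)
    then have eq: "real i * real (n choose i) = (real n - real i + 1) * real (n choose j)"
      using assms Suc by (simp add: of_nat_diff)
    have pos: "real n - real i + 1 > 0" using assms by linarith
    have "(real n - 2 * real i + 1) / (real n - real i + 1) * real (n choose i) =
        real (n choose i) - real (n choose j)"
      using pos eq by (simp add: field_simps)
    moreover have "(n choose j) \<le> (n choose i)"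
      using assms Suc by (intro binomial_mono) auto
    ultimately show ?thesis by (metis of_nat_diff)
  qed
  then obtain d where "(real n - 2 * real i + 1) / (real n - real i + 1) * real (n choose i) = real d" ..
  then show ?thesis by (simp add: mult_m_def)
qed

text \<open>The bounds are compared in the reals: \<open>k - i\<close> is negative for \<open>i > k\<close>, and then no \<open>j\<close>
  is admitted.\<close>

definition P_set :: "nat \<Rightarrow> nat \<Rightarrow> (nat \<times> nat) set" where
  "P_set D k = {(i, j). real i \<le> (real D - real k) / 2 \<and>
     real j \<le> Min {real D - real k - real i, real k - real i, real k / 2}}"

end

theory Submission
  imports Defs
begin

text \<open>
  Adjoining one point to \<open>S\<close> tensors the \<open>U(sl\<^sub>2)\<close>-module \<open>\<complex>\<^bsup>2^S\<^esup>\<close> with \<open>L\<^sub>1\<close>, so an explicit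
  Clebsch-Gordan step gives a basis of the cube indexed by ballot words, which are counted by \<open>m\<^sub>i\<close>.
  Tensoring the bases for \<open>\<Omega> \<setminus> x\<^sub>0\<close> and \<open>x\<^sub>0\<close> and taking weight spaces decomposes the subset module
  into modules \<open>(L\<^sub>m \<otimes> L\<^sub>n)(\<theta>)\<close>. On such a module \<open>A\<close> is diagonal with simple spectrum and \<open>C\<close>
  connects neighbouring eigenvectors, hence it is irreducible. The two central elements of the
  Hahn algebra recover the Casimir values of \<open>L\<^sub>m\<close> and \<open>L\<^sub>n\<close> if \<open>\<theta> \<noteq> 0\<close>; for \<open>\<theta> = 0\<close> they recover
  only the sum of these values, and \<open>(L\<^sub>m \<otimes> L\<^sub>n)(0) \<cong> (L\<^sub>n \<otimes> L\<^sub>m)(0)\<close>, which explains the second case.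
\<close>

section \<open>Decompositions of modules\<close>

text \<open>Neither complete reducibility nor cancellation of direct summands is invoked. Direct
  sums are handled through explicit inclusions and projections, so an isomorphism comes down to a
  bijection of index sets that respects isomorphism types, and such a bijection exists once every
  type occurs equally often on both sides. Likewise the basis of the cube is built together with its
  inverse coordinate map, so that spanning and independence become two identities instead of a
  dimension count.

  Pairs of words produce a summand for all i \<le> (D - k)/2 and j \<le> k/2, but some of the weight
  spaces vanish; the remaining inequalities of P(k) say exactly that the weight D - 2k occurs.

  At weight 0 the central elements do not even separate unordered pairs: L_6, L_0 and L_4, L_4 both
  have Casimir sum 48 = 24 + 24, and both pairs occur for k = 6, D = 12. The extreme eigenvalue of
  \<open>A\<close> is the invariant that tells such modules apart.\<close>

lemma lin_on_zero: "cvec.subspace V \<Longrightarrow> lin_on V f \<Longrightarrow> f 0 = 0"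
  unfolding lin_on_def by (metis cvec.scale_zero_left cvec.subspace_0)

lemma lin_on_sum:
  assumes "cvec.subspace V" "lin_on V f" "\<And>i. i \<in> I \<Longrightarrow> v i \<in> V"
  shows "f (\<Sum>i\<in>I. v i) = (\<Sum>i\<in>I. f (v i))"
  using assms(3)
proof (induction I rule: infinite_finite_induct)
  case (insert i I)
  then have "(\<Sum>i\<in>I. v i) \<in> V" by (intro cvec.subspace_sum[OF assms(1)]) auto
  then show ?case using insert assms(2) by (simp add: lin_on_def)
qed (simp_all add: lin_on_zero[OF assms(1,2)])

definition mod_hom :: "('a, 'v::cvector) cmodule \<Rightarrow> ('a, 'w::cvector) cmodule \<Rightarrow> ('v \<Rightarrow> 'w) \<Rightarrow> bool" where
  "mod_hom M N f \<longleftrightarrow> (\<forall>v\<in>mcarrier M. f v \<in> mcarrier N) \<and> lin_on (mcarrier M) f \<and>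
     (\<forall>a. \<forall>v\<in>mcarrier M. f (act M a v) = act N a (f v))"

lemma mod_homD:
  assumes "mod_hom M N f"
  shows "v \<in> mcarrier M \<Longrightarrow> f v \<in> mcarrier N"
    and "lin_on (mcarrier M) f"
    and "v \<in> mcarrier M \<Longrightarrow> w \<in> mcarrier M \<Longrightarrow> f (v + w) = f v + f w"
    and "v \<in> mcarrier M \<Longrightarrow> f (c *\<^sub>C v) = c *\<^sub>C f v"
    and "v \<in> mcarrier M \<Longrightarrow> f (act M a v) = act N a (f v)"
  using assms by (auto simp: mod_hom_def lin_on_def)

lemma mod_homI:
  assumes "\<And>v. v \<in> mcarrier M \<Longrightarrow> f v \<in> mcarrier N"
    and "\<And>v w. v \<in> mcarrier M \<Longrightarrow> w \<in> mcarrier M \<Longrightarrow> f (v + w) = f v + f w"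
    and "\<And>c v. v \<in> mcarrier M \<Longrightarrow> f (c *\<^sub>C v) = c *\<^sub>C f v"
    and "\<And>a v. v \<in> mcarrier M \<Longrightarrow> f (act M a v) = act N a (f v)"
  shows "mod_hom M N f"
  using assms by (simp add: mod_hom_def lin_on_def)

lemma mod_hom_comp: "mod_hom M N f \<Longrightarrow> mod_hom N K g \<Longrightarrow> mod_hom M K (\<lambda>v. g (f v))"
  by (intro mod_homI) (auto simp: mod_homD)

lemma mod_hom_zero: "is_module M \<Longrightarrow> mod_hom M N f \<Longrightarrow> f 0 = 0"
  by (rule lin_on_zero[OF is_moduleD(1) mod_homD(2)])

lemma mod_hom_sum:
  assumes "is_module M" "mod_hom M N f" "\<And>i. i \<in> I \<Longrightarrow> v i \<in> mcarrier M"
  shows "f (\<Sum>i\<in>I. v i) = (\<Sum>i\<in>I. f (v i))"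
  using assms by (intro lin_on_sum[OF is_moduleD(1) mod_homD(2)]) auto

lemma sum_mod_hom:
  assumes N: "is_module N" and f: "\<And>i. i \<in> I \<Longrightarrow> mod_hom M N (f i)"
  shows "mod_hom M N (\<lambda>v. \<Sum>i\<in>I. f i v)"
proof (rule mod_homI)
  fix v a assume v: "v \<in> mcarrier M"
  show "(\<Sum>i\<in>I. f i v) \<in> mcarrier N"
    by (intro cvec.subspace_sum[OF is_moduleD(1)[OF N]] mod_homD(1)[OF f v])
  show "(\<Sum>i\<in>I. f i (act M a v)) = act N a (\<Sum>i\<in>I. f i v)"
    by (subst lin_on_sum[OF is_moduleD(1)[OF N] is_moduleD(3)[OF N]])
      (auto simp: mod_homD(5)[OF f v] intro!: sum.cong mod_homD(1)[OF f v])
qed (auto simp: mod_homD(3,4)[OF f] cvec.scale_sum_right simp flip: sum.distrib)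

lemma mod_iso_iff: "M \<cong>\<^sub>m N \<longleftrightarrow> (\<exists>f. bij_betw f (mcarrier M) (mcarrier N) \<and> mod_hom M N f)"
  unfolding mod_iso_def mod_hom_def by (auto dest: bij_betwE)

lemma mod_isoE:
  assumes "M \<cong>\<^sub>m N" "is_module M"
  obtains f g where "mod_hom M N f" "mod_hom N M g"
    "\<And>v. v \<in> mcarrier M \<Longrightarrow> g (f v) = v" "\<And>w. w \<in> mcarrier N \<Longrightarrow> f (g w) = w"
proof -
  obtain f where f: "bij_betw f (mcarrier M) (mcarrier N)" "mod_hom M N f"
    using assms(1) unfolding mod_iso_iff by blast
  define g where "g = inv_into (mcarrier M) f"
  have gf: "g (f v) = v" if "v \<in> mcarrier M" for v
    using f(1) that unfolding g_def by (simp add: bij_betw_def)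
  have fg: "f (g w) = w" and gM: "g w \<in> mcarrier M" if "w \<in> mcarrier N" for w
    using f(1) that unfolding g_def bij_betw_def by (auto simp: f_inv_into_f inv_into_into)
  note D = is_moduleD[OF assms(2)]
  note S = cvec.subspace_add[OF D(1)] cvec.subspace_scale[OF D(1)] D(2)
  have "mod_hom N M g"
  proof (rule mod_homI)
    fix v w c a assume v: "v \<in> mcarrier N"
    show "g v \<in> mcarrier M" by (rule gM[OF v])
    show "g (c *\<^sub>C v) = c *\<^sub>C g v"
      using gf[OF S(2)[OF gM[OF v], of c]] by (simp add: mod_homD[OF f(2)] gM v fg)
    show "g (act N a v) = act M a (g v)"
      using gf[OF S(3)[OF gM[OF v], of a]] by (simp add: mod_homD[OF f(2)] gM v fg)
    assume w: "w \<in> mcarrier N"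
    show "g (v + w) = g v + g w"
      using gf[OF S(1)[OF gM[OF v] gM[OF w]]] by (simp add: mod_homD[OF f(2)] gM v w fg)
  qed
  with that f(2) gf fg show ?thesis by blast
qed

lemma mod_isoI:
  assumes "mod_hom M N f" "\<And>w. w \<in> mcarrier N \<Longrightarrow> g w \<in> mcarrier M"
    and "\<And>v. v \<in> mcarrier M \<Longrightarrow> g (f v) = v" "\<And>w. w \<in> mcarrier N \<Longrightarrow> f (g w) = w"
  shows "M \<cong>\<^sub>m N"
  unfolding mod_iso_iff using assms
  by (intro exI[of _ f] conjI bij_betw_byWitness[where f' = g]) (auto dest: mod_homD(1))

lemma mod_iso_refl: "M \<cong>\<^sub>m M"
  by (rule mod_isoI[where f = "\<lambda>v. v" and g = "\<lambda>v. v"]) (auto intro: mod_homI)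

lemma mod_iso_sym: "M \<cong>\<^sub>m N \<Longrightarrow> is_module M \<Longrightarrow> N \<cong>\<^sub>m M"
  by (erule (1) mod_isoE) (blast intro: mod_isoI dest: mod_homD(1))

text \<open>An internal direct sum in the form of biorthogonal inclusions \<open>\<phi> j\<close>
  and projections \<open>\<psi> j\<close>. In contrast to an isomorphism with
  \<open>dsum J N\<close> this needs no further carrier type, composes, and restricts to weight
  spaces with the same maps. Zero summands are allowed.\<close>

definition decomposition :: "('a::calgebra, 'v::cvector) cmodule \<Rightarrow> 'j set \<Rightarrow>
    ('j \<Rightarrow> ('a, 'w::cvector) cmodule) \<Rightarrow> ('j \<Rightarrow> 'w \<Rightarrow> 'v) \<Rightarrow> ('j \<Rightarrow> 'v \<Rightarrow> 'w) \<Rightarrow> bool" where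
  "decomposition M J N \<phi> \<psi> \<longleftrightarrow> is_module M \<and> finite J \<and>
     (\<forall>j\<in>J. is_module (N j) \<and> mod_hom (N j) M (\<phi> j) \<and> mod_hom M (N j) (\<psi> j)) \<and>
     (\<forall>i\<in>J. \<forall>j\<in>J. \<forall>x\<in>mcarrier (N j). \<psi> i (\<phi> j x) = (if i = j then x else 0)) \<and>
     (\<forall>v\<in>mcarrier M. (\<Sum>j\<in>J. \<phi> j (\<psi> j v)) = v)"

definition decomposes :: "('a::calgebra, 'v::cvector) cmodule \<Rightarrow> 'j set \<Rightarrow>
    ('j \<Rightarrow> ('a, 'w::cvector) cmodule) \<Rightarrow> bool" where
  "decomposes M J N \<longleftrightarrow> (\<exists>\<phi> \<psi>. decomposition M J N \<phi> \<psi>)"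

lemma decompositionD:
  assumes "decomposition M J N \<phi> \<psi>"
  shows "is_module M" "finite J" "j \<in> J \<Longrightarrow> is_module (N j)"
    "j \<in> J \<Longrightarrow> mod_hom (N j) M (\<phi> j)" "j \<in> J \<Longrightarrow> mod_hom M (N j) (\<psi> j)"
    "i \<in> J \<Longrightarrow> j \<in> J \<Longrightarrow> x \<in> mcarrier (N j) \<Longrightarrow> \<psi> i (\<phi> j x) = (if i = j then x else 0)"
    "v \<in> mcarrier M \<Longrightarrow> (\<Sum>j\<in>J. \<phi> j (\<psi> j v)) = v"
  using assms unfolding decomposition_def by auto

lemma decompositionI:
  assumes "is_module M" "finite J" "\<And>j. j \<in> J \<Longrightarrow> is_module (N j)"
    "\<And>j. j \<in> J \<Longrightarrow> mod_hom (N j) M (\<phi> j)" "\<And>j. j \<in> J \<Longrightarrow> mod_hom M (N j) (\<psi> j)"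
    "\<And>i j x. i \<in> J \<Longrightarrow> j \<in> J \<Longrightarrow> x \<in> mcarrier (N j) \<Longrightarrow> \<psi> i (\<phi> j x) = (if i = j then x else 0)"
    "\<And>v. v \<in> mcarrier M \<Longrightarrow> (\<Sum>j\<in>J. \<phi> j (\<psi> j v)) = v"
  shows "decomposition M J N \<phi> \<psi>"
  using assms unfolding decomposition_def by auto

lemma decomposition_comp:
  assumes d: "decomposition M J N \<phi> \<psi>" and i: "i \<in> J" and x: "\<And>j. j \<in> J \<Longrightarrow> x j \<in> mcarrier (N j)"
  shows "\<psi> i (\<Sum>j\<in>J. \<phi> j (x j)) = x i"
proof -
  note D = decompositionD[OF d]
  have "\<psi> i (\<Sum>j\<in>J. \<phi> j (x j)) = (\<Sum>j\<in>J. \<psi> i (\<phi> j (x j)))"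
    using D(4) x by (intro mod_hom_sum[OF D(1) D(5)[OF i]]) (auto dest: mod_homD(1))
  also have "\<dots> = (\<Sum>j\<in>J. if i = j then x j else 0)"
    using D(6)[OF i] x by (intro sum.cong) auto
  also have "\<dots> = x i" using i D(2) by simp
  finally show ?thesis .
qed

text \<open>Equivariance of the projections is automatic: expand \<open>act M a v\<close> into the
  vectors \<open>\<phi> j (act (N j) a (\<psi> j v))\<close> and read off the component at
  \<open>i\<close>. Hence projections known only as linear coordinate maps suffice.\<close>

lemma decomposition_lin:
  assumes "is_module M" "finite J" "\<And>j. j \<in> J \<Longrightarrow> is_module (N j)"
    "\<And>j. j \<in> J \<Longrightarrow> mod_hom (N j) M (\<phi> j)" "\<And>j. j \<in> J \<Longrightarrow> lin_on (mcarrier M) (\<psi> j)"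
    "\<And>j v. j \<in> J \<Longrightarrow> v \<in> mcarrier M \<Longrightarrow> \<psi> j v \<in> mcarrier (N j)"
    "\<And>i j x. i \<in> J \<Longrightarrow> j \<in> J \<Longrightarrow> x \<in> mcarrier (N j) \<Longrightarrow> \<psi> i (\<phi> j x) = (if i = j then x else 0)"
    "\<And>v. v \<in> mcarrier M \<Longrightarrow> (\<Sum>j\<in>J. \<phi> j (\<psi> j v)) = v"
  shows "decomposition M J N \<phi> \<psi>"
proof (rule decompositionI)
  fix i assume i: "i \<in> J"
  have "\<psi> i (act M a v) = act (N i) a (\<psi> i v)" if v: "v \<in> mcarrier M" for a v
  proof -
    have "act M a v = act M a (\<Sum>j\<in>J. \<phi> j (\<psi> j v))" using assms(8)[OF v] by simp
    also have "\<dots> = (\<Sum>j\<in>J. act M a (\<phi> j (\<psi> j v)))"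
      using assms(4,6) v
      by (intro lin_on_sum[OF is_moduleD(1)[OF assms(1)] is_moduleD(3)[OF assms(1)]]) (auto dest: mod_homD(1))
    also have "\<dots> = (\<Sum>j\<in>J. \<phi> j (act (N j) a (\<psi> j v)))"
      by (intro sum.cong HOL.refl mod_homD(5)[OF assms(4), symmetric] assms(6) v)
    finally have "\<psi> i (act M a v) = \<psi> i (\<Sum>j\<in>J. \<phi> j (act (N j) a (\<psi> j v)))" by simp
    also have "\<dots> = (\<Sum>j\<in>J. \<psi> i (\<phi> j (act (N j) a (\<psi> j v))))"
      by (intro lin_on_sum[OF is_moduleD(1)[OF assms(1)] assms(5)[OF i]] mod_homD(1)[OF assms(4)]
          is_moduleD(2)[OF assms(3)] assms(6) v)
    also have "\<dots> = (\<Sum>j\<in>J. if i = j then act (N j) a (\<psi> j v) else 0)"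
      using assms(3,6) v i by (intro sum.cong HOL.refl assms(7)) (auto simp: is_moduleD)
    also have "\<dots> = act (N i) a (\<psi> i v)" using i assms(2) by simp
    finally show ?thesis .
  qed
  then show "mod_hom M (N i) (\<psi> i)"
    using assms(5,6)[OF i] by (simp add: mod_hom_def)
qed (use assms in auto)

lemma decomposes_iso:
  fixes M :: "('a::calgebra, 'v::cvector) cmodule" and M' :: "('a, 'v'::cvector) cmodule"
  assumes "decomposes M J N" "decomposes M' J' N'" "bij_betw \<pi> J J'"
    and iso: "\<And>j. j \<in> J \<Longrightarrow> N j \<cong>\<^sub>m N' (\<pi> j)"
  shows "M \<cong>\<^sub>m M'"
proof -
  obtain \<phi> \<psi> where d: "decomposition M J N \<phi> \<psi>" using assms(1) unfolding decomposes_def by blast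
  obtain \<phi>' \<psi>' where d': "decomposition M' J' N' \<phi>' \<psi>'" using assms(2) unfolding decomposes_def by blast
  note D = decompositionD[OF d] and D' = decompositionD[OF d']
  have "\<exists>f g. mod_hom (N j) (N' (\<pi> j)) f \<and> mod_hom (N' (\<pi> j)) (N j) g \<and>
      (\<forall>x\<in>mcarrier (N j). g (f x) = x) \<and> (\<forall>x\<in>mcarrier (N' (\<pi> j)). f (g x) = x)" if "j \<in> J" for j
    by (rule mod_isoE[OF iso[OF that] D(3)[OF that]]) blast
  then obtain f g where fg: "\<And>j. j \<in> J \<Longrightarrow> mod_hom (N j) (N' (\<pi> j)) (f j)"
      "\<And>j. j \<in> J \<Longrightarrow> mod_hom (N' (\<pi> j)) (N j) (g j)"
      "\<And>j x. j \<in> J \<Longrightarrow> x \<in> mcarrier (N j) \<Longrightarrow> g j (f j x) = x"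
      "\<And>j x. j \<in> J \<Longrightarrow> x \<in> mcarrier (N' (\<pi> j)) \<Longrightarrow> f j (g j x) = x"
    by metis
  have \<pi>: "\<pi> j \<in> J'" if "j \<in> J" for j using assms(3) that by (auto simp: bij_betw_def)
  \<comment> \<open>Components of \<open>F v\<close> are read off with
    \<open>decomposition_comp\<close>, which speaks of sums over \<open>J'\<close>; this calls for
    re-indexing by the inverse of \<open>\<pi>\<close>.\<close>
  define \<sigma> where "\<sigma> = inv_into J \<pi>"
  have \<sigma>: "\<sigma> (\<pi> j) = j" if "j \<in> J" for j
    using assms(3) that unfolding \<sigma>_def by (simp add: bij_betw_def)
  have re: "(\<Sum>j\<in>J. h (\<pi> j)) = sum h J'" for h :: "_ \<Rightarrow> 'v'"
    using sum.reindex_bij_betw[OF assms(3), of h] .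
  define F where "F v = (\<Sum>j\<in>J. \<phi>' (\<pi> j) (f j (\<psi> j v)))" for v
  define G where "G w = (\<Sum>j\<in>J. \<phi> j (g j (\<psi>' (\<pi> j) w)))" for w
  have F: "mod_hom M M' F" unfolding F_def
    by (rule sum_mod_hom[OF D'(1)]) (intro mod_hom_comp[OF D(5) mod_hom_comp[OF fg(1) D'(4)[OF \<pi>]]])
  have cF: "\<psi>' (\<pi> i) (F v) = f i (\<psi> i v)" if v: "v \<in> mcarrier M" and i: "i \<in> J" for i v
  proof -
    have "F v = (\<Sum>j\<in>J'. \<phi>' j (f (\<sigma> j) (\<psi> (\<sigma> j) v)))"
      unfolding F_def re[symmetric] by (intro sum.cong) (simp_all add: \<sigma>)
    moreover have "f (\<sigma> j) (\<psi> (\<sigma> j) v) \<in> mcarrier (N' j)" if j: "j \<in> J'" for j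
    proof -
      obtain l where "l \<in> J" "j = \<pi> l" using j assms(3) unfolding bij_betw_def by blast
      then show ?thesis using fg(1) D(5) v by (auto simp: \<sigma> dest: mod_homD(1))
    qed
    ultimately show ?thesis using decomposition_comp[OF d' \<pi>[OF i]] i by (simp add: \<sigma>)
  qed
  have GM: "G w \<in> mcarrier M" if w: "w \<in> mcarrier M'" for w
    unfolding G_def using D(4) fg(2) D'(5) \<pi> w
    by (intro cvec.subspace_sum[OF is_moduleD(1)[OF D(1)]]) (blast dest: mod_homD(1))
  have cG: "\<psi> i (G w) = g i (\<psi>' (\<pi> i) w)" if w: "w \<in> mcarrier M'" and i: "i \<in> J" for i w
    unfolding G_def using fg(2) D'(5) \<pi> w
    by (intro decomposition_comp[OF d i]) (blast dest: mod_homD(1))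
  show ?thesis
  proof (rule mod_isoI[where f = F and g = G])
    fix v assume v: "v \<in> mcarrier M"
    have "G (F v) = (\<Sum>j\<in>J. \<phi> j (\<psi> j v))"
      unfolding G_def by (intro sum.cong HOL.refl) (simp add: cF v fg(3) mod_homD(1)[OF D(5) v])
    then show "G (F v) = v" using D(7) v by simp
  next
    fix w assume w: "w \<in> mcarrier M'"
    have "F (G w) = (\<Sum>j\<in>J. \<phi>' (\<pi> j) (\<psi>' (\<pi> j) w))"
      unfolding F_def by (intro sum.cong HOL.refl) (simp add: cG w fg(4) mod_homD(1)[OF D'(5)[OF \<pi>] w])
    also have "\<dots> = w" unfolding re[of "\<lambda>j. \<phi>' j (\<psi>' j w)"] using D'(7) w by simp
    finally show "F (G w) = w" .
  qed (use F GM in auto)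
qed

text \<open>Bijections between the fibres glue, because an element determines its label. With
  isomorphism types as labels, an isomorphism of direct sums is reduced to counting.\<close>

lemma ex_bij_betw_fibres:
  assumes "finite J" "finite J'"
    and "\<And>x. card {j \<in> J. \<kappa> j = x} = card {j \<in> J'. \<kappa>' j = x}"
  shows "\<exists>\<pi>. bij_betw \<pi> J J' \<and> (\<forall>j\<in>J. \<kappa>' (\<pi> j) = \<kappa> j)"
proof -
  have "\<exists>\<pi>. bij_betw \<pi> {j \<in> J. \<kappa> j = x} {j \<in> J'. \<kappa>' j = x}" for x
    using assms by (intro finite_same_card_bij) auto
  then obtain \<pi> where \<pi>: "\<And>x. bij_betw (\<pi> x) {j \<in> J. \<kappa> j = x} {j \<in> J'. \<kappa>' j = x}" by metis
  have r: "\<pi> (\<kappa> j) j \<in> J'" "\<kappa>' (\<pi> (\<kappa> j) j) = \<kappa> j" if "j \<in> J" for j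
    using bij_betwE[OF \<pi>[of "\<kappa> j"]] that by auto
  have "bij_betw (\<lambda>j. \<pi> (\<kappa> j) j) J J'"
    unfolding bij_betw_def
  proof
    show "inj_on (\<lambda>j. \<pi> (\<kappa> j) j) J"
    proof (rule inj_onI)
      fix i j assume ij: "i \<in> J" "j \<in> J" and eq: "\<pi> (\<kappa> i) i = \<pi> (\<kappa> j) j"
      then have "\<kappa> i = \<kappa> j" using r(2) by metis
      then show "i = j" using \<pi>[of "\<kappa> j"] ij eq unfolding bij_betw_def inj_on_def by auto
    qed
    show "(\<lambda>j. \<pi> (\<kappa> j) j) ` J = J'"
    proof
      show "(\<lambda>j. \<pi> (\<kappa> j) j) ` J \<subseteq> J'" using r by auto
      show "J' \<subseteq> (\<lambda>j. \<pi> (\<kappa> j) j) ` J"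
      proof
        fix j' assume "j' \<in> J'"
        then have "j' \<in> \<pi> (\<kappa>' j') ` {j \<in> J. \<kappa> j = \<kappa>' j'}"
          using \<pi>[of "\<kappa>' j'"] unfolding bij_betw_def by auto
        then obtain j where "j \<in> J" "\<kappa> j = \<kappa>' j'" "j' = \<pi> (\<kappa>' j') j" by blast
        then show "j' \<in> (\<lambda>j. \<pi> (\<kappa> j) j) ` J" by (intro image_eqI[of _ _ j]) auto
      qed
    qed
  qed
  then show ?thesis using r by blast
qed

lemma decomposes_transfer:
  assumes iso: "M \<cong>\<^sub>m M'" and M: "is_module M" and d: "decomposes M' J N"
  shows "decomposes M J N"
proof -
  obtain \<phi> \<psi> where "decomposition M' J N \<phi> \<psi>" using d unfolding decomposes_def by blast
  note D = decompositionD[OF this]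
  obtain f g where fg: "mod_hom M M' f" "mod_hom M' M g"
    "\<And>v. v \<in> mcarrier M \<Longrightarrow> g (f v) = v" "\<And>w. w \<in> mcarrier M' \<Longrightarrow> f (g w) = w"
    using mod_isoE[OF iso M] by metis
  have "decomposition M J N (\<lambda>j x. g (\<phi> j x)) (\<lambda>j v. \<psi> j (f v))"
  proof (rule decompositionI)
    fix v assume v: "v \<in> mcarrier M"
    have "(\<Sum>j\<in>J. g (\<phi> j (\<psi> j (f v)))) = g (\<Sum>j\<in>J. \<phi> j (\<psi> j (f v)))"
      using D(4,5) v mod_homD(1)[OF fg(1)] by (intro mod_hom_sum[OF D(1) fg(2), symmetric]) (blast dest: mod_homD(1))
    then show "(\<Sum>j\<in>J. g (\<phi> j (\<psi> j (f v)))) = v" using D(7)[OF mod_homD(1)[OF fg(1) v]] fg(3)[OF v] by simp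
  next
    fix i j x assume "i \<in> J" "j \<in> J" "x \<in> mcarrier (N j)"
    then show "\<psi> i (f (g (\<phi> j x))) = (if i = j then x else 0)"
      using fg(4)[OF mod_homD(1)[OF D(4)]] D(6) by simp
  qed (use D M fg in \<open>auto intro: mod_hom_comp\<close>)
  then show ?thesis unfolding decomposes_def by blast
qed

text \<open>Serves to discard the pairs of words that contribute nothing at the given weight: a zero
  summand adds 0 to the sum that reconstructs \<open>v\<close>.\<close>

lemma decomposes_drop_zero:
  assumes d: "decomposes M J N" and "I \<subseteq> J" "\<And>j. j \<in> J - I \<Longrightarrow> mcarrier (N j) = {0}"
  shows "decomposes M I N"
proof -
  obtain \<phi> \<psi> where d: "decomposition M J N \<phi> \<psi>" using d unfolding decomposes_def by blast
  note D = decompositionD[OF d]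
  have "decomposition M I N \<phi> \<psi>"
  proof (rule decompositionI)
    fix v assume v: "v \<in> mcarrier M"
    have "\<phi> j (\<psi> j v) = 0" if j: "j \<in> J - I" for j
    proof -
      have "\<psi> j v \<in> mcarrier (N j)" using mod_homD(1)[OF D(5) v] j by auto
      then have "\<psi> j v = 0" using assms(3)[OF j] by auto
      then show ?thesis using mod_hom_zero[OF D(3) D(4)] j by auto
    qed
    then have "(\<Sum>j\<in>I. \<phi> j (\<psi> j v)) = (\<Sum>j\<in>J. \<phi> j (\<psi> j v))"
      using assms(2) D(2) by (intro sum.mono_neutral_left) auto
    then show "(\<Sum>j\<in>I. \<phi> j (\<psi> j v)) = v" using D(7) v by simp
  next
    fix i j x assume "i \<in> I" "j \<in> I" "x \<in> mcarrier (N j)"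
    then show "\<psi> i (\<phi> j x) = (if i = j then x else 0)" using assms(2) by (intro D(6)) auto
  qed (use assms(2) D in \<open>auto intro: finite_subset\<close>)
  then show ?thesis unfolding decomposes_def by blast
qed

text \<open>Flattens nested sums: a direct sum of \<open>copies\<close> becomes one family indexed
  by a summand together with the number of the copy, and its fibres can be counted.\<close>

lemma decomposes_Sigma:
  assumes d: "decomposes M J N" and e: "\<And>j. j \<in> J \<Longrightarrow> decomposes (N j) (K j) (N' j)"
  shows "decomposes M (Sigma J K) (\<lambda>(j, k). N' j k)"
proof -
  obtain \<phi> \<psi> where d: "decomposition M J N \<phi> \<psi>" using d unfolding decomposes_def by blast
  note D = decompositionD[OF d]
  obtain \<phi>' \<psi>' where e: "\<And>j. j \<in> J \<Longrightarrow> decomposition (N j) (K j) (N' j) (\<phi>' j) (\<psi>' j)"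
    using e unfolding decomposes_def by metis
  note E = decompositionD[OF e]
  have "decomposition M (Sigma J K) (\<lambda>(j, k). N' j k) (\<lambda>(j, k) x. \<phi> j (\<phi>' j k x)) (\<lambda>(j, k) v. \<psi>' j k (\<psi> j v))"
  proof (rule decompositionI)
    fix v assume v: "v \<in> mcarrier M"
    have "(\<Sum>p\<in>Sigma J K. (\<lambda>(j, k) x. \<phi> j (\<phi>' j k x)) p ((\<lambda>(j, k) v. \<psi>' j k (\<psi> j v)) p v)) =
      (\<Sum>(j, k)\<in>Sigma J K. \<phi> j (\<phi>' j k (\<psi>' j k (\<psi> j v))))"
      by (intro sum.cong) auto
    also have "\<dots> = (\<Sum>j\<in>J. \<Sum>k\<in>K j. \<phi> j (\<phi>' j k (\<psi>' j k (\<psi> j v))))"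
      using D(2) E(2) by (subst sum.Sigma) auto
    also have "\<dots> = (\<Sum>j\<in>J. \<phi> j (\<psi> j v))"
    proof (rule sum.cong[OF HOL.refl])
      fix j assume j: "j \<in> J"
      then have w: "\<psi> j v \<in> mcarrier (N j)" using D(5) v by (auto dest: mod_homD(1))
      have "(\<Sum>k\<in>K j. \<phi> j (\<phi>' j k (\<psi>' j k (\<psi> j v)))) = \<phi> j (\<Sum>k\<in>K j. \<phi>' j k (\<psi>' j k (\<psi> j v)))"
        using E(4,5) j w by (intro mod_hom_sum[OF D(3,4), symmetric]) (blast dest: mod_homD(1))+
      also have "\<dots> = \<phi> j (\<psi> j v)" using E(7)[OF j w] by simp
      finally show "(\<Sum>k\<in>K j. \<phi> j (\<phi>' j k (\<psi>' j k (\<psi> j v)))) = \<phi> j (\<psi> j v)" .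
    qed
    finally show "(\<Sum>p\<in>Sigma J K. (\<lambda>(j, k) x. \<phi> j (\<phi>' j k x)) p ((\<lambda>(j, k) v. \<psi>' j k (\<psi> j v)) p v)) = v"
      using D(7) v by simp
  next
    fix p q x assume pq: "p \<in> Sigma J K" "q \<in> Sigma J K" and x: "x \<in> mcarrier ((\<lambda>(j, k). N' j k) q)"
    obtain i k j l where p: "p = (i, k)" and q: "q = (j, l)" by (cases p, cases q)
    have ij: "i \<in> J" "k \<in> K i" "j \<in> J" "l \<in> K j" and x: "x \<in> mcarrier (N' j l)"
      using pq x by (auto simp: p q)
    have y: "\<phi>' j l x \<in> mcarrier (N j)" using E(4)[OF ij(3,4)] x by (auto dest: mod_homD(1))
    have "\<psi>' i k 0 = 0" using mod_hom_zero[OF D(3) E(5)] ij by auto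
    then have "\<psi>' i k (\<psi> i (\<phi> j (\<phi>' j l x))) = (if p = q then x else 0)"
      using D(6)[OF ij(1,3) y] E(6)[OF ij(3) _ ij(4) x, of k] ij by (auto simp: p q)
    then show "(\<lambda>(j, k) v. \<psi>' j k (\<psi> j v)) p ((\<lambda>(j, k) x. \<phi> j (\<phi>' j k x)) q x) = (if p = q then x else 0)"
      by (simp add: p q)
  qed (use D(1,2) E(2,3) mod_hom_comp[OF E(4) D(4)] mod_hom_comp[OF D(5) E(5)] in auto)
  then show ?thesis unfolding decomposes_def by blast
qed

section \<open>External direct sums, copies and binary sums as decompositions\<close>

lemma lookup_dsum_act:
  assumes "\<And>j. j \<in> J \<Longrightarrow> is_module (N j)" "f \<in> mcarrier (dsum J N)"
  shows "Poly_Mapping.lookup (act (dsum J N) a f) j =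
    (if j \<in> J then act (N j) a (Poly_Mapping.lookup f j) else 0)"
proof -
  \<comment> \<open>\<open>Poly_Mapping.mapp\<close> applies its function on the support only; at a
    vanishing component both sides still agree because the action is linear.\<close>
  have "act (N j) a 0 = 0" if "j \<in> J"
    using lin_on_zero[OF is_moduleD(1,3)[OF assms(1)[OF that]]] .
  then show ?thesis using assms(2)
    by (auto simp: dsum_def mapp.rep_eq when_def in_keys_iff)
qed

lemma dsum_carrier:
  "f \<in> mcarrier (dsum J N) \<longleftrightarrow> Poly_Mapping.keys f \<subseteq> J \<and> (\<forall>j\<in>J. Poly_Mapping.lookup f j \<in> mcarrier (N j))"
  by (simp add: dsum_def)

lemma dsum_module:
  assumes N: "\<And>j. j \<in> J \<Longrightarrow> is_module (N j)"
  shows "is_module (dsum J N)"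
proof -
  have L: "Poly_Mapping.lookup (act (dsum J N) a f) j =
      (if j \<in> J then act (N j) a (Poly_Mapping.lookup f j) else 0)" if "f \<in> mcarrier (dsum J N)" for a f j
    using lookup_dsum_act[OF N that] .
  let ?M = "dsum J N"
  note D = is_moduleD[OF N]
  have C: "f \<in> mcarrier ?M \<longleftrightarrow> (\<forall>j. if j \<in> J then Poly_Mapping.lookup f j \<in> mcarrier (N j)
      else Poly_Mapping.lookup f j = 0)" for f
    by (auto simp: dsum_carrier in_keys_iff subset_iff split: if_splits)
  have sub: "cvec.subspace (mcarrier ?M)"
    by (rule cvec.subspaceI)
      (simp_all add: C lookup_add scaleC_poly_mapping.rep_eq cvec.subspace_0[OF D(1)]
        cvec.subspace_add[OF D(1)] cvec.subspace_scale[OF D(1)])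
  note S = cvec.subspace_add[OF sub] cvec.subspace_scale[OF sub]
  have cl: "act ?M a v \<in> mcarrier ?M" if "v \<in> mcarrier ?M" for a v
  proof -
    have "\<forall>j. j \<in> J \<longrightarrow> Poly_Mapping.lookup v j \<in> mcarrier (N j)" using that by (simp add: C)
    then show ?thesis unfolding C[of "act ?M a v"] L[OF that] by (simp add: D(2))
  qed
  have in_N: "Poly_Mapping.lookup v j \<in> mcarrier (N j)" if "v \<in> mcarrier ?M" "j \<in> J" for v j
    using that by (simp add: dsum_carrier)
  have out: "Poly_Mapping.lookup v j = 0" if "v \<in> mcarrier ?M" "j \<notin> J" for v j
    using that by (auto simp: dsum_carrier in_keys_iff)
  show ?thesis
    by (rule is_moduleI[OF sub cl]; (rule poly_mapping_eqI)?)
      (simp_all add: L S cl lookup_add scaleC_poly_mapping.rep_eq in_N out D)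
qed

lemma decomposes_dsum:
  assumes "finite J" and N: "\<And>j. j \<in> J \<Longrightarrow> is_module (N j)"
  shows "decomposes (dsum J N) J N"
proof -
  note M = dsum_module[where J = J and N = N, OF N] and D = is_moduleD[OF N]
  note Z = cvec.subspace_0[OF D(1)]
  have a0: "act (N j) a 0 = 0" if "j \<in> J" for j a
    using lin_on_zero[OF is_moduleD(1,3)[OF N[OF that]]] .
  have sM: "Poly_Mapping.single j x \<in> mcarrier (dsum J N)" if "j \<in> J" "x \<in> mcarrier (N j)" for j x
    using that Z by (auto simp: dsum_carrier lookup_single when_def)
  have "decomposition (dsum J N) J N Poly_Mapping.single (\<lambda>j f. Poly_Mapping.lookup f j)"
  proof (rule decompositionI)
    show "mod_hom (N j) (dsum J N) (Poly_Mapping.single j)" if "j \<in> J" for j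
      using that sM a0
      by (intro mod_homI poly_mapping_eqI)
        (auto simp: lookup_dsum_act[OF N] lookup_add lookup_single when_def scaleC_poly_mapping.rep_eq)
    show "mod_hom (dsum J N) (N j) (\<lambda>f. Poly_Mapping.lookup f j)" if "j \<in> J" for j
      using that by (intro mod_homI)
        (auto simp: lookup_dsum_act[OF N] lookup_add scaleC_poly_mapping.rep_eq, simp add: dsum_carrier)
    show "(\<Sum>j\<in>J. Poly_Mapping.single j (Poly_Mapping.lookup v j)) = v" if "v \<in> mcarrier (dsum J N)" for v
      using that assms(1) by (intro poly_mapping_eqI)
        (auto simp: dsum_carrier lookup_sum lookup_single when_def in_keys_iff subset_iff)
  qed (use assms M in \<open>auto simp: lookup_single\<close>)
  then show ?thesis unfolding decomposes_def by blast
qed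

lemma decomposes_copies: "is_module M \<Longrightarrow> decomposes (copies r M) {..<r} (\<lambda>_. M)"
  unfolding copies_def by (rule decomposes_dsum) auto

lemma copies_module: "is_module M \<Longrightarrow> is_module (copies r M)"
  unfolding copies_def by (rule dsum_module)

lemma sum_Pair_zero:
  "(\<Sum>j\<in>A. (f j, 0)) = (sum f A, 0)" "(\<Sum>j\<in>A. (0, f j)) = (0, sum f A)"
  by (induction A rule: infinite_finite_induct) (simp_all add: zero_prod_def plus_prod_def)

lemma decomposes_dsum2:
  assumes "decomposes M J N" "decomposes M' J' N'"
  shows "decomposes (M \<oplus>\<^sub>m M') (J <+> J') (case_sum N N')"
proof -
  obtain \<phi> \<psi> where d: "decomposition M J N \<phi> \<psi>" using assms(1) unfolding decomposes_def by blast
  obtain \<phi>' \<psi>' where d': "decomposition M' J' N' \<phi>' \<psi>'" using assms(2) unfolding decomposes_def by blast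
  note D = decompositionD[OF d] and D' = decompositionD[OF d']
  note m = is_moduleD[OF D(1)] is_moduleD[OF D'(1)]
  have s0: "0 \<in> mcarrier M" "0 \<in> mcarrier M'" using m(1,10) by (auto intro: cvec.subspace_0)
  have a0: "act M a 0 = 0" "act M' a 0 = 0" for a
    using lin_on_zero[OF m(1,3)] lin_on_zero[OF m(10,12)] .
  have mod: "is_module (M \<oplus>\<^sub>m M')"
    using m(1,10) by (intro is_moduleI cvec.subspaceI)
     (auto simp: dsum2_def m plus_prod_def scaleC_prod_def zero_prod_def
       intro: cvec.subspace_0 cvec.subspace_add cvec.subspace_scale)
  have "decomposition (M \<oplus>\<^sub>m M') (J <+> J') (case_sum N N')
     (case_sum (\<lambda>j x. (\<phi> j x, 0)) (\<lambda>j x. (0, \<phi>' j x))) (case_sum (\<lambda>j v. \<psi> j (fst v)) (\<lambda>j v. \<psi>' j (snd v)))"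
  proof (rule decompositionI[OF mod])
    show "mod_hom (case_sum N N' j) (M \<oplus>\<^sub>m M') (case_sum (\<lambda>j x. (\<phi> j x, 0)) (\<lambda>j x. (0, \<phi>' j x)) j)"
      if "j \<in> J <+> J'" for j
      using that s0 a0 by (auto intro!: mod_homI simp: dsum2_def plus_prod_def scaleC_prod_def
          mod_homD[OF D(4)] mod_homD[OF D'(4)])
    show "mod_hom (M \<oplus>\<^sub>m M') (case_sum N N' j) (case_sum (\<lambda>j v. \<psi> j (fst v)) (\<lambda>j v. \<psi>' j (snd v)) j)"
      if "j \<in> J <+> J'" for j
      using that s0 a0 by (auto intro!: mod_homI simp: dsum2_def plus_prod_def scaleC_prod_def
          mod_homD[OF D(5)] mod_homD[OF D'(5)])
    show "case_sum (\<lambda>j v. \<psi> j (fst v)) (\<lambda>j v. \<psi>' j (snd v)) i (case_sum (\<lambda>j x. (\<phi> j x, 0)) (\<lambda>j x. (0, \<phi>' j x)) j x)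
        = (if i = j then x else 0)"
      if "i \<in> J <+> J'" "j \<in> J <+> J'" "x \<in> mcarrier (case_sum N N' j)" for i j x
      using that mod_hom_zero[OF D(1) D(5)] mod_hom_zero[OF D'(1) D'(5)] by (auto simp: D(6) D'(6) split: if_splits)
    show "(\<Sum>j\<in>J <+> J'. case_sum (\<lambda>j x. (\<phi> j x, 0)) (\<lambda>j x. (0, \<phi>' j x)) j
        (case_sum (\<lambda>j v. \<psi> j (fst v)) (\<lambda>j v. \<psi>' j (snd v)) j v)) = v"
      if "v \<in> mcarrier (M \<oplus>\<^sub>m M')" for v
      using that
      by (cases v) (simp add: sum.Plus D(2) D'(2) D(7) D'(7) dsum2_def plus_prod_def sum_Pair_zero)
  qed (use D D' in auto)
  then show ?thesis unfolding decomposes_def by blast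
qed

section \<open>Ballot words\<close>

text \<open>Words grow at the head, one letter per adjoined point: \<open>True\<close> picks the
  summand of highest weight l + 1, \<open>False\<close> the one of highest weight l - 1. On ballot
  words the subtraction never truncates. Ballot words of length n and height n - 2i correspond to
  standard tableaux of the two-row shape (n - i, i).\<close>

fun height :: "bool list \<Rightarrow> nat" where
  "height [] = 0"
| "height (True # q) = Suc (height q)"
| "height (False # q) = height q - 1"

fun ballot :: "bool list \<Rightarrow> bool" where
  "ballot [] \<longleftrightarrow> True"
| "ballot (True # q) \<longleftrightarrow> ballot q"
| "ballot (False # q) \<longleftrightarrow> ballot q \<and> 0 < height q"

definition words :: "nat \<Rightarrow> bool list set" where
  "words n = {q. length q = n \<and> ballot q}"

lemma words_0: "words 0 = {[]}"
  by (auto simp: words_def)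

lemma words_Suc: "words (Suc n) = Cons True ` words n \<union> Cons False ` {q \<in> words n. 0 < height q}"
proof (intro set_eqI iffI)
  fix q assume q: "q \<in> words (Suc n)"
  then obtain b r where br: "q = b # r" by (cases q) (auto simp: words_def)
  show "q \<in> Cons True ` words n \<union> Cons False ` {q \<in> words n. 0 < height q}"
    using q by (cases b) (auto simp: br words_def)
qed (auto simp: words_def)

lemma finite_words: "finite (words n)"
  by (induction n) (simp_all add: words_0 words_Suc)

lemma words_height: "q \<in> words n \<Longrightarrow> \<exists>i. 2 * i \<le> n \<and> height q = n - 2 * i"
proof (induction n arbitrary: q)
  case 0
  then show ?case by (simp add: words_0)
next
  case (Suc n)
  from Suc.prems consider r where "r \<in> words n" "q = True # r" | r where "r \<in> words n" "0 < height r" "q = False # r"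
    unfolding words_Suc by auto
  then show ?case
  proof cases
    case 1
    with Suc.IH obtain i where "2 * i \<le> n" "height r = n - 2 * i" by blast
    then show ?thesis using 1 by (intro exI[of _ i]) auto
  next
    case 2
    with Suc.IH obtain i where "2 * i \<le> n" "height r = n - 2 * i" by blast
    then show ?thesis using 2 by (intro exI[of _ "Suc i"]) auto
  qed
qed

text \<open>Split by the head. The form \<open>Suc (height q) = l\<close> makes the first set empty
  at l = 0, where \<open>height q = l - 1\<close> would wrongly count the words of height 0.\<close>

lemma card_words_Suc:
  "card {q \<in> words (Suc n). height q = l} =
     card {q \<in> words n. Suc (height q) = l} + card {q \<in> words n. height q = Suc l}"
proof -
  have "{q \<in> words (Suc n). height q = l} =
      Cons True ` {q \<in> words n. Suc (height q) = l} \<union> Cons False ` {q \<in> words n. height q = Suc l}"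
    unfolding words_Suc by auto
  moreover have "card \<dots> = card (Cons True ` {q \<in> words n. Suc (height q) = l}) +
      card (Cons False ` {q \<in> words n. height q = Suc l})"
    using finite_words by (intro card_Un_disjoint) auto
  ultimately show ?thesis by (simp add: card_image inj_on_def)
qed

text \<open>The absorption identity i C(n,i) = (n - i + 1) C(n,i-1) turns the quotient into a
  difference of neighbouring binomials, the form to which Pascal's rule applies. Integers keep the
  subtraction exact.\<close>

lemma mult_m_binomial:
  assumes "2 * i \<le> n"
  shows "int (mult_m i n) = int (n choose i) - (if i = 0 then 0 else int (n choose (i - 1)))"
proof -
  have "real (mult_m i n) = real (n choose i) - (if i = 0 then 0 else real (n choose (i - 1)))"
  proof (cases i)
    case 0
    then show ?thesis using mult_m_exact[OF assms] by simp
  next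
    case (Suc j)
    have "Suc j * (n choose Suc j) = (n - j) * (n choose j)"
      using binomial_absorb_comp[of n j] binomial_absorption[of j n] by simp
    then have "real (Suc j) * real (n choose Suc j) = real (n - j) * real (n choose j)"
      by (metis of_nat_mult)
    then have eq: "real i * real (n choose i) = (real n - real i + 1) * real (n choose j)"
      using assms Suc by (simp add: of_nat_diff)
    have pos: "real n - real i + 1 > 0" using assms by linarith
    have "(real n - 2 * real i + 1) / (real n - real i + 1) * real (n choose i) =
        real (n choose i) - real (n choose j)"
      using pos eq by (simp add: field_simps)
    then show ?thesis using mult_m_exact[OF assms] Suc by simp
  qed
  then have "real_of_int (int (mult_m i n)) =
      real_of_int (int (n choose i) - (if i = 0 then 0 else int (n choose (i - 1))))"
    by simp
  then show ?thesis by (simp only: of_int_eq_iff)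
qed

lemma card_words_height:
  assumes "2 * i \<le> n"
  shows "card {q \<in> words n. height q = n - 2 * i} = mult_m i n"
proof -
  let ?b = "\<lambda>n i. int (n choose i) - (if i = 0 then 0 else int (n choose (i - 1)))"
  have "int (card {q \<in> words n. height q = n - 2 * i}) = ?b n i"
    using assms
  proof (induction n arbitrary: i)
    case 0
    have "{q \<in> words 0. height q = 0} = {[]}" by (auto simp: words_0)
    then show ?case using 0 by simp
  next
    case (Suc n)
    show ?case
    \<comment> \<open>Height 0 is reached only from height 1 by \<open>False\<close>, so a single
      term remains. Its value agrees with the Pascal recursion by the symmetry C(2j+1, j+1) =
      C(2j+1, j).\<close>
    proof (cases "2 * i = Suc n")
      case True
      then obtain j where i: "i = Suc j" by (cases i) auto
      have n: "n = Suc (2 * j)" using True i by simp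
      have "int (card {q \<in> words (Suc n). height q = Suc n - 2 * i}) = int (card {q \<in> words n. height q = n - 2 * j})"
        using True n by (simp add: card_words_Suc)
      also have "\<dots> = ?b n j" using n by (intro Suc.IH) simp
      also have "\<dots> = ?b (Suc n) i"
      proof -
        have "n choose Suc j = n choose j"
          using binomial_symmetric[of "Suc j" n] n by simp
        then show ?thesis by (cases j) (simp_all add: i)
      qed
      finally show ?thesis .
    next
      case False
      then have i: "2 * i \<le> n" using Suc.prems by simp
      have "int (card {q \<in> words (Suc n). height q = Suc n - 2 * i}) =
          int (card {q \<in> words n. height q = n - 2 * i}) + int (card {q \<in> words n. height q = n + 2 - 2 * i})"
        using i by (simp add: card_words_Suc Suc_diff_le)
      also have "\<dots> = ?b n i + (if i = 0 then 0 else ?b n (i - 1))"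
      proof (cases i)
        case 0
        have "card {q \<in> words n. height q = n + 2} = 0"
          using words_height by (intro card_eq_0_iff[THEN iffD2] disjI1) force
        then show ?thesis using Suc.IH[OF i] 0 by simp
      next
        case (Suc j)
        then show ?thesis using Suc.IH[OF i] Suc.IH[of j] i by simp
      qed
      also have "\<dots> = ?b (Suc n) i"
        by (cases i; cases "i - 1") auto
      finally show ?thesis .
    qed
  qed
  then show ?thesis using mult_m_binomial[OF assms] by simp
qed


section \<open>A basis of the cube adapted to its irreducible components\<close>

definition word_basis :: "nat \<Rightarrow> (bool list \<times> nat) set" where
  "word_basis n = {(q, a). q \<in> words n \<and> a \<le> height q}"

text \<open>\<open>w\<close> lists the adapted basis vectors and \<open>g\<close> expresses the
  subsets in them; the two inverse identities replace a proof of spanning and independence. The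
  operator equations are those of \<open>L_mod (height q)\<close>. Where \<open>a - 1\<close> or
  \<open>a + 1\<close> would leave the range the coefficient is 0, so values of \<open>w\<close>
  outside the range do not matter.\<close>

definition cube_basis :: "'a set \<Rightarrow> (bool list \<times> nat \<Rightarrow> ('a set \<Rightarrow>\<^sub>0 complex)) \<Rightarrow>
    ('a set \<Rightarrow> (bool list \<times> nat \<Rightarrow>\<^sub>0 complex)) \<Rightarrow> bool" where
  "cube_basis S w g \<longleftrightarrow>
    (\<forall>q\<in>words (card S). \<forall>a\<le>height q.
       w (q, a) \<in> free_on (Pow S) \<and> lin_ext g (w (q, a)) = bvec (q, a) \<and>
       lin_ext (cube_op S GE) (w (q, a)) = of_nat a *\<^sub>C w (q, a - 1) \<and>
       lin_ext (cube_op S GF) (w (q, a)) = (of_nat (height q) - of_nat a) *\<^sub>C w (q, a + 1) \<and>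
       lin_ext (cube_op S GH) (w (q, a)) = (of_nat (height q) - 2 * of_nat a) *\<^sub>C w (q, a)) \<and>
    (\<forall>x\<subseteq>S. g x \<in> free_on (word_basis (card S)) \<and> lin_ext w (g x) = bvec x)"

lemmas coeff_simps = lookup_add lookup_minus scaleC_poly_mapping.rep_eq scaleC_complex_def

lemma lin_ext_diff: "lin_ext f (v - w) = lin_ext f v - lin_ext f w"
  using lin_ext_add[of f "v - w" w] by (simp add: algebra_simps)

text \<open>Read \<open>v\<close> as v tensor v_0 and \<open>P v\<close> as v tensor v_1: these are
  the coproduct formulas on the tensor product of the cube of \<open>S\<close> with L_1.\<close>

lemma cube_op_insert:
  fixes p :: 'a and S
  assumes S: "finite S" "p \<notin> S" and v: "v \<in> free_on (Pow S)"
  defines "P \<equiv> lin_ext (\<lambda>x. bvec (insert p x)) :: _ \<Rightarrow> ('a set \<Rightarrow>\<^sub>0 complex)"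
  shows "lin_ext (cube_op (insert p S) GE) v = lin_ext (cube_op S GE) v"
    and "lin_ext (cube_op (insert p S) GE) (P v) = P (lin_ext (cube_op S GE) v) + v"
    and "lin_ext (cube_op (insert p S) GF) v = lin_ext (cube_op S GF) v + P v"
    and "lin_ext (cube_op (insert p S) GF) (P v) = P (lin_ext (cube_op S GF) v)"
    and "lin_ext (cube_op (insert p S) GH) v = lin_ext (cube_op S GH) v + v"
    and "lin_ext (cube_op (insert p S) GH) (P v) = P (lin_ext (cube_op S GH) v) - P v"
proof -
  note L = lin_on_eqI[where X = "Pow S", OF _ _ _ v]
  note l = lin_on_def lin_ext_simps scaleC_add_right cvec.scale_right_diff_distrib P_def
  have x: "finite x" "p \<notin> x" "S - x = S - x - {p}" if "x \<in> Pow S" for x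
    using that S finite_subset by auto
  show "lin_ext (cube_op (insert p S) GE) v = lin_ext (cube_op S GE) v"
    by (rule L) (simp_all add: l)
  show "lin_ext (cube_op (insert p S) GH) v = lin_ext (cube_op S GH) v + v"
  proof (rule L[where g = "\<lambda>v. lin_ext (cube_op S GH) v + v"])
    show "lin_ext (cube_op (insert p S) GH) (bvec y) = lin_ext (cube_op S GH) (bvec y) + bvec y" for y
      using S by (intro poly_mapping_eqI) (simp add: lin_ext_simps coeff_simps algebra_simps)
  qed (simp_all add: l algebra_simps)
  show "lin_ext (cube_op (insert p S) GH) (P v) = P (lin_ext (cube_op S GH) v) - P v"
  proof (rule L[where f = "\<lambda>v. lin_ext (cube_op (insert p S) GH) (P v)" and
        g = "\<lambda>v. P (lin_ext (cube_op S GH) v) - P v"])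
    show "lin_ext (cube_op (insert p S) GH) (P (bvec y)) = P (lin_ext (cube_op S GH) (bvec y)) - P (bvec y)"
      if "y \<in> Pow S" for y
      using S x[OF that]
      by (intro poly_mapping_eqI) (simp add: P_def lin_ext_simps lin_ext_diff coeff_simps algebra_simps)
  qed (simp_all add: l algebra_simps)
  show "lin_ext (cube_op (insert p S) GE) (P v) = P (lin_ext (cube_op S GE) v) + v"
  proof (rule L[where f = "\<lambda>v. lin_ext (cube_op (insert p S) GE) (P v)" and
        g = "\<lambda>v. P (lin_ext (cube_op S GE) v) + v"])
    fix y assume y: "y \<in> Pow S"
    have "(\<Sum>a\<in>y. bvec (insert p y - {a})) = (\<Sum>a\<in>y. bvec (insert p (y - {a})) :: _ \<Rightarrow>\<^sub>0 complex)"
      using x[OF y] by (intro sum.cong) (auto intro!: arg_cong[of _ _ bvec])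
    moreover have "insert p y - {p} = y" using x[OF y] by auto
    ultimately show "lin_ext (cube_op (insert p S) GE) (P (bvec y)) = P (lin_ext (cube_op S GE) (bvec y)) + bvec y"
      using x[OF y] by (simp add: P_def lin_ext_simps cube_op_E del: cube_op.simps)
  qed (simp_all add: l algebra_simps)
  show "lin_ext (cube_op (insert p S) GF) v = lin_ext (cube_op S GF) v + P v"
  proof (rule L[where g = "\<lambda>v. lin_ext (cube_op S GF) v + P v"])
    fix y assume y: "y \<in> Pow S"
    have "insert p S - y = insert p (S - y)" using x[OF y] by auto
    then show "lin_ext (cube_op (insert p S) GF) (bvec y) = lin_ext (cube_op S GF) (bvec y) + P (bvec y)"
      using x[OF y] S y by (simp add: P_def lin_ext_simps cube_op_F subset_insertI2 add.commute del: cube_op.simps)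
  qed (simp_all add: l algebra_simps)
  show "lin_ext (cube_op (insert p S) GF) (P v) = P (lin_ext (cube_op S GF) v)"
  proof (rule L[where f = "\<lambda>v. lin_ext (cube_op (insert p S) GF) (P v)" and
        g = "\<lambda>v. P (lin_ext (cube_op S GF) v)"])
    fix y assume y: "y \<in> Pow S"
    have "insert p S - insert p y = S - y" using x[OF y] S by auto
    then show "lin_ext (cube_op (insert p S) GF) (P (bvec y)) = P (lin_ext (cube_op S GF) (bvec y))"
      using x[OF y] S y
      by (simp add: P_def lin_ext_simps cube_op_F[of S y] cube_op_F[of "insert p S" "insert p y", OF _ insert_mono]
          insert_commute[of p] del: cube_op.simps)
  qed (simp_all add: l algebra_simps)
qed

text \<open>Adjoining a point tensors the cube with \<open>L\<^sub>1\<close>. Under \<open>v\<^sub>a = X\<^bsup>l-a\<^esup> Y\<^bsup>a\<^esup>\<close>, the copies of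
  \<open>L\<^bsub>l+1\<^esub>\<close> and \<open>L\<^bsub>l-1\<^esub>\<close> inside \<open>L\<^bsub>l\<^esub> \<otimes> L\<^sub>1\<close> arise from polarization and from multiplication
  by \<open>X \<otimes> v\<^sub>1 - Y \<otimes> v\<^sub>0\<close>.\<close>

lemma cube_basis_insert:
  fixes p :: 'a
  assumes S: "finite S" "p \<notin> S" and wg: "cube_basis S w g"
  shows "\<exists>w' g'. cube_basis (insert p S) w' g'"
proof -
  define P :: "_ \<Rightarrow> ('a set \<Rightarrow>\<^sub>0 complex)" where "P = lin_ext (\<lambda>x. bvec (insert p x))"
  let ?l = "\<lambda>q. of_nat (height q) :: complex"
  define W where "W = (\<lambda>(q', a). case q' of [] \<Rightarrow> 0 | b # q \<Rightarrow>
    if b then (?l q + 1 - of_nat a) *\<^sub>C w (q, a) + of_nat a *\<^sub>C P (w (q, a - 1))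
    else P (w (q, a)) - w (q, a + 1))"
  \<comment> \<open>Inverse of the change of basis. The vectors at \<open>(True # q, a)\<close> and
    \<open>(False # q, a - 1)\<close> are combinations of \<open>w (q, a)\<close> and
    \<open>P (w (q, a - 1))\<close> with determinant (l + 1 - a) + a = l + 1, hence the denominator.
    The \<open>False\<close> term has coefficient 0 at a = 0 in \<open>\<gamma>0\<close> and at a =
    l in \<open>\<gamma>1\<close>, exactly where its index would leave the range.\<close>
  define \<gamma>0 :: "_ \<Rightarrow> (bool list \<times> nat \<Rightarrow>\<^sub>0 complex)" where "\<gamma>0 = (\<lambda>(q, a). (1 / (?l q + 1)) *\<^sub>C
    (bvec (True # q, a) - of_nat a *\<^sub>C bvec (False # q, a - 1)))"
  define \<gamma>1 :: "_ \<Rightarrow> (bool list \<times> nat \<Rightarrow>\<^sub>0 complex)" where "\<gamma>1 = (\<lambda>(q, a). (1 / (?l q + 1)) *\<^sub>C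
    (bvec (True # q, a + 1) + (?l q - of_nat a) *\<^sub>C bvec (False # q, a)))"
  define G where "G x = (if p \<in> x then lin_ext \<gamma>1 (g (x - {p})) else lin_ext \<gamma>0 (g x))" for x
  have WT: "W (True # q, a) = (?l q + 1 - of_nat a) *\<^sub>C w (q, a) + of_nat a *\<^sub>C P (w (q, a - 1))"
    and WF: "W (False # q, a) = P (w (q, a)) - w (q, a + 1)" for q a
    by (simp_all add: W_def)
  have l1: "?l q + 1 \<noteq> 0" for q by (metis of_nat_Suc of_nat_neq_0 add.commute)
  have Pl: "P (u + v) = P u + P v" "P (u - v) = P u - P v" "P (c *\<^sub>C v) = c *\<^sub>C P v" "P 0 = 0" for u v c
    by (simp_all add: P_def lin_ext_simps lin_ext_diff)
  have PS: "P v \<in> free_on (Pow (insert p S))" if "v \<in> free_on (Pow S)" for v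
    unfolding P_def using that
    by (intro lin_ext_closed[where X = "Pow S"] free_on_subspace) (auto simp: bvec_free_on)
  have SS: "v \<in> free_on (Pow (insert p S))" if "v \<in> free_on (Pow S)" for v
    using that unfolding free_on_def by auto
  note sub = cvec.subspace_add[OF free_on_subspace] cvec.subspace_diff[OF free_on_subspace]
    cvec.subspace_scale[OF free_on_subspace]
  have card: "card (insert p S) = Suc (card S)" using S by simp
  have w: "w (q, a) \<in> free_on (Pow S)" "lin_ext g (w (q, a)) = bvec (q, a)"
      "lin_ext (cube_op S GE) (w (q, a)) = of_nat a *\<^sub>C w (q, a - 1)"
      "lin_ext (cube_op S GF) (w (q, a)) = (?l q - of_nat a) *\<^sub>C w (q, a + 1)"
      "lin_ext (cube_op S GH) (w (q, a)) = (?l q - 2 * of_nat a) *\<^sub>C w (q, a)"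
    if "q \<in> words (card S)" "a \<le> height q" for q a
    using wg that unfolding cube_basis_def by blast+
  have g: "g x \<in> free_on (word_basis (card S))" "lin_ext w (g x) = bvec x" if "x \<subseteq> S" for x
    using wg that unfolding cube_basis_def by blast+
  note O = cube_op_insert[OF S, folded P_def]
  have G0: "lin_ext G v = lin_ext \<gamma>0 (lin_ext g v)" if "v \<in> free_on (Pow S)" for v
    by (rule lin_on_eqI[where X = "Pow S" and g = "\<lambda>v. lin_ext \<gamma>0 (lin_ext g v)", OF _ _ _ that])
      (use S in \<open>auto simp: lin_on_def lin_ext_simps G_def\<close>)
  have G1: "lin_ext G (P v) = lin_ext \<gamma>1 (lin_ext g v)" if "v \<in> free_on (Pow S)" for v
  proof (rule lin_on_eqI[where X = "Pow S" and f = "\<lambda>v. lin_ext G (P v)" and g = "\<lambda>v. lin_ext \<gamma>1 (lin_ext g v)", OF _ _ _ that])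
    fix x assume "x \<in> Pow S"
    then have "insert p x - {p} = x" using S by auto
    then show "lin_ext G (P (bvec x)) = lin_ext \<gamma>1 (lin_ext g (bvec x))"
      by (simp add: P_def lin_ext_simps G_def)
  qed (auto simp: lin_on_def lin_ext_simps Pl)
  define E' F' H' where "E' = lin_ext (cube_op (insert p S) GE)" and "F' = lin_ext (cube_op (insert p S) GF)"
    and "H' = lin_ext (cube_op (insert p S) GH)"
  note O = O[folded E'_def F'_def H'_def]
  have R: "E' (w (q, a)) = of_nat a *\<^sub>C w (q, a - 1)"
      "E' (P (w (q, a))) = of_nat a *\<^sub>C P (w (q, a - 1)) + w (q, a)"
      "F' (w (q, a)) = (?l q - of_nat a) *\<^sub>C w (q, a + 1) + P (w (q, a))"
      "F' (P (w (q, a))) = (?l q - of_nat a) *\<^sub>C P (w (q, a + 1))"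
      "H' (w (q, a)) = (?l q - 2 * of_nat a) *\<^sub>C w (q, a) + w (q, a)"
      "H' (P (w (q, a))) = (?l q - 2 * of_nat a) *\<^sub>C P (w (q, a)) - P (w (q, a))"
      "lin_ext G (w (q, a)) = \<gamma>0 (q, a)" "lin_ext G (P (w (q, a))) = \<gamma>1 (q, a)"
    if "q \<in> words (card S)" "a \<le> height q" for q a
    unfolding O[OF w(1)[OF that]] G0[OF w(1)[OF that]] G1[OF w(1)[OF that]] w(2-5)[OF that] Pl
    by (rule HOL.refl | simp add: lin_ext_bvec)+
  have lin: "f (u + v) = f u + f v" "f (u - v) = f u - f v" "f (c *\<^sub>C v) = c *\<^sub>C f v"
    if "f \<in> {E', F', H'}" for f u v c
    using that unfolding E'_def F'_def H'_def by (auto simp: lin_ext_simps lin_ext_diff)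
  note E = lin[of E'] lin[of F'] lin[of H'] lin_ext_add lin_ext_scale lin_ext_diff
  have T: "W (True # q, a) \<in> free_on (Pow (insert p S)) \<and> lin_ext G (W (True # q, a)) = bvec (True # q, a) \<and>
      E' (W (True # q, a)) = of_nat a *\<^sub>C W (True # q, a - 1) \<and>
      F' (W (True # q, a)) = (of_nat (height (True # q)) - of_nat a) *\<^sub>C W (True # q, a + 1) \<and>
      H' (W (True # q, a)) = (of_nat (height (True # q)) - 2 * of_nat a) *\<^sub>C W (True # q, a)"
    if q: "q \<in> words (card S)" and a: "a \<le> Suc (height q)" for q a
  proof -
    \<comment> \<open>At a = 0 the index \<open>a - 1\<close> truncates, and at a = height q + 1 the
      vector \<open>w (q, a)\<close> lies outside the family. In both cases the coefficient in front
      is 0, so the ends are treated with one term only.\<close>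
    consider "a = 0" | b where "a = Suc b" "a \<le> height q" | "a = Suc (height q)"
      using a by (cases a) (auto simp: le_Suc_eq)
    then show ?thesis
    proof cases
      case 1
      have W: "W (True # q, a) = (?l q + 1) *\<^sub>C w (q, 0)" by (simp add: WT 1)
      have w0: "w (q, 0) \<in> free_on (Pow S)" by (rule w(1)[OF q]) simp
      note R0 = R[OF q, of 0, simplified]
      show ?thesis
      proof (intro conjI)
        show "W (True # q, a) \<in> free_on (Pow (insert p S))"
          unfolding W by (intro sub SS w0)
        show "lin_ext G (W (True # q, a)) = bvec (True # q, a)"
          unfolding W E[simplified] R0 using l1[of q] 1
          by (intro poly_mapping_eqI) (simp add: coeff_simps \<gamma>0_def)
      qed (unfold W E[simplified] R0, (rule poly_mapping_eqI, simp add: 1 WT coeff_simps algebra_simps)+)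
    next
      case 2
      have W: "W (True # q, a) = (?l q - of_nat b) *\<^sub>C w (q, Suc b) + (of_nat b + 1) *\<^sub>C P (w (q, b))"
        by (simp add: WT 2 add.commute)
      have wS: "w (q, Suc b) \<in> free_on (Pow S)" "w (q, b) \<in> free_on (Pow S)" using w(1) q 2 by auto
      have Rb: "b \<le> height q" "Suc b \<le> height q" using 2 by auto
      note R0 = R[OF q Rb(1)] R[OF q Rb(2)]
      show ?thesis
      proof (intro conjI)
        show "W (True # q, a) \<in> free_on (Pow (insert p S))"
          unfolding W by (intro sub SS PS wS)
        show "lin_ext G (W (True # q, a)) = bvec (True # q, a)"
          unfolding W E[simplified] R0 using l1[of q] 2
          by (intro poly_mapping_eqI) (simp add: coeff_simps \<gamma>0_def \<gamma>1_def divide_simps, simp add: algebra_simps)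
      qed (unfold W E[simplified] R0, (rule poly_mapping_eqI, simp add: 2 WT coeff_simps algebra_simps)+)
    next
      case 3
      have W: "W (True # q, a) = (?l q + 1) *\<^sub>C P (w (q, height q))"
        by (simp add: WT 3 add.commute)
      have wS: "w (q, height q) \<in> free_on (Pow S)" using w(1) q by auto
      note R0 = R[OF q order.refl]
      show ?thesis
      proof (intro conjI)
        show "W (True # q, a) \<in> free_on (Pow (insert p S))"
          unfolding W by (intro sub SS PS wS)
        show "lin_ext G (W (True # q, a)) = bvec (True # q, a)"
          unfolding W E[simplified] R0 using l1[of q] 3
          by (intro poly_mapping_eqI) (simp add: coeff_simps \<gamma>0_def \<gamma>1_def divide_simps)
      qed (unfold W E[simplified] R0, (rule poly_mapping_eqI, simp add: 3 WT coeff_simps algebra_simps)+)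
    qed
  qed
  have F: "W (False # q, a) \<in> free_on (Pow (insert p S)) \<and> lin_ext G (W (False # q, a)) = bvec (False # q, a) \<and>
      E' (W (False # q, a)) = of_nat a *\<^sub>C W (False # q, a - 1) \<and>
      F' (W (False # q, a)) = (of_nat (height (False # q)) - of_nat a) *\<^sub>C W (False # q, a + 1) \<and>
      H' (W (False # q, a)) = (of_nat (height (False # q)) - 2 * of_nat a) *\<^sub>C W (False # q, a)"
    if q: "q \<in> words (card S)" and a: "a < height q" for q a
  proof -
    have h: "of_nat (height (False # q)) = ?l q - 1" using a by (simp add: of_nat_diff)
    have wS: "w (q, a) \<in> free_on (Pow S)" "w (q, a + 1) \<in> free_on (Pow S)" using w(1) q a by auto
    have a': "a \<le> height q" "a + 1 \<le> height q" using a by auto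
    note R0 = R[OF q a'(1)] R[OF q a'(2)]
    show ?thesis unfolding h
    proof (intro conjI)
      show "W (False # q, a) \<in> free_on (Pow (insert p S))"
        unfolding WF by (intro sub SS PS wS)
      show "lin_ext G (W (False # q, a)) = bvec (False # q, a)"
        unfolding WF E[simplified] R0 using l1[of q]
        by (intro poly_mapping_eqI) (simp add: coeff_simps \<gamma>0_def \<gamma>1_def divide_simps, simp add: algebra_simps)
      show "E' (W (False # q, a)) = of_nat a *\<^sub>C W (False # q, a - 1)"
        unfolding WF E[simplified] R0
        by (cases a) (rule poly_mapping_eqI, simp add: coeff_simps algebra_simps)+
    qed (unfold WF E[simplified] R0, (rule poly_mapping_eqI, simp add: coeff_simps algebra_simps)+)
  qed
  have W0: "lin_ext W (\<gamma>0 (q, a)) = w (q, a)" for q a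
  proof (rule poly_mapping_eqI)
    show "Poly_Mapping.lookup (lin_ext W (\<gamma>0 (q, a))) x = Poly_Mapping.lookup (w (q, a)) x" for x
      using l1[of q] by (cases a)
        (simp_all add: \<gamma>0_def lin_ext_simps lin_ext_diff WT WF coeff_simps divide_simps, simp_all add: algebra_simps)
  qed
  have W1: "lin_ext W (\<gamma>1 (q, a)) = P (w (q, a))" for q a
    using l1[of q] by (intro poly_mapping_eqI)
      (simp add: \<gamma>1_def lin_ext_simps lin_ext_diff WT WF coeff_simps divide_simps, simp add: algebra_simps)
  have "cube_basis (insert p S) W G"
    unfolding cube_basis_def card
    E'_def[symmetric] F'_def[symmetric] H'_def[symmetric]
  proof (intro conjI[rotated] allI impI)
    show "\<forall>q\<in>words (Suc (card S)). \<forall>a\<le>height q.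
       W (q, a) \<in> free_on (Pow (insert p S)) \<and> lin_ext G (W (q, a)) = bvec (q, a) \<and>
       E' (W (q, a)) = of_nat a *\<^sub>C W (q, a - 1) \<and>
       F' (W (q, a)) = (of_nat (height q) - of_nat a) *\<^sub>C W (q, a + 1) \<and>
       H' (W (q, a)) = (of_nat (height q) - 2 * of_nat a) *\<^sub>C W (q, a)"
      unfolding words_Suc using T F by auto
  next
    fix x assume x: "x \<subseteq> insert p S"
    have c: "\<gamma>0 z \<in> free_on (word_basis (Suc (card S)))" "\<gamma>1 z \<in> free_on (word_basis (Suc (card S)))"
      if zB: "z \<in> word_basis (card S)" for z
    proof -
      obtain q a where z: "z = (q, a)" and q: "q \<in> words (card S)" "a \<le> height q"
        using zB by (auto simp: word_basis_def)
      have in_T: "bvec (True # q, b) \<in> free_on (word_basis (Suc (card S)))" if "b \<le> Suc (height q)" for b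
        using that q by (auto simp: bvec_free_on word_basis_def words_Suc)
      have in_F: "c *\<^sub>C bvec (False # q, b) \<in> free_on (word_basis (Suc (card S)))" if "c \<noteq> 0 \<longrightarrow> b < height q" for b c
        using that q cvec.subspace_0[OF free_on_subspace]
        by (cases "c = 0") (auto intro!: sub simp: bvec_free_on word_basis_def words_Suc)
      show "\<gamma>0 z \<in> free_on (word_basis (Suc (card S)))" "\<gamma>1 z \<in> free_on (word_basis (Suc (card S)))"
        unfolding z \<gamma>0_def \<gamma>1_def using q by (auto intro!: sub in_T in_F)
    qed
    have lW0: "lin_ext W (lin_ext \<gamma>0 v) = lin_ext w v" and lW1: "lin_ext W (lin_ext \<gamma>1 v) = P (lin_ext w v)"
      if "v \<in> free_on (word_basis (card S))" for v
      by (rule lin_on_eqI[OF _ _ _ that]; auto simp: lin_on_def lin_ext_simps W0 W1 Pl split: prod.splits)+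
    show "G x \<in> free_on (word_basis (Suc (card S)))"
      using x g c S unfolding G_def
      by (auto intro!: lin_ext_closed[where X = "word_basis (card S)"] free_on_subspace simp: subset_insert_iff)
    show "lin_ext W (G x) = bvec x"
    proof (cases "p \<in> x")
      case True
      then have "x - {p} \<subseteq> S" "insert p (x - {p}) = x" using x by auto
      then show ?thesis using True g lW1 by (simp add: G_def P_def lin_ext_simps)
    next
      case False
      then have "x \<subseteq> S" using x by auto
      then show ?thesis using False g lW0 by (simp add: G_def)
    qed
  qed
  then show ?thesis by blast
qed

lemma ex_cube_basis:
  assumes "finite S"
  shows "\<exists>w g. cube_basis S w g"
  using assms
proof induction
  case empty
  have "{y :: 'a set. y = {} \<and> card y = Suc 0} = {}" by auto
  then have "cube_basis {} (\<lambda>_. bvec ({} :: 'a set)) (\<lambda>_. bvec ([], 0))"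
    by (simp add: cube_basis_def words_0 word_basis_def bvec_free_on lin_ext_simps cong: conj_cong)
  then show ?case by blast
next
  case (insert p S)
  from insert.IH obtain w g where "cube_basis S w g" by blast
  then show ?case by (rule cube_basis_insert[OF insert.hyps])
qed

section \<open>Decomposition of the subset module\<close>

text \<open>Induction over expressions: each acts through sums and compositions of generators.
  Explicit formulas for E, F, H, for pure tensors, or for A, B, C therefore suffice to get a
  homomorphism.\<close>

lemma mod_hom_gensI:
  fixes M :: "('g::presentation palg, 'v::cvector) cmodule"
  assumes M: "is_module M" and N: "is_module N"
    and f: "\<And>v. v \<in> mcarrier M \<Longrightarrow> f v \<in> mcarrier N" "lin_on (mcarrier M) f"
    and gen: "\<And>g v. v \<in> mcarrier M \<Longrightarrow> f (act M (gen g) v) = act N (gen g) (f v)"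
  shows "mod_hom M N f"
proof -
  note m = is_moduleD[OF M] and n = is_moduleD[OF N]
  have "f (act M (abs_palg p) v) = act N (abs_palg p) (f v)" if "v \<in> mcarrier M" for p v
    using that
  proof (induction p arbitrary: v)
    case (Scal c)
    then show ?case using f by (simp add: abs_palg_simps m n lin_on_def)
  next
    case (Add p q)
    then show ?case using f by (simp add: abs_palg_simps m n lin_on_def)
  qed (simp_all add: abs_palg_simps gen m n f(1))
  then have "f (act M a v) = act N a (f v)" if "v \<in> mcarrier M" for a v
    using that by (induction a rule: palg.abs_induct) simp
  then show ?thesis using f by (simp add: mod_hom_def)
qed

lemma L_act_gen: "v \<in> free_on {0..n} \<Longrightarrow> act (L_mod n) (gen s) v = lin_ext (L_op n s) v"
  unfolding L_mod_def by (rule operators.act_gen[OF L_operators])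

lemma cube_act_gen: "finite S \<Longrightarrow> v \<in> free_on (Pow S) \<Longrightarrow> act (cube S) (gen s) v = lin_ext (cube_op S s) v"
  unfolding cube_def by (rule operators.act_gen[OF cube_operators])

text \<open>At i = 0 and i = n the conditionals in \<open>L_op\<close> only suppress a term whose
  coefficient is already 0.\<close>

lemma L_op_eq:
  "L_op n GE i = of_nat i *\<^sub>C bvec (i - 1)" "L_op n GF i = (of_nat n - of_nat i) *\<^sub>C bvec (i + 1)"
  "L_op n GH i = (of_nat n - 2 * of_nat i) *\<^sub>C bvec i"
  by simp_all

lemma mod_hom_L_cube:
  assumes S: "finite S" and wg: "cube_basis S w g" and q: "q \<in> words (card S)"
  shows "mod_hom (L_mod (height q)) (cube S) (lin_ext (\<lambda>a. w (q, a)))"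
proof -
  have w: "w (q, a) \<in> free_on (Pow S)"
      "lin_ext (cube_op S s) (w (q, a)) = lin_ext (\<lambda>a. w (q, a)) (L_op (height q) s a)"
    if "a \<le> height q" for a s
  proof -
    show "w (q, a) \<in> free_on (Pow S)" using wg q that unfolding cube_basis_def by blast
    have "lin_ext (cube_op S GE) (w (q, a)) = of_nat a *\<^sub>C w (q, a - 1)"
       "lin_ext (cube_op S GF) (w (q, a)) = (of_nat (height q) - of_nat a) *\<^sub>C w (q, a + 1)"
       "lin_ext (cube_op S GH) (w (q, a)) = (of_nat (height q) - 2 * of_nat a) *\<^sub>C w (q, a)"
      using wg q that unfolding cube_basis_def by blast+
    then show "lin_ext (cube_op S s) (w (q, a)) = lin_ext (\<lambda>a. w (q, a)) (L_op (height q) s a)"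
      by (cases s) (simp_all only: L_op_eq lin_ext_scale lin_ext_bvec)
  qed
  have closed: "lin_ext (\<lambda>a. w (q, a)) v \<in> free_on (Pow S)" if "v \<in> free_on {0..height q}" for v
    using w(1) that by (intro lin_ext_closed[where X = "{0..height q}"] free_on_subspace) auto
  show ?thesis
  proof (rule mod_hom_gensI)
    fix s v assume "v \<in> mcarrier (L_mod (height q))"
    then have v: "v \<in> free_on {0..height q}" by (simp add: L_module)
    have "lin_ext (\<lambda>a. w (q, a)) (lin_ext (L_op (height q) s) v) =
        lin_ext (cube_op S s) (lin_ext (\<lambda>a. w (q, a)) v)"
      by (rule lin_on_eqI[where f = "\<lambda>v. lin_ext (\<lambda>a. w (q, a)) (lin_ext (L_op (height q) s) v)"
            and g = "\<lambda>v. lin_ext (cube_op S s) (lin_ext (\<lambda>a. w (q, a)) v)", OF _ _ _ v])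
        (auto simp: lin_on_def lin_ext_add lin_ext_scale lin_ext_bvec w)
    then show "lin_ext (\<lambda>a. w (q, a)) (act (L_mod (height q)) (gen s) v) =
        act (cube S) (gen s) (lin_ext (\<lambda>a. w (q, a)) v)"
      using v S by (simp add: L_act_gen cube_act_gen closed)
  qed (use S closed in \<open>simp_all add: L_module cube_module lin_on_lin_ext\<close>)
qed

lemma lin_ext_tvec: "lin_ext (\<lambda>(x, y). F x \<otimes>\<^sub>v H y) (v \<otimes>\<^sub>v w) = lin_ext F v \<otimes>\<^sub>v lin_ext H w"
  by (simp add: lin_ext_def tvec_sum(1) tvec_simps(3))
    (simp add: keys_tvec sum.cartesian_product tvec_sum(2) tvec_simps(4)
      tvec.rep_eq split_beta cvec.scale_sum_right)

lemma tvec_free_on: "v \<in> free_on X \<Longrightarrow> w \<in> free_on Y \<Longrightarrow> v \<otimes>\<^sub>v w \<in> free_on (X \<times> Y)"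
  by (auto simp: free_on_def keys_tvec)

lemma mod_hom_tensor:
  fixes M :: "('a::calgebra, 'x \<Rightarrow>\<^sub>0 complex) cmodule" and N :: "('b::calgebra, 'y \<Rightarrow>\<^sub>0 complex) cmodule"
  assumes M: "is_module M" "mcarrier M = free_on X" and N: "is_module N" "mcarrier N = free_on Y"
    and M': "is_module M'" "mcarrier M' = free_on X'" and N': "is_module N'" "mcarrier N' = free_on Y'"
    and F: "mod_hom M M' (lin_ext F)" and H: "mod_hom N N' (lin_ext H)"
  shows "mod_hom (M \<otimes>\<^sub>m N) (M' \<otimes>\<^sub>m N') (lin_ext (\<lambda>(x, y). F x \<otimes>\<^sub>v H y))" (is "mod_hom _ _ ?T")
proof -
  note T = tensor_module[OF M N] and T' = tensor_module[OF M' N']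
  have cF: "F x \<in> free_on X'" if "x \<in> X" for x
    using mod_homD(1)[OF F, of "bvec x"] that by (simp add: M M' bvec_free_on lin_ext_bvec)
  have cH: "H x \<in> free_on Y'" if "x \<in> Y" for x
    using mod_homD(1)[OF H, of "bvec x"] that by (simp add: N N' bvec_free_on lin_ext_bvec)
  have cT: "?T v \<in> free_on (X' \<times> Y')" if "v \<in> free_on (X \<times> Y)" for v
    using that cF cH by (intro lin_ext_closed[where X = "X \<times> Y"] free_on_subspace) (auto intro: tvec_free_on)
  show ?thesis
  proof (rule mod_hom_gensI)
    fix s :: "('a, 'b) tgen" and v assume "v \<in> mcarrier (M \<otimes>\<^sub>m N)"
    then have v: "v \<in> free_on (X \<times> Y)" by (simp add: T)
    obtain a b where s: "s = TGen a b" by (cases s)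
    show "?T (act (M \<otimes>\<^sub>m N) (gen s) v) = act (M' \<otimes>\<^sub>m N') (gen s) (?T v)"
      unfolding s tens_def[symmetric]
    proof (rule lin_on_eqI[where f = "\<lambda>v. ?T (act (M \<otimes>\<^sub>m N) (a \<otimes>\<^sub>a b) v)"
          and g = "\<lambda>v. act (M' \<otimes>\<^sub>m N') (a \<otimes>\<^sub>a b) (?T v)", OF _ _ _ v])
      show "lin_on (free_on (X \<times> Y)) (\<lambda>v. ?T (act (M \<otimes>\<^sub>m N) (a \<otimes>\<^sub>a b) v))"
        using is_moduleD(3)[OF T(2), of "a \<otimes>\<^sub>a b"] by (simp add: T lin_on_def lin_ext_add lin_ext_scale)
      show "lin_on (free_on (X \<times> Y)) (\<lambda>v. act (M' \<otimes>\<^sub>m N') (a \<otimes>\<^sub>a b) (?T v))"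
        using is_moduleD(4,5)[OF T'(2)] cT by (simp add: T' lin_on_def lin_ext_add lin_ext_scale)
      fix z assume "z \<in> X \<times> Y"
      then obtain x y where z: "z = (x, y)" and xy: "x \<in> X" "y \<in> Y" by auto
      have b: "bvec x \<in> free_on X" "bvec y \<in> free_on Y" using xy by (auto simp: bvec_free_on)
      have "?T (act (M \<otimes>\<^sub>m N) (a \<otimes>\<^sub>a b) (bvec x \<otimes>\<^sub>v bvec y)) = act (M' \<otimes>\<^sub>m N') (a \<otimes>\<^sub>a b) (?T (bvec x \<otimes>\<^sub>v bvec y))"
        using mod_homD(5)[OF F, of "bvec x" a] mod_homD(5)[OF H, of "bvec y" b] b
        by (simp add: T(3) T'(3) cF cH xy lin_ext_tvec lin_ext_bvec M N)
      then show "?T (act (M \<otimes>\<^sub>m N) (a \<otimes>\<^sub>a b) (bvec z)) = act (M' \<otimes>\<^sub>m N') (a \<otimes>\<^sub>a b) (?T (bvec z))"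
        by (simp add: z bvec_tvec)
    qed
  qed (use cT in \<open>simp_all add: T T' lin_on_lin_ext\<close>)
qed

lemma cube_tensor_decomposes:
  fixes S S' :: "'a set"
  assumes S: "finite S" "finite S'"
  shows "decomposes (cube S \<otimes>\<^sub>m cube S') (words (card S) \<times> words (card S'))
    (\<lambda>(q, r). L_mod (height q) \<otimes>\<^sub>m L_mod (height r))"
proof -
  obtain w g w' g' where wg: "cube_basis S w g" and wg': "cube_basis S' w' g'"
    using ex_cube_basis S by metis
  let ?J = "words (card S) \<times> words (card S')"
  let ?B = "word_basis (card S)" and ?B' = "word_basis (card S')"
  define \<phi> where "\<phi> = (\<lambda>(q, r). lin_ext (\<lambda>(a, b). w (q, a) \<otimes>\<^sub>v w' (r, b)))"
  \<comment> \<open>\<open>\<Gamma>\<close> takes coordinates in the product of the two adapted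
    bases; \<open>\<rho> j\<close> keeps those belonging to the pair of words \<open>j\<close> and
    then forgets the words. The resulting projections are merely linear, which is enough for
    \<open>decomposition_lin\<close>.\<close>
  define \<Gamma> where "\<Gamma> = lin_ext (\<lambda>(x, y). g x \<otimes>\<^sub>v g' y)"
  define \<rho> :: "bool list \<times> bool list \<Rightarrow> ((bool list \<times> nat) \<times> (bool list \<times> nat) \<Rightarrow>\<^sub>0 complex) \<Rightarrow> (nat \<times> nat \<Rightarrow>\<^sub>0 complex)"
    where "\<rho> = (\<lambda>j. lin_ext (\<lambda>(z, z'). if (fst z, fst z') = j then bvec (snd z, snd z') else 0))"
  define \<psi> where "\<psi> = (\<lambda>j v. \<rho> j (\<Gamma> v))"
  note T = tensor_module[OF cube_module(1,2)[OF S(1)] cube_module(1,2)[OF S(2)]]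
  note TL = tensor_module[OF L_module L_module]
  have w: "lin_ext g (w (q, a)) = bvec (q, a)" if "q \<in> words (card S)" "a \<le> height q" for q a
    using wg that unfolding cube_basis_def by blast
  have w': "lin_ext g' (w' (q, a)) = bvec (q, a)" if "q \<in> words (card S')" "a \<le> height q" for q a
    using wg' that unfolding cube_basis_def by blast
  have g: "g x \<in> free_on ?B" "lin_ext w (g x) = bvec x" if "x \<subseteq> S" for x
    using wg that unfolding cube_basis_def by blast+
  have g': "g' x \<in> free_on ?B'" "lin_ext w' (g' x) = bvec x" if "x \<subseteq> S'" for x
    using wg' that unfolding cube_basis_def by blast+
  have \<Gamma>: "\<Gamma> v \<in> free_on (?B \<times> ?B')" if "v \<in> free_on (Pow S \<times> Pow S')" for v
    unfolding \<Gamma>_def using that g g'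
    by (intro lin_ext_closed[where X = "Pow S \<times> Pow S'"] free_on_subspace) (auto intro: tvec_free_on)
  have "decomposition (cube S \<otimes>\<^sub>m cube S') ?J (\<lambda>(q, r). L_mod (height q) \<otimes>\<^sub>m L_mod (height r)) \<phi> \<psi>"
  proof (rule decomposition_lin)
    fix j assume j: "j \<in> ?J"
    then obtain q r where qr: "j = (q, r)" "q \<in> words (card S)" "r \<in> words (card S')" by auto
    show "is_module ((\<lambda>(q, r). L_mod (height q) \<otimes>\<^sub>m L_mod (height r)) j)" by (simp add: qr TL)
    show "mod_hom ((\<lambda>(q, r). L_mod (height q) \<otimes>\<^sub>m L_mod (height r)) j) (cube S \<otimes>\<^sub>m cube S') (\<phi> j)"
      unfolding qr \<phi>_def prod.case
      by (rule mod_hom_tensor[OF L_module L_module cube_module(1,2)[OF S(1)] cube_module(1,2)[OF S(2)]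
          mod_hom_L_cube[OF S(1) wg qr(2)] mod_hom_L_cube[OF S(2) wg' qr(3)]])
    show "lin_on (mcarrier (cube S \<otimes>\<^sub>m cube S')) (\<psi> j)"
      by (simp add: \<psi>_def \<rho>_def \<Gamma>_def lin_on_def lin_ext_add lin_ext_scale)
    show "\<psi> j v \<in> mcarrier ((\<lambda>(q, r). L_mod (height q) \<otimes>\<^sub>m L_mod (height r)) j)"
      if "v \<in> mcarrier (cube S \<otimes>\<^sub>m cube S')" for v
      unfolding \<psi>_def \<rho>_def qr prod.case TL(1)
      using \<Gamma> that T(1) cvec.subspace_0[OF free_on_subspace]
      by (intro lin_ext_closed[where X = "?B \<times> ?B'"] free_on_subspace) (auto simp: bvec_free_on word_basis_def)
    fix i x assume i: "i \<in> ?J" and "x \<in> mcarrier ((\<lambda>(q, r). L_mod (height q) \<otimes>\<^sub>m L_mod (height r)) j)"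
    then have x: "x \<in> free_on ({0..height q} \<times> {0..height r})" by (simp add: qr TL)
    show "\<psi> i (\<phi> j x) = (if i = j then x else 0)"
    proof (rule lin_on_eqI[where f = "\<lambda>x. \<psi> i (\<phi> j x)" and g = "\<lambda>x. if i = j then x else 0", OF _ _ _ x])
      show "lin_on (free_on ({0..height q} \<times> {0..height r})) (\<lambda>x. \<psi> i (\<phi> j x))"
        by (simp add: \<psi>_def \<rho>_def \<Gamma>_def \<phi>_def qr lin_on_def lin_ext_add lin_ext_scale)
      fix z assume "z \<in> {0..height q} \<times> {0..height r}"
      then obtain a b where z: "z = (a, b)" "a \<le> height q" "b \<le> height r" by auto
      show "\<psi> i (\<phi> j (bvec z)) = (if i = j then bvec z else 0)"
        using qr z by (simp add: \<psi>_def \<phi>_def \<Gamma>_def \<rho>_def lin_ext_bvec lin_ext_tvec w w' bvec_tvec)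
    qed (simp add: lin_on_def)
  next
    fix v assume "v \<in> mcarrier (cube S \<otimes>\<^sub>m cube S')"
    then have v: "v \<in> free_on (Pow S \<times> Pow S')" by (simp add: T)
    have "(\<Sum>j\<in>?J. \<phi> j (\<psi> j v)) = lin_ext (\<lambda>(z, z'). w z \<otimes>\<^sub>v w' z') (\<Gamma> v)"
      unfolding \<psi>_def
    proof (rule lin_on_eqI[where f = "\<lambda>u. \<Sum>j\<in>?J. \<phi> j (\<rho> j u)", OF _ _ _ \<Gamma>[OF v]])
      show "lin_on (free_on (?B \<times> ?B')) (\<lambda>u. \<Sum>j\<in>?J. \<phi> j (\<rho> j u))"
        by (simp add: \<phi>_def \<rho>_def lin_on_def split_beta lin_ext_add lin_ext_scale sum.distrib cvec.scale_sum_right)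
      fix z assume "z \<in> ?B \<times> ?B'"
      then obtain q a r b where z: "z = ((q, a), (r, b))" and qr: "q \<in> words (card S)" "r \<in> words (card S')"
        by (auto simp: word_basis_def)
      have "(\<Sum>j\<in>?J. \<phi> j (\<rho> j (bvec z))) = (\<Sum>j\<in>?J. if j = (q, r) then w (q, a) \<otimes>\<^sub>v w' (r, b) else 0)"
        by (intro sum.cong HOL.refl) (auto simp: z \<phi>_def \<rho>_def lin_ext_bvec lin_ext_zero)
      also have "\<dots> = w (q, a) \<otimes>\<^sub>v w' (r, b)" using qr finite_words by simp
      finally show "(\<Sum>j\<in>?J. \<phi> j (\<rho> j (bvec z))) = lin_ext (\<lambda>(z, z'). w z \<otimes>\<^sub>v w' z') (bvec z)"
        by (simp add: z lin_ext_bvec)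
    qed (rule lin_on_lin_ext)
    also have "\<dots> = v"
    proof (rule lin_on_eqI[where f = "\<lambda>v. lin_ext (\<lambda>(z, z'). w z \<otimes>\<^sub>v w' z') (\<Gamma> v)" and g = "\<lambda>v. v", OF _ _ _ v])
      show "lin_on (free_on (Pow S \<times> Pow S')) (\<lambda>v. lin_ext (\<lambda>(z, z'). w z \<otimes>\<^sub>v w' z') (\<Gamma> v))"
        by (simp add: \<Gamma>_def lin_on_def lin_ext_add lin_ext_scale)
      show "lin_ext (\<lambda>(z, z'). w z \<otimes>\<^sub>v w' z') (\<Gamma> (bvec p)) = bvec p" if "p \<in> Pow S \<times> Pow S'" for p
        using that g g' by (auto simp: \<Gamma>_def lin_ext_bvec lin_ext_tvec bvec_tvec)
    qed (simp add: lin_on_def)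
    finally show "(\<Sum>j\<in>?J. \<phi> j (\<psi> j v)) = v" .
  qed (use T finite_words in auto)
  then show ?thesis unfolding decomposes_def by blast
qed

lemma weight_module_simps:
  "v \<in> mcarrier (weight_module M \<theta>) \<longleftrightarrow> v \<in> mcarrier M \<and> act M (\<Delta> UH) v = \<theta> *\<^sub>C v"
  "act (weight_module M \<theta>) a = act M (\<natural> a)"
  by (simp_all add: weight_module_def via_natural_def)

lemma mod_hom_weight:
  assumes "mod_hom M N f"
  shows "mod_hom (weight_module M \<theta>) (weight_module N \<theta>) f"
proof -
  note f = mod_homD[OF assms]
  have "act N (\<Delta> UH) (f v) = \<theta> *\<^sub>C f v" if "v \<in> mcarrier M" "act M (\<Delta> UH) v = \<theta> *\<^sub>C v" for v
    using f(5)[OF that(1), of "\<Delta> UH"] that by (simp add: f(4))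
  then show ?thesis
    by (intro mod_homI) (simp_all add: weight_module_simps f(1,3,4,5))
qed

text \<open>Homomorphisms over the whole tensor square commute with \<open>\<Delta> UH\<close>, so
  inclusions and projections restrict to the weight spaces unchanged.\<close>

lemma decomposes_weight:
  assumes "decomposes M J N"
  shows "decomposes (weight_module M \<theta>) J (\<lambda>j. weight_module (N j) \<theta>)"
proof -
  obtain \<phi> \<psi> where "decomposition M J N \<phi> \<psi>" using assms unfolding decomposes_def by blast
  note D = decompositionD[OF this]
  have "decomposition (weight_module M \<theta>) J (\<lambda>j. weight_module (N j) \<theta>) \<phi> \<psi>"
    by (rule decompositionI) (simp_all add: D weight_module_is_module mod_hom_weight weight_module_simps)
  then show ?thesis unfolding decomposes_def by blast
qed

text \<open>The map \<open>\<iota> x0\<close> carries the decomposition of the tensor product back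
  to the cube. All pairs of words are still present, including those whose weight space is
  zero.\<close>

lemma ksubset_module_decomposes:
  assumes "finite \<Omega>" "x0 \<in> ksubsets \<Omega> k"
  shows "decomposes (ksubset_module \<Omega> k x0) (words (card \<Omega> - k) \<times> words k)
    (\<lambda>(q, r). LL (height q) (height r) (of_nat (card \<Omega>) - 2 * of_nat k))"
proof -
  have x0: "x0 \<subseteq> \<Omega>" "card x0 = k" "finite x0" using assms finite_subset by (auto simp: ksubsets_def)
  have c: "card (\<Omega> - x0) = card \<Omega> - k" using x0 by (simp add: card_Diff_subset)
  have f: "finite (\<Omega> - x0)" using assms(1) by simp
  note T = tensor_module[OF cube_module(1,2)[OF f] cube_module(1,2)[OF x0(3)]]
  note M = cube_at_module[OF assms(1) x0(1)]
  have "cube_at \<Omega> x0 \<cong>\<^sub>m cube (\<Omega> - x0) \<otimes>\<^sub>m cube x0"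
    unfolding mod_iso_def M(2) T(1) using iota_bij[OF x0(1)] M(3)
    by (intro exI[of _ "\<iota> x0"]) (simp add: iota_def lin_on_lin_ext)
  from decomposes_weight[OF decomposes_transfer[OF this M(1) cube_tensor_decomposes[OF f x0(3)]],
      of "of_nat (card \<Omega>) - 2 * of_nat k"]
  show ?thesis
    unfolding ksubset_module_eq_weight[OF assms(1) x0(1)] c x0(2) LL_def by (simp add: split_beta')
qed

section \<open>The modules \<open>(L\<^sub>m \<otimes> L\<^sub>n)(\<theta>)\<close>\<close>

definition LL_index :: "nat \<Rightarrow> nat \<Rightarrow> complex \<Rightarrow> (nat \<times> nat) set" where
  "LL_index m n \<theta> = {(a, b). a \<le> m \<and> b \<le> n \<and> (of_nat m - 2 * of_nat a) + (of_nat n - 2 * of_nat b) = \<theta>}"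

lemmas LT_module = tensor_module[OF L_module L_module]

lemma bvec_nonzero: "bvec z \<noteq> 0"
  using lookup_single_eq[of z "1 :: complex"] by (metis lookup_zero zero_neq_one)

lemma lookup_lin_ext_diag:
  "Poly_Mapping.lookup (lin_ext (\<lambda>x. c x *\<^sub>C bvec x) v) x = c x * Poly_Mapping.lookup v x"
  by (simp add: lin_ext_def Poly_Mapping.lookup_sum scaleC_poly_mapping.rep_eq lookup_single
      scaleC_complex_def when_def in_keys_iff if_distrib cong: if_cong)

lemma LT_act:
  assumes "a \<le> m" "b \<le> n"
  shows "act (L_mod m \<otimes>\<^sub>m L_mod n) (gen s \<otimes>\<^sub>a gen t) (bvec (a, b)) = L_op m s a \<otimes>\<^sub>v L_op n t b"
    and "act (L_mod m \<otimes>\<^sub>m L_mod n) (gen s \<otimes>\<^sub>a 1) (bvec (a, b)) = L_op m s a \<otimes>\<^sub>v bvec b"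
    and "act (L_mod m \<otimes>\<^sub>m L_mod n) (1 \<otimes>\<^sub>a gen s) (bvec (a, b)) = bvec a \<otimes>\<^sub>v L_op n s b"
    and "act (L_mod m \<otimes>\<^sub>m L_mod n) 1 (bvec (a, b)) = bvec (a, b)"
proof -
  have ab: "bvec a \<in> free_on {0..m}" "bvec b \<in> free_on {0..n}" using assms by (auto simp: bvec_free_on)
  have 1: "act (L_mod m) 1 (bvec a) = bvec a" "act (L_mod n) 1 (bvec b) = bvec b"
    using is_moduleD(6)[OF L_module(1)] ab by (simp_all add: L_module)
  show "act (L_mod m \<otimes>\<^sub>m L_mod n) (gen s \<otimes>\<^sub>a gen t) (bvec (a, b)) = L_op m s a \<otimes>\<^sub>v L_op n t b"
    "act (L_mod m \<otimes>\<^sub>m L_mod n) (gen s \<otimes>\<^sub>a 1) (bvec (a, b)) = L_op m s a \<otimes>\<^sub>v bvec b"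
    "act (L_mod m \<otimes>\<^sub>m L_mod n) (1 \<otimes>\<^sub>a gen s) (bvec (a, b)) = bvec a \<otimes>\<^sub>v L_op n s b"
    using LT_module(3)[OF ab] assms 1 by (simp_all add: L_act bvec_tvec del: L_op.simps)
  show "act (L_mod m \<otimes>\<^sub>m L_mod n) 1 (bvec (a, b)) = bvec (a, b)"
    using is_moduleD(6)[OF LT_module(2)] assms by (simp add: LT_module bvec_free_on)
qed

lemma act_diff: "is_module M \<Longrightarrow> v \<in> mcarrier M \<Longrightarrow> act M (a - b) v = act M a v - act M b v"
  using is_moduleD(7)[of M v "a - b" b] by (simp add: algebra_simps)

lemma LT_act_natural:
  assumes "a \<le> m" "b \<le> n"
  shows "act (L_mod m \<otimes>\<^sub>m L_mod n) (\<Delta> UH) (bvec (a, b)) =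
      ((of_nat m - 2 * of_nat a) + (of_nat n - 2 * of_nat b)) *\<^sub>C bvec (a, b)"
    and "act (L_mod m \<otimes>\<^sub>m L_mod n) (\<natural> (gen GA)) (bvec (a, b)) =
      (((of_nat m - 2 * of_nat a) - (of_nat n - 2 * of_nat b)) / 4) *\<^sub>C bvec (a, b)"
    and "act (L_mod m \<otimes>\<^sub>m L_mod n) (\<natural> (gen GC)) (bvec (a, b)) =
      (of_nat a * (of_nat n - of_nat b)) *\<^sub>C bvec (a - 1, b + 1) -
      ((of_nat m - of_nat a) * of_nat b) *\<^sub>C bvec (a + 1, b - 1)"
proof -
  let ?M = "L_mod m \<otimes>\<^sub>m L_mod n"
  have v: "bvec (a, b) \<in> mcarrier ?M" using assms by (simp add: LT_module bvec_free_on)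
  note M = is_moduleD[OF LT_module(2)[of m n]] act_diff[OF LT_module(2)[of m n]]
  show "act ?M (\<Delta> UH) (bvec (a, b)) =
      ((of_nat m - 2 * of_nat a) + (of_nat n - 2 * of_nat b)) *\<^sub>C bvec (a, b)"
    by (simp add: comul_hom(2) M v LT_act assms tvec_simps bvec_tvec flip: scaleC_add_left)
  show "act ?M (\<natural> (gen GA)) (bvec (a, b)) =
      (((of_nat m - 2 * of_nat a) - (of_nat n - 2 * of_nat b)) / 4) *\<^sub>C bvec (a, b)"
    by (simp add: natural_hom(2) M v LT_act assms tvec_simps bvec_tvec flip: cvec.scale_left_diff_distrib)
  show "act ?M (\<natural> (gen GC)) (bvec (a, b)) =
      (of_nat a * (of_nat n - of_nat b)) *\<^sub>C bvec (a - 1, b + 1) -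
      ((of_nat m - of_nat a) * of_nat b) *\<^sub>C bvec (a + 1, b - 1)"
    by (simp add: natural_hom(2) M v LT_act assms L_op_eq tvec_simps bvec_tvec mult.commute del: L_op.simps)
qed

lemma LL_module: "is_module (LL m n \<theta>)"
  unfolding LL_def by (rule weight_module_is_module[OF LT_module(2)])

lemma LL_act: "act (LL m n \<theta>) a = act (L_mod m \<otimes>\<^sub>m L_mod n) (\<natural> a)"
  unfolding LL_def by (rule weight_module_simps)

text \<open>\<open>\<Delta> UH\<close> is diagonal in the basis of pure tensors, so a vector has
  weight \<theta> exactly when every basis vector in its support does.\<close>

lemma LL_carrier: "mcarrier (LL m n \<theta>) = free_on (LL_index m n \<theta>)"
proof (rule set_eqI)
  fix v
  let ?M = "L_mod m \<otimes>\<^sub>m L_mod n"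
  define c where "c = (\<lambda>(a, b). (of_nat m - 2 * of_nat a) + (of_nat n - 2 * of_nat b) :: complex)"
  have "act ?M (\<Delta> UH) v = lin_ext (\<lambda>x. c x *\<^sub>C bvec x) v" if "v \<in> free_on ({0..m} \<times> {0..n})"
    using is_moduleD(3)[OF LT_module(2), of m n "\<Delta> UH", unfolded LT_module(1)]
    by (rule lin_on_eqI[OF _ lin_on_lin_ext _ that])
      (auto simp: lin_ext_bvec LT_act_natural c_def)
  then have "Poly_Mapping.lookup (act ?M (\<Delta> UH) v) x = c x * Poly_Mapping.lookup v x"
    if "v \<in> free_on ({0..m} \<times> {0..n})" for x
    using that by (simp add: lookup_lin_ext_diag)
  then have "act ?M (\<Delta> UH) v = \<theta> *\<^sub>C v \<longleftrightarrow> (\<forall>x. x \<in> Poly_Mapping.keys v \<longrightarrow> c x = \<theta>)"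
    if "v \<in> free_on ({0..m} \<times> {0..n})"
    unfolding poly_mapping_eq_iff fun_eq_iff using that
    by (simp add: scaleC_poly_mapping.rep_eq scaleC_complex_def in_keys_iff disj_commute imp_conv_disj del: split_paired_All)
  moreover have "v \<in> free_on (LL_index m n \<theta>) \<longleftrightarrow>
      v \<in> free_on ({0..m} \<times> {0..n}) \<and> (\<forall>x. x \<in> Poly_Mapping.keys v \<longrightarrow> c x = \<theta>)"
    unfolding free_on_def LL_index_def c_def by fastforce
  ultimately show "v \<in> mcarrier (LL m n \<theta>) \<longleftrightarrow> v \<in> free_on (LL_index m n \<theta>)"
    unfolding LL_def weight_module_simps LT_module(1) by blast
qed

section \<open>Irreducibility from the simple spectrum of \<open>A\<close> and the neighbour
  structure of \<open>C\<close>\<close>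

lemma diagonal_stable_subspace:
  assumes W: "cvec.subspace W" and stable: "\<And>v. v \<in> W \<Longrightarrow> lin_ext (\<lambda>x. c x *\<^sub>C bvec x) v \<in> W"
    and inj: "inj_on c X" and v: "v \<in> W" "v \<in> free_on X" and z: "z \<in> Poly_Mapping.keys v"
  shows "bvec z \<in> W"
  using v z
proof (induction "card (Poly_Mapping.keys v)" arbitrary: v rule: less_induct)
  case less
  show ?case
  proof (cases "Poly_Mapping.keys v = {z}")
    case True
    then have "Poly_Mapping.lookup v x \<noteq> 0 \<longleftrightarrow> x = z" for x by (simp flip: in_keys_iff)
    then have "bvec z = (1 / Poly_Mapping.lookup v z) *\<^sub>C v"
      by (intro poly_mapping_eqI)
        (auto simp: lookup_single when_def scaleC_poly_mapping.rep_eq scaleC_complex_def)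
    then show ?thesis using less.prems W by (auto intro: cvec.subspace_scale)
  next
    case False
    then obtain y where y: "y \<in> Poly_Mapping.keys v" "y \<noteq> z" using less.prems by auto
    \<comment> \<open>Subtracting the eigenvalue at \<open>y\<close> removes \<open>y\<close> from
      the support and, \<open>c\<close> being injective, nothing else. So \<open>z\<close> survives
      in a smaller support.\<close>
    define u where "u = lin_ext (\<lambda>x. c x *\<^sub>C bvec x) v - c y *\<^sub>C v"
    have l: "Poly_Mapping.lookup u x = (c x - c y) * Poly_Mapping.lookup v x" for x
      by (simp add: u_def lookup_minus lookup_lin_ext_diag scaleC_poly_mapping.rep_eq
          scaleC_complex_def algebra_simps)
    have "c x \<noteq> c y" if "x \<in> Poly_Mapping.keys v" "x \<noteq> y" for x
      using that y inj less.prems(2) by (auto simp: inj_on_def free_on_def)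
    then have "x \<in> Poly_Mapping.keys u \<longleftrightarrow> x \<in> Poly_Mapping.keys v - {y}" for x
      by (cases "x = y") (auto simp: in_keys_iff l)
    then have k: "Poly_Mapping.keys u = Poly_Mapping.keys v - {y}" by blast
    have "card (Poly_Mapping.keys u) < card (Poly_Mapping.keys v)"
      unfolding k using y by (intro psubset_card_mono) auto
    moreover have "u \<in> W" unfolding u_def
      using stable less.prems W by (intro cvec.subspace_diff cvec.subspace_scale) auto
    moreover have "u \<in> free_on X" "z \<in> Poly_Mapping.keys u"
      using k y less.prems by (auto simp: free_on_def)
    ultimately show ?thesis by (rule less.hyps)
  qed
qed

definition A_value :: "nat \<Rightarrow> nat \<Rightarrow> nat \<times> nat \<Rightarrow> complex" where
  "A_value m n = (\<lambda>(a, b). ((of_nat m - 2 * of_nat a) - (of_nat n - 2 * of_nat b)) / 4)"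

lemma LL_act_A:
  assumes "v \<in> free_on (LL_index m n \<theta>)"
  shows "act (LL m n \<theta>) (gen GA) v = lin_ext (\<lambda>z. A_value m n z *\<^sub>C bvec z) v"
proof (rule lin_on_eqI[OF _ lin_on_lin_ext _ assms])
  show "lin_on (free_on (LL_index m n \<theta>)) (act (LL m n \<theta>) (gen GA))"
    using is_moduleD(3)[OF LL_module] by (simp add: LL_carrier)
qed (auto simp: LL_act LT_act_natural LL_index_def A_value_def lin_ext_bvec)

lemma LL_index_sum:
  assumes "(a, b) \<in> LL_index m n \<theta>" "(a', b') \<in> LL_index m n \<theta>"
  shows "a + b = a' + b'"
proof -
  have "of_nat (2 * (a + b)) = (of_nat (2 * (a' + b')) :: complex)"
    using assms unfolding LL_index_def by (auto simp: algebra_simps)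
  then have "2 * (a + b) = 2 * (a' + b')" by (simp only: of_nat_eq_iff)
  then show ?thesis by simp
qed

text \<open>The weight fixes a + b and the eigenvalue of \<open>A\<close> fixes a - b; together they
  fix the pair.\<close>

lemma inj_on_A_value: "inj_on (A_value m n) (LL_index m n \<theta>)"
proof (rule inj_onI)
  fix x y assume xy: "x \<in> LL_index m n \<theta>" "y \<in> LL_index m n \<theta>" and eq: "A_value m n x = A_value m n y"
  obtain a b a' b' where x: "x = (a, b)" and y: "y = (a', b')" by (cases x, cases y)
  have "a + b = a' + b'" using LL_index_sum xy unfolding x y by blast
  moreover have "of_nat (8 * (a + b')) = (of_nat (8 * (a' + b)) :: complex)"
    using eq by (simp add: x y A_value_def field_simps)
  then have "8 * (a + b') = 8 * (a' + b)" by (simp only: of_nat_eq_iff)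
  ultimately show "x = y" by (simp add: x y)
qed

lemma LL_irreducible:
  assumes "LL_index m n \<theta> \<noteq> {}"
  shows "irreducible_module (LL m n \<theta>)"
proof -
  let ?I = "LL_index m n \<theta>"
  have "W = free_on ?I" if W: "submodule W (LL m n \<theta>)" and "W \<noteq> {0}" for W
  proof -
    have sub: "cvec.subspace W" and WI: "W \<subseteq> free_on ?I"
      and st: "\<And>a v. v \<in> W \<Longrightarrow> act (LL m n \<theta>) a v \<in> W"
      using W by (auto simp: submodule_def LL_carrier)
    have keys: "bvec z \<in> W" if "v \<in> W" "z \<in> Poly_Mapping.keys v" for v z
      using st[of _ "gen GA"] WI that
      by (intro diagonal_stable_subspace[OF sub _ inj_on_A_value, where v = v]) (auto simp flip: LL_act_A)
    \<comment> \<open>\<open>C\<close> maps the vector at (a, b) into the span of its two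
      neighbours. The coefficient a (n - b) is nonzero here and the neighbours are distinct, so
      nothing cancels and \<open>keys\<close> isolates this neighbour.\<close>
    have step: "bvec (a - 1, b + 1) \<in> W" if "bvec (a, b) \<in> W" "0 < a" "b < n" for a b
    proof -
      have ab: "a \<le> m" "b \<le> n" using that(1) WI by (auto simp: bvec_free_on LL_index_def)
      show ?thesis using that ab
        by (intro keys[OF st[OF that(1), of "gen GC"]])
          (auto simp: LL_act LT_act_natural in_keys_iff lookup_minus scaleC_poly_mapping.rep_eq
            lookup_single when_def scaleC_complex_def)
    qed
    have step': "bvec (a + 1, b - 1) \<in> W" if "bvec (a, b) \<in> W" "0 < b" "a < m" for a b
    proof -
      have ab: "a \<le> m" "b \<le> n" using that(1) WI by (auto simp: bvec_free_on LL_index_def)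
      show ?thesis using that ab
        by (intro keys[OF st[OF that(1), of "gen GC"]])
          (auto simp: LL_act LT_act_natural in_keys_iff lookup_minus scaleC_poly_mapping.rep_eq
            lookup_single when_def scaleC_complex_def)
    qed
    obtain v where "v \<in> W" "v \<noteq> 0" using \<open>W \<noteq> {0}\<close> cvec.subspace_0[OF sub] by auto
    then obtain a0 b0 where z: "bvec (a0, b0) \<in> W" using keys[of v] by (metis keys_eq_empty all_not_in_conv surj_pair)
    then have z': "(a0, b0) \<in> ?I" using WI by (auto simp: bvec_free_on)
    then have ab0: "a0 \<le> m" "b0 \<le> n" by (auto simp: LL_index_def)
    \<comment> \<open>The indices form the part of a line a + b = const inside a box, hence one
      interval: walking from (a0, b0) in both directions reaches every index without leaving the
      box.\<close>
    have up: "bvec (a0 + d, b0 - d) \<in> W" if "a0 + d \<le> m" "d \<le> b0" for d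
      using that
    proof (induction d)
      case (Suc d)
      then show ?case using step'[of "a0 + d" "b0 - d"] by simp
    qed (use z in simp)
    have down: "bvec (a0 - d, b0 + d) \<in> W" if "d \<le> a0" "b0 + d \<le> n" for d
      using that
    proof (induction d)
      case (Suc d)
      then show ?case using step[of "a0 - d" "b0 + d"] by simp
    qed (use z in simp)
    have "bvec y \<in> W" if "y \<in> ?I" for y
    proof -
      obtain a b where y: "y = (a, b)" by (cases y)
      have s: "a + b = a0 + b0" using LL_index_sum that z' unfolding y by blast
      have ab: "a \<le> m" "b \<le> n" using that y by (auto simp: LL_index_def)
      show ?thesis
      proof (cases "a0 \<le> a")
        case True
        have "b0 - (a - a0) = b" "a - a0 \<le> b0" using s True by auto
        then show ?thesis using up[of "a - a0"] ab True by (simp add: y)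
      next
        case False
        have "b0 + (a0 - a) = b" "a0 - a \<le> a0" using s False by auto
        then show ?thesis using down[of "a0 - a"] ab False by (simp add: y)
      qed
    qed
    then have "free_on ?I \<subseteq> W" using lin_ext_closed[OF sub, of ?I bvec] by (auto simp: lin_ext_expand)
    then show ?thesis using WI by blast
  qed
  moreover obtain z where "z \<in> ?I" using assms by blast
  then have "bvec z \<in> free_on ?I" "bvec z \<noteq> 0" by (auto simp: bvec_free_on bvec_nonzero)
  then have "free_on ?I \<noteq> {0}" by blast
  ultimately show ?thesis
    unfolding irreducible_module_def using LL_module by (auto simp: LL_carrier)
qed

lemma LL_zero: "LL_index m n \<theta> = {} \<Longrightarrow> mcarrier (LL m n \<theta>) = {0}"
  unfolding LL_carrier by (auto simp: free_on_def)

text \<open>Exchanging the tensor factors and applying the Weyl element \<open>v\<^sub>i \<mapsto> v\<^bsub>n-i\<^esub>\<close> to each of them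
  preserves \<open>A\<close>, \<open>B\<close> and \<open>C\<close> and changes the sign of the weight.\<close>

lemma LL_swap: "LL m n 0 \<cong>\<^sub>m LL n m 0"
proof -
  define \<sigma> :: "nat \<Rightarrow> nat \<Rightarrow> (nat \<times> nat \<Rightarrow>\<^sub>0 complex) \<Rightarrow> (nat \<times> nat \<Rightarrow>\<^sub>0 complex)"
    where "\<sigma> m n = lin_ext (\<lambda>(a, b). bvec (n - b, m - a))" for m n
  let ?M = "\<lambda>m n. L_mod m \<otimes>\<^sub>m L_mod n"
  have \<sigma>_simps: "\<sigma> m n (u + v) = \<sigma> m n u + \<sigma> m n v" "\<sigma> m n (u - v) = \<sigma> m n u - \<sigma> m n v"
      "\<sigma> m n (c *\<^sub>C v) = c *\<^sub>C \<sigma> m n v" for m n u v c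
    by (simp_all add: \<sigma>_def lin_ext_simps lin_ext_diff)
  have cl: "\<sigma> m n v \<in> free_on ({0..n} \<times> {0..m})" if "v \<in> free_on ({0..m} \<times> {0..n})" for v
    unfolding \<sigma>_def using that
    by (intro lin_ext_closed[where X = "{0..m} \<times> {0..n}"] free_on_subspace) (auto simp: bvec_free_on)
  note M = is_moduleD[OF LT_module(2)[of m n]] act_diff[OF LT_module(2)[of m n]]
  note N = is_moduleD[OF LT_module(2)[of n m]] act_diff[OF LT_module(2)[of n m]]
  \<comment> \<open>Conjugation by \<open>\<sigma>\<close> on the six generators: the factors are
    exchanged, E and F trade places, and H changes its sign.\<close>
  have tw: "\<sigma> m n (act (?M m n) x v) = c *\<^sub>C act (?M n m) y (\<sigma> m n v)"
    if v: "v \<in> free_on ({0..m} \<times> {0..n})"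
      and xy: "(x, c, y) \<in> {(UE \<otimes>\<^sub>a 1, 1, 1 \<otimes>\<^sub>a UF), (1 \<otimes>\<^sub>a UE, 1, UF \<otimes>\<^sub>a 1), (UF \<otimes>\<^sub>a 1, 1, 1 \<otimes>\<^sub>a UE),
        (1 \<otimes>\<^sub>a UF, 1, UE \<otimes>\<^sub>a 1), (UH \<otimes>\<^sub>a 1, -1, 1 \<otimes>\<^sub>a UH), (1 \<otimes>\<^sub>a UH, -1, UH \<otimes>\<^sub>a 1)}" for x c y v
  proof (rule lin_on_eqI[where f = "\<lambda>v. \<sigma> m n (act (?M m n) x v)" and g = "\<lambda>v. c *\<^sub>C act (?M n m) y (\<sigma> m n v)", OF _ _ _ v])
    show "lin_on (free_on ({0..m} \<times> {0..n})) (\<lambda>v. \<sigma> m n (act (?M m n) x v))"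
      using M(4,5) by (simp add: lin_on_def LT_module \<sigma>_simps)
    show "lin_on (free_on ({0..m} \<times> {0..n})) (\<lambda>v. c *\<^sub>C act (?M n m) y (\<sigma> m n v))"
      using N(4,5) cl by (simp add: lin_on_def LT_module \<sigma>_simps scaleC_add_right mult.commute)
    fix z assume "z \<in> {0..m} \<times> {0..n}"
    then obtain a b where z: "z = (a, b)" and ab: "a \<le> m" "b \<le> n" by auto
    have ab': "n - b \<le> n" "m - a \<le> m" by auto
    have \<sigma>b: "\<sigma> m n (bvec (i, j)) = bvec (n - j, m - i)" for i j by (simp add: \<sigma>_def lin_ext_bvec)
    \<comment> \<open>For a = 0 or b = 0 the subtraction truncates and the two vectors differ, but
      then the scalar is 0.\<close>
    have \<sigma>S: "of_nat a *\<^sub>C bvec (n - b, m - (a - Suc 0)) = (of_nat a *\<^sub>C bvec (n - b, Suc (m - a)) :: _ \<Rightarrow>\<^sub>0 complex)"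
      "of_nat b *\<^sub>C bvec (n - (b - Suc 0), m - a) = (of_nat b *\<^sub>C bvec (Suc (n - b), m - a) :: _ \<Rightarrow>\<^sub>0 complex)"
      using ab by (cases a; cases b; auto simp: Suc_diff_Suc)+
    show "\<sigma> m n (act (?M m n) x (bvec z)) = c *\<^sub>C act (?M n m) y (\<sigma> m n (bvec z))"
      using xy ab unfolding z \<sigma>b
      by (auto simp: LT_act[OF ab] LT_act[OF ab'] L_op_eq tvec_simps bvec_tvec \<sigma>_simps \<sigma>b \<sigma>S
          simp del: L_op.simps(1,2) simp flip: cvec.scale_minus_left)
  qed
  have hom: "\<sigma> m n (act (?M m n) (\<natural> (gen g)) v) = act (?M n m) (\<natural> (gen g)) (\<sigma> m n v)"
    if v: "v \<in> free_on ({0..m} \<times> {0..n})" for g v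
  proof -
    have c: "act (?M m n) x v \<in> free_on ({0..m} \<times> {0..n})" if "v \<in> free_on ({0..m} \<times> {0..n})" for x v
      using M(2) that by (simp add: LT_module)
    have c': "act (?M n m) x v \<in> free_on ({0..n} \<times> {0..m})" if "v \<in> free_on ({0..n} \<times> {0..m})" for x v
      using N(2) that by (simp add: LT_module)
    note M' = M[unfolded LT_module(1)] and N' = N[unfolded LT_module(1)]
    define e1 e2 f1 f2 h1 h2 :: usl2_2 where d: "e1 = UE \<otimes>\<^sub>a 1" "e2 = 1 \<otimes>\<^sub>a UE" "f1 = UF \<otimes>\<^sub>a 1"
      "f2 = 1 \<otimes>\<^sub>a UF" "h1 = UH \<otimes>\<^sub>a 1" "h2 = 1 \<otimes>\<^sub>a UH"
    have L: "\<Delta> \<Lambda> = (e1 + e2) * (f1 + f2) + (f1 + f2) * (e1 + e2) + (1/2) *\<^sub>C ((h1 + h2) * (h1 + h2))"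
      using comul_hom unfolding Casimir_def alg_hom_def d by (simp add: power2_eq_square)
    have C: "UE \<otimes>\<^sub>a UF = e1 * f2" "UF \<otimes>\<^sub>a UE = f1 * e2" by (simp_all add: d tens_simps)
    have t: "\<sigma> m n (act (?M m n) e1 v) = act (?M n m) f2 (\<sigma> m n v)"
        "\<sigma> m n (act (?M m n) e2 v) = act (?M n m) f1 (\<sigma> m n v)"
        "\<sigma> m n (act (?M m n) f1 v) = act (?M n m) e2 (\<sigma> m n v)"
        "\<sigma> m n (act (?M m n) f2 v) = act (?M n m) e1 (\<sigma> m n v)"
        "\<sigma> m n (act (?M m n) h1 v) = (-1) *\<^sub>C act (?M n m) h2 (\<sigma> m n v)"
        "\<sigma> m n (act (?M m n) h2 v) = (-1) *\<^sub>C act (?M n m) h1 (\<sigma> m n v)"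
      if "v \<in> free_on ({0..m} \<times> {0..n})" for v
      using tw[OF that, of e1 1 f2] tw[OF that, of e2 1 f1] tw[OF that, of f1 1 e2]
        tw[OF that, of f2 1 e1] tw[OF that, of h1 "-1" h2] tw[OF that, of h2 "-1" h1] by (simp_all add: d)
    have "e1 * f2 = f2 * e1" "f1 * e2 = e2 * f1" by (simp_all add: d tens_simps)
    note comm = this
    show ?thesis
    \<comment> \<open>The difference h1 - h2 becomes -h2 + h1, and ef + fe + h^2/2 is symmetric
      under exchanging e, f and negating h. For \<open>C\<close> the substitution gives f2 e1 - e2
      f1, which is the original element because the two tensor factors commute.\<close>
    proof (cases g)
      case GA
      show ?thesis unfolding GA natural_hom(2) natural_gen.simps d(5,6)[symmetric]
        using v cl c c' by (simp add: M' N' t \<sigma>_simps algebra_simps)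
    next
      case GB
      define e f h where efh: "e = e1 + e2" "f = f1 + f2" "h = h1 + h2"
      have tt: "\<sigma> m n (act (?M m n) e v) = act (?M n m) f (\<sigma> m n v)"
          "\<sigma> m n (act (?M m n) f v) = act (?M n m) e (\<sigma> m n v)"
          "\<sigma> m n (act (?M m n) h v) = (-1) *\<^sub>C act (?M n m) h (\<sigma> m n v)"
        if "v \<in> free_on ({0..m} \<times> {0..n})" for v
        unfolding efh using that cl by (simp_all add: M' N' t \<sigma>_simps algebra_simps)
      have neg: "act (?M n m) h (- u) = - act (?M n m) h u" if "u \<in> free_on ({0..n} \<times> {0..m})" for u
        using N'(5)[OF that, of h "-1"] by simp
      show ?thesis unfolding GB natural_hom(2) natural_gen.simps L efh[symmetric]
        using v cl c c' by (simp add: M' N' tt neg \<sigma>_simps add.commute)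
    next
      case GC
      show ?thesis unfolding GC natural_hom(2) natural_gen.simps C
        using v cl c c' by (simp add: M' N' t \<sigma>_simps) (simp add: comm N' cl c' flip: N'(8))
    qed
  qed
  have wt: "(n - b, m - a) \<in> LL_index n m 0" if "(a, b) \<in> LL_index m n 0" for m n a b
  proof -
    have ab: "a \<le> m" "b \<le> n" and eq: "(of_nat m - 2 * of_nat a) + (of_nat n - 2 * of_nat b) = (0 :: complex)"
      using that by (auto simp: LL_index_def)
    have "(of_nat n - 2 * of_nat (n - b)) + (of_nat m - 2 * of_nat (m - a)) =
        - ((of_nat m - 2 * of_nat a) + (of_nat n - 2 * of_nat b) :: complex)"
      using ab by (simp add: of_nat_diff)
    then show ?thesis unfolding eq by (simp add: LL_index_def)
  qed
  have cl': "\<sigma> m n v \<in> free_on (LL_index n m 0)" if "v \<in> free_on (LL_index m n 0)" for m n v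
    unfolding \<sigma>_def using that wt
    by (intro lin_ext_closed[where X = "LL_index m n 0"] free_on_subspace) (auto simp: bvec_free_on)
  have inv: "\<sigma> n m (\<sigma> m n v) = v" if v: "v \<in> free_on (LL_index m n 0)" for m n v
    by (rule lin_on_eqI[where f = "\<lambda>v. \<sigma> n m (\<sigma> m n v)" and g = "\<lambda>v. v", OF _ _ _ v])
      (auto simp: lin_on_def \<sigma>_simps, auto simp: \<sigma>_def lin_ext_bvec LL_index_def)
  have sub: "v \<in> free_on (LL_index m n 0) \<Longrightarrow> v \<in> free_on ({0..m} \<times> {0..n})" for v
    by (auto simp: free_on_def LL_index_def)
  show ?thesis
  proof (rule mod_isoI[where f = "\<sigma> m n" and g = "\<sigma> n m"])
    show "mod_hom (LL m n 0) (LL n m 0) (\<sigma> m n)"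
      by (rule mod_hom_gensI[OF LL_module LL_module])
        (auto simp: LL_carrier LL_act cl' hom sub lin_on_def \<sigma>_simps)
  qed (auto simp: LL_carrier cl' inv)
qed

section \<open>Eigenvalues of the central elements and non-isomorphism\<close>

definition casimir_value :: "nat \<Rightarrow> complex" where
  "casimir_value n = of_nat (n * (n + 2))"

text \<open>Twice \<open>\<Lambda>\<close>, the normalization used for \<open>k1\<close> and
  \<open>k2\<close> in \<open>hahn_identities\<close>; on L_n it is the scalar n (n + 2).\<close>

definition doubled_Casimir :: usl2 where
  "doubled_Casimir = 2 *\<^sub>C (UE * UF + UF * UE) + UH * UH"

lemma L_Casimir:
  assumes v: "v \<in> free_on {0..n}"
  shows "act (L_mod n) doubled_Casimir v = casimir_value n *\<^sub>C v"
proof (rule lin_on_eqI[where g = "\<lambda>v. casimir_value n *\<^sub>C v", OF _ _ _ v])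
  note L = is_moduleD[OF L_module(1)[of n]]
  show "lin_on (free_on {0..n}) (act (L_mod n) doubled_Casimir)" using L(3) by (simp add: L_module)
  show "lin_on (free_on {0..n}) (\<lambda>v. casimir_value n *\<^sub>C v)"
    by (simp add: lin_on_def scaleC_add_right mult.commute)
  fix i assume "i \<in> {0..n}"
  then have i: "i \<le> n" by simp
  have b: "bvec j \<in> mcarrier (L_mod n) \<longleftrightarrow> j \<le> n" for j by (simp add: L_module bvec_free_on)
  have EF: "act (L_mod n) (UE * UF) (bvec i) = ((of_nat n - of_nat i) * (of_nat i + 1)) *\<^sub>C bvec i"
  proof (cases "i = n")
    case True
    have "act (L_mod n) UE 0 = 0" using lin_on_zero[OF L(1,3)] .
    then show ?thesis using i True by (simp add: L b L_act)
  next
    case False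
    then show ?thesis using i by (simp add: L b L_act add.commute)
  qed
  have FE: "act (L_mod n) (UF * UE) (bvec i) = (of_nat i * (of_nat n - of_nat i + 1)) *\<^sub>C bvec i"
  proof (cases i)
    case 0
    have "act (L_mod n) UF 0 = 0" using lin_on_zero[OF L(1,3)] .
    moreover have "act (L_mod n) (UF * UE) (bvec i) = act (L_mod n) UF (act (L_mod n) UE (bvec i))"
      using L(8) b i by blast
    ultimately show ?thesis unfolding L_act[OF i] using 0 by simp
  next
    case (Suc j)
    then show ?thesis using i by (simp add: L b L_act)
  qed
  have HH: "act (L_mod n) (UH * UH) (bvec i) = (of_nat n - 2 * of_nat i) ^ 2 *\<^sub>C bvec i"
    using i by (simp add: L b L_act power2_eq_square)
  show "act (L_mod n) doubled_Casimir (bvec i) = casimir_value n *\<^sub>C bvec i"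
    using i unfolding doubled_Casimir_def
    by (simp add: L(7,9) b EF FE HH casimir_value_def power2_eq_square flip: scaleC_add_left)
      (simp add: algebra_simps)
qed

definition hahn_central :: "hahn" where
  "hahn_central = gen GC * gen GA - gen GA * gen GC + 2 *\<^sub>C (gen GA * gen GA) + gen GB"

definition hahn_central' :: "hahn" where
  "hahn_central' = gen GB * gen GC - gen GC * gen GB + 4 *\<^sub>C (gen GB * gen GA) + 2 *\<^sub>C gen GC"

text \<open>In the notation of \<open>hahn_identities\<close> the images of A and B are a/4 and b/4;
  rescaling the identities there produces the factors 1/8 and 1/4.\<close>

lemma natural_hahn_central:
  "\<natural> hahn_central = (1/8) *\<^sub>C (\<Delta> UH * \<Delta> UH + 2 *\<^sub>C (doubled_Casimir \<otimes>\<^sub>a 1 + 1 \<otimes>\<^sub>a doubled_Casimir))"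
  "\<natural> hahn_central' = (1/4) *\<^sub>C ((doubled_Casimir \<otimes>\<^sub>a 1 - 1 \<otimes>\<^sub>a doubled_Casimir) * \<Delta> UH)"
proof -
  let ?e1 = "UE \<otimes>\<^sub>a 1 :: usl2_2" and ?f1 = "UF \<otimes>\<^sub>a 1 :: usl2_2" and ?h1 = "UH \<otimes>\<^sub>a 1 :: usl2_2"
  let ?e2 = "1 \<otimes>\<^sub>a UE :: usl2_2" and ?f2 = "1 \<otimes>\<^sub>a UF :: usl2_2" and ?h2 = "1 \<otimes>\<^sub>a UH :: usl2_2"
  have r1: "?h1 * ?e1 = ?e1 * ?h1 + (?e1 + ?e1)" "?h1 * ?f1 = ?f1 * ?h1 - (?f1 + ?f1)"
      "?e1 * ?f1 = ?f1 * ?e1 + ?h1"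
    and r2: "?h2 * ?e2 = ?e2 * ?h2 + (?e2 + ?e2)" "?h2 * ?f2 = ?f2 * ?h2 - (?f2 + ?f2)"
      "?e2 * ?f2 = ?f2 * ?e2 + ?h2"
    by (simp_all add: tens_simps tens_diff sl2_rewrite)
  have c: "?e2 * ?e1 = ?e1 * ?e2" "?e2 * ?f1 = ?f1 * ?e2" "?e2 * ?h1 = ?h1 * ?e2"
       "?f2 * ?e1 = ?e1 * ?f2" "?f2 * ?f1 = ?f1 * ?f2" "?f2 * ?h1 = ?h1 * ?f2"
       "?h2 * ?e1 = ?e1 * ?h2" "?h2 * ?f1 = ?f1 * ?h2" "?h2 * ?h1 = ?h1 * ?h2"
    by (simp_all add: tens_simps)
  define a where "a = ?h1 - ?h2"
  define b where "b = 2 *\<^sub>C ((?e1 + ?e2) * (?f1 + ?f2) + (?f1 + ?f2) * (?e1 + ?e2))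
      + (?h1 + ?h2) * (?h1 + ?h2)"
  define cc where "cc = ?e1 * ?f2 - ?f1 * ?e2"
  have k: "2 *\<^sub>C (?e1 * ?f1 + ?f1 * ?e1) + ?h1 * ?h1 = doubled_Casimir \<otimes>\<^sub>a 1"
      "2 *\<^sub>C (?e2 * ?f2 + ?f2 * ?e2) + ?h2 * ?h2 = 1 \<otimes>\<^sub>a doubled_Casimir"
    by (simp_all add: doubled_Casimir_def tens_simps)
  have h: "?h1 + ?h2 = \<Delta> UH" by (simp add: comul_hom)
  note I = hahn_identities(2,3)[OF r1 r2 c, folded a_def b_def cc_def, unfolded k h]
  have gA: "\<natural> (gen GA) = (1/4) *\<^sub>C a" by (simp add: natural_hom(2) a_def)
  have "\<Delta> \<Lambda> = (?e1 + ?e2) * (?f1 + ?f2) + (?f1 + ?f2) * (?e1 + ?e2)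
      + (1/2) *\<^sub>C ((?h1 + ?h2) * (?h1 + ?h2))"
    using comul_hom unfolding Casimir_def alg_hom_def by (simp add: power2_eq_square)
  then have gB: "\<natural> (gen GB) = (1/4) *\<^sub>C b" by (simp add: natural_hom(2) b_def scaleC_add_right)
  have gC: "\<natural> (gen GC) = cc" by (simp add: natural_hom(2) cc_def tens_simps)
  have nat: "\<natural> (x + y) = \<natural> x + \<natural> y" "\<natural> (x * y) = \<natural> x * \<natural> y" "\<natural> (s *\<^sub>C x) = s *\<^sub>C \<natural> x" for x y s
    using natural_hom(1) unfolding alg_hom_def by auto
  have natd: "\<natural> (x - y) = \<natural> x - \<natural> y" for x y
    using nat(1)[of "x - y" y] by (simp add: algebra_simps)
  show "\<natural> hahn_central = (1/8) *\<^sub>C (\<Delta> UH * \<Delta> UH + 2 *\<^sub>C (doubled_Casimir \<otimes>\<^sub>a 1 + 1 \<otimes>\<^sub>a doubled_Casimir))"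
    unfolding I(1)[symmetric] hahn_central_def nat natd gA gB gC
    by (simp add: algebra_simps scaleC_add_right cvec.scale_right_diff_distrib)
  show "\<natural> hahn_central' = (1/4) *\<^sub>C ((doubled_Casimir \<otimes>\<^sub>a 1 - 1 \<otimes>\<^sub>a doubled_Casimir) * \<Delta> UH)"
    unfolding I(2)[symmetric] hahn_central'_def nat natd gA gB gC
    by (simp add: algebra_simps scaleC_add_right cvec.scale_right_diff_distrib)
qed

lemma LL_central_act:
  assumes v: "v \<in> mcarrier (LL m n \<theta>)"
  shows "act (LL m n \<theta>) hahn_central v =
      ((1/8) * (\<theta> ^ 2 + 2 * (casimir_value m + casimir_value n))) *\<^sub>C v"
    and "act (LL m n \<theta>) hahn_central' v =
      ((1/4) * ((casimir_value m - casimir_value n) * \<theta>)) *\<^sub>C v"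
proof -
  let ?M = "L_mod m \<otimes>\<^sub>m L_mod n"
  note M = is_moduleD[OF LT_module(2)[of m n]] act_diff[OF LT_module(2)[of m n]]
  have vM: "v \<in> mcarrier ?M" and h: "act ?M (\<Delta> UH) v = \<theta> *\<^sub>C v"
    using v by (simp_all add: LL_def weight_module_simps)
  have s: "c *\<^sub>C v \<in> mcarrier ?M" for c using cvec.subspace_scale[OF M(1) vM] .
  have k: "act ?M (doubled_Casimir \<otimes>\<^sub>a 1) v = casimir_value m *\<^sub>C v" "act ?M (1 \<otimes>\<^sub>a doubled_Casimir) v = casimir_value n *\<^sub>C v"
  proof -
    have lin: "lin_on (free_on ({0..m} \<times> {0..n})) (act ?M x)" for x using M(3) by (simp add: LT_module)
    have lin': "lin_on (free_on ({0..m} \<times> {0..n})) (\<lambda>v. c *\<^sub>C v)" for c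
      by (simp add: lin_on_def scaleC_add_right mult.commute)
    have vF: "v \<in> free_on ({0..m} \<times> {0..n})" using vM by (simp add: LT_module)
    have 1: "act (L_mod n) 1 w = w" if "w \<in> free_on {0..n}" for n w
      using is_moduleD(6)[OF L_module(1)] that by (simp add: L_module)
    have "act ?M (doubled_Casimir \<otimes>\<^sub>a 1) (bvec z) = casimir_value m *\<^sub>C bvec z \<and>
        act ?M (1 \<otimes>\<^sub>a doubled_Casimir) (bvec z) = casimir_value n *\<^sub>C bvec z" if "z \<in> {0..m} \<times> {0..n}" for z
    proof -
      have b: "bvec (fst z) \<in> free_on {0..m}" "bvec (snd z) \<in> free_on {0..n}"
        using that by (auto simp: bvec_free_on)
      show ?thesis using LT_module(3)[OF b] b by (simp add: L_Casimir 1 tvec_simps bvec_tvec)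
    qed
    then show "act ?M (doubled_Casimir \<otimes>\<^sub>a 1) v = casimir_value m *\<^sub>C v" "act ?M (1 \<otimes>\<^sub>a doubled_Casimir) v = casimir_value n *\<^sub>C v"
      using lin_on_eqI[OF lin lin' _ vF] by blast+
  qed
  show "act (LL m n \<theta>) hahn_central v = ((1/8) * (\<theta> ^ 2 + 2 * (casimir_value m + casimir_value n))) *\<^sub>C v"
    unfolding LL_act natural_hahn_central
    by (simp add: M vM s h k power2_eq_square flip: scaleC_add_left)
  show "act (LL m n \<theta>) hahn_central' v = ((1/4) * ((casimir_value m - casimir_value n) * \<theta>)) *\<^sub>C v"
    unfolding LL_act natural_hahn_central
    by (simp add: M vM s h k mult.commute flip: cvec.scale_left_diff_distrib)
qed

lemma scaleC_right_cancel: "c *\<^sub>C v = d *\<^sub>C v \<Longrightarrow> v \<noteq> 0 \<Longrightarrow> c = d"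
  by (metis cvec.scale_right_imp_eq)

lemma casimir_value_inj: "casimir_value m = casimir_value n \<Longrightarrow> m = n"
proof -
  assume "casimir_value m = casimir_value n"
  then have eq: "m * (m + 2) = n * (n + 2)" by (simp only: casimir_value_def of_nat_eq_iff)
  have "i * (i + 2) < j * (j + 2)" if "i < j" for i j :: nat
    using that by (intro mult_strict_mono) auto
  with eq show ?thesis by (metis nat_neq_iff)
qed

text \<open>An isomorphism preserves the scalars by which \<open>hahn_central\<close> and
  \<open>hahn_central'\<close> act. Comparing scalars takes a nonzero vector, whence
  \<open>ne\<close>; the common term \<theta>^2 cancels in the first equation.\<close>

lemma LL_iso_casimir:
  assumes iso: "LL m n \<theta> \<cong>\<^sub>m LL m' n' \<theta>" and ne: "LL_index m n \<theta> \<noteq> {}"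
  shows "casimir_value m + casimir_value n = casimir_value m' + casimir_value n'"
    and "(casimir_value m - casimir_value n) * \<theta> = (casimir_value m' - casimir_value n') * \<theta>"
proof -
  obtain f g where fg: "mod_hom (LL m n \<theta>) (LL m' n' \<theta>) f" "mod_hom (LL m' n' \<theta>) (LL m n \<theta>) g"
    "\<And>v. v \<in> mcarrier (LL m n \<theta>) \<Longrightarrow> g (f v) = v" "\<And>w. w \<in> mcarrier (LL m' n' \<theta>) \<Longrightarrow> f (g w) = w"
    using mod_isoE[OF iso LL_module] by metis
  obtain z where z: "bvec z \<in> mcarrier (LL m n \<theta>)" using ne by (auto simp: LL_carrier bvec_free_on)
  note F = mod_homD[OF fg(1)]
  have "f (bvec z) \<noteq> 0" using fg(3)[OF z] mod_hom_zero[OF LL_module fg(2)] bvec_nonzero by metis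
  note cancel = scaleC_right_cancel[OF _ this]
  have "((1/8) * (\<theta> ^ 2 + 2 * (casimir_value m + casimir_value n))) *\<^sub>C f (bvec z) =
      ((1/8) * (\<theta> ^ 2 + 2 * (casimir_value m' + casimir_value n'))) *\<^sub>C f (bvec z)"
    using F(5)[OF z, of hahn_central] unfolding LL_central_act(1)[OF z] LL_central_act(1)[OF F(1)[OF z]] F(4)[OF z] .
  from cancel[OF this] show "casimir_value m + casimir_value n = casimir_value m' + casimir_value n'"
    by (simp del: distrib_left_numeral)
  have "((1/4) * ((casimir_value m - casimir_value n) * \<theta>)) *\<^sub>C f (bvec z) =
      ((1/4) * ((casimir_value m' - casimir_value n') * \<theta>)) *\<^sub>C f (bvec z)"
    using F(5)[OF z, of hahn_central'] unfolding LL_central_act(2)[OF z] LL_central_act(2)[OF F(1)[OF z]] F(4)[OF z] .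
  from cancel[OF this] show "(casimir_value m - casimir_value n) * \<theta> = (casimir_value m' - casimir_value n') * \<theta>" by simp
qed

lemma LL_iso_nonzero_weight:
  assumes iso: "LL m n \<theta> \<cong>\<^sub>m LL m' n' \<theta>" and ne: "LL_index m n \<theta> \<noteq> {}" and "\<theta> \<noteq> 0"
  shows "m = m' \<and> n = n'"
proof -
  note c = LL_iso_casimir[OF iso ne]
  have d: "casimir_value m - casimir_value n = casimir_value m' - casimir_value n'" using c(2) \<open>\<theta> \<noteq> 0\<close> by simp
  have "2 * casimir_value m = (casimir_value m + casimir_value n) + (casimir_value m - casimir_value n)" by simp
  also have "\<dots> = 2 * casimir_value m'" unfolding c(1) d by simp
  finally have "casimir_value m = casimir_value m'" by simp
  moreover from this have "casimir_value n = casimir_value n'" using c(1) by simp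
  ultimately show ?thesis by (simp add: casimir_value_inj)
qed

text \<open>At weight \<open>0\<close> the largest eigenvalue of \<open>A\<close> is \<open>n / 2\<close> for \<open>n \<le> m\<close>.\<close>

lemma LL_iso_zero_weight_le:
  assumes iso: "LL m n 0 \<cong>\<^sub>m LL m' n' 0" and mn: "n \<le> m" "even (m - n)"
  shows "n \<le> n'"
proof -
  obtain f g where fg: "mod_hom (LL m n 0) (LL m' n' 0) f" "mod_hom (LL m' n' 0) (LL m n 0) g"
    "\<And>v. v \<in> mcarrier (LL m n 0) \<Longrightarrow> g (f v) = v" "\<And>w. w \<in> mcarrier (LL m' n' 0) \<Longrightarrow> f (g w) = w"
    using mod_isoE[OF iso LL_module] by metis
  obtain a where a: "m = n + 2 * a" using mn by (metis evenE le_add_diff_inverse)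
  \<comment> \<open>The pure tensor whose factors have H-weights n and -n: total weight 0,
    eigenvalue (n + n)/4 = n/2 of \<open>A\<close>.\<close>
  have z: "bvec (a, n) \<in> free_on (LL_index m n 0)" by (simp add: bvec_free_on LL_index_def a)
  note F = mod_homD[OF fg(1), unfolded LL_carrier]
  define v where "v = f (bvec (a, n))"
  have v: "v \<in> free_on (LL_index m' n' 0)" using F(1)[OF z] by (simp add: v_def)
  have "v \<noteq> 0" using fg(3) z mod_hom_zero[OF LL_module fg(2)] bvec_nonzero unfolding v_def LL_carrier by metis
  then obtain y where y: "y \<in> Poly_Mapping.keys v" by (metis keys_eq_empty all_not_in_conv)
  have "act (LL m n 0) (gen GA) (bvec (a, n)) = (of_nat n / 2) *\<^sub>C bvec (a, n)"
    unfolding LL_act_A[OF z] by (simp add: lin_ext_bvec A_value_def a)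
  then have "act (LL m' n' 0) (gen GA) v = (of_nat n / 2) *\<^sub>C v"
    using F(5)[OF z, of "gen GA"] F(4)[OF z] by (simp add: v_def)
  then have "Poly_Mapping.lookup (lin_ext (\<lambda>z. A_value m' n' z *\<^sub>C bvec z) v) y =
      (of_nat n / 2) * Poly_Mapping.lookup v y"
    by (simp add: LL_act_A[OF v] scaleC_poly_mapping.rep_eq scaleC_complex_def)
  then have eq: "A_value m' n' y = of_nat n / 2"
    using y by (simp add: lookup_lin_ext_diag in_keys_iff)
  obtain c d where cd: "y = (c, d)" by (cases y)
  have y': "d \<le> n'" and w: "(of_nat m' - 2 * of_nat c) + (of_nat n' - 2 * of_nat d) = (0 :: complex)"
    using y v by (auto simp: free_on_def LL_index_def cd subset_iff)
  \<comment> \<open>At weight 0 the eigenvalue of \<open>A\<close> at (c, d) is (2d - n')/2, which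
    is at most n'/2 because d \<le> n'. Equating it with n/2 gives n \<le> n'.\<close>
  have "of_nat m' - 2 * of_nat c = - (of_nat n' - 2 * of_nat d :: complex)"
    using w by (simp only: add_eq_0_iff2)
  then have "of_nat n / 2 = ((- (of_nat n' - 2 * of_nat d) - (of_nat n' - 2 * of_nat d)) / 4 :: complex)"
    using eq by (simp only: A_value_def cd prod.case)
  then have "of_nat (2 * n + 2 * n') = (of_nat (4 * d) :: complex)" by (simp add: field_simps)
  then have "2 * n + 2 * n' = 4 * d" by (simp only: of_nat_eq_iff)
  with y' show ?thesis by simp
qed

text \<open>The bound on eigenvalues of \<open>A\<close>, used in both directions, gives n = n';
  after that the sum of the Casimir values leaves only m = m'.\<close>

lemma LL_iso_zero_weight:
  assumes iso: "LL m n 0 \<cong>\<^sub>m LL m' n' 0" and mn: "n \<le> m" "even (m - n)" "n' \<le> m'" "even (m' - n')"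
  shows "m = m' \<and> n = n'"
proof -
  have n: "n = n'"
    using LL_iso_zero_weight_le[OF iso mn(1,2)] LL_iso_zero_weight_le[OF mod_iso_sym[OF iso LL_module] mn(3,4)] by simp
  obtain a where "m = n + 2 * a" using mn by (metis evenE le_add_diff_inverse)
  then have "(a, n) \<in> LL_index m n 0" by (simp add: LL_index_def)
  then have "casimir_value m = casimir_value m'" using LL_iso_casimir(1)[OF iso] n by auto
  then show ?thesis using n by (simp add: casimir_value_inj)
qed

section \<open>Multiplicities\<close>

text \<open>\<open>\<kappa>\<close> and \<open>\<kappa>'\<close> record isomorphism types with
  representatives \<open>L\<close>. Only the first family may differ from its representatives, and
  this freedom absorbs the exchange of factors at weight 0.\<close>

lemma decomposes_iso_fibres:
  assumes d: "decomposes M J N" and d': "decomposes M' J' N'"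
    and "\<And>x. card {j \<in> J. \<kappa> j = x} = card {j \<in> J'. \<kappa>' j = x}"
    and N: "\<And>j. j \<in> J \<Longrightarrow> N j \<cong>\<^sub>m L (\<kappa> j)" and N': "\<And>j. j \<in> J' \<Longrightarrow> N' j = L (\<kappa>' j)"
  shows "M \<cong>\<^sub>m M'"
proof -
  have "finite J" "finite J'" using d d' unfolding decomposes_def decomposition_def by auto
  from ex_bij_betw_fibres[OF this assms(3)] obtain \<pi> where
    \<pi>: "bij_betw \<pi> J J'" "\<And>j. j \<in> J \<Longrightarrow> \<kappa>' (\<pi> j) = \<kappa> j" by blast
  have "N j \<cong>\<^sub>m N' (\<pi> j)" if "j \<in> J" for j
    using N[OF that] N'[of "\<pi> j"] \<pi> that by (auto dest: bij_betwE)
  then show ?thesis by (rule decomposes_iso[OF d d' \<pi>(1)])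
qed

section \<open>The set P(k) as the set of nonvanishing weight spaces\<close>

lemma P_set_iff:
  assumes "k \<le> D"
  shows "(i, j) \<in> P_set D k \<longleftrightarrow> 2 * i \<le> D - k \<and> i + j \<le> D - k \<and> i + j \<le> k \<and> 2 * j \<le> k"
proof -
  obtain e where e: "D = k + e" using assms le_Suc_ex by blast
  have "(i, j) \<in> P_set D k \<longleftrightarrow> real i \<le> real e / 2 \<and> real j \<le> real e - real i \<and>
      real j \<le> real k - real i \<and> real j \<le> real k / 2"
    by (simp add: P_set_def e)
  also have "\<dots> \<longleftrightarrow> 2 * i \<le> e \<and> i + j \<le> e \<and> i + j \<le> k \<and> 2 * j \<le> k" by linarith
  finally show ?thesis by (simp add: e)
qed

lemma finite_P_set: "k \<le> D \<Longrightarrow> finite (P_set D k)"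
  by (rule finite_subset[of _ "{0..D} \<times> {0..D}"]) (auto simp: P_set_iff)

lemma LL_index_iff:
  assumes "k \<le> D" "2 * i \<le> D - k" "2 * j \<le> k"
  shows "LL_index (D - k - 2 * i) (k - 2 * j) (of_nat D - 2 * of_nat k) =
    {(a, b). a \<le> D - k - 2 * i \<and> b \<le> k - 2 * j \<and> i + j + a + b = k}"
proof -
  have "(of_nat (D - k - 2 * i) - 2 * of_nat a) + (of_nat (k - 2 * j) - 2 * of_nat b) =
      (of_nat D - 2 * of_nat k :: complex) \<longleftrightarrow> i + j + a + b = k" for a b
  proof -
    have "(of_nat (D - k - 2 * i) - 2 * of_nat a) + (of_nat (k - 2 * j) - 2 * of_nat b) -
        (of_nat D - 2 * of_nat k :: complex) = of_nat (2 * k) - of_nat (2 * (i + j + a + b))"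
      using assms by (simp add: of_nat_diff algebra_simps)
    then have "(of_nat (D - k - 2 * i) - 2 * of_nat a) + (of_nat (k - 2 * j) - 2 * of_nat b) =
      (of_nat D - 2 * of_nat k :: complex) \<longleftrightarrow> of_nat (2 * k) = (of_nat (2 * (i + j + a + b)) :: complex)"
      by (metis eq_iff_diff_eq_0)
    also have "\<dots> \<longleftrightarrow> 2 * k = 2 * (i + j + a + b)" by (simp only: of_nat_eq_iff)
    finally show ?thesis by auto
  qed
  then show ?thesis unfolding LL_index_def by simp
qed

text \<open>The line a + b = k - i - j meets the box exactly if 0 \<le> k - i - j \<le> (D - k - 2i)
  + (k - 2j), that is, if i + j \<le> k and i + j \<le> D - k. These are the bounds of P(k) that
  couple i and j.\<close>

lemma LL_index_nonempty_iff:
  assumes "k \<le> D" "2 * i \<le> D - k" "2 * j \<le> k"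
  shows "LL_index (D - k - 2 * i) (k - 2 * j) (of_nat D - 2 * of_nat k) \<noteq> {} \<longleftrightarrow> (i, j) \<in> P_set D k"
proof
  assume "LL_index (D - k - 2 * i) (k - 2 * j) (of_nat D - 2 * of_nat k) \<noteq> {}"
  then obtain a b where "a \<le> D - k - 2 * i" "b \<le> k - 2 * j" "i + j + a + b = k"
    unfolding LL_index_iff[OF assms] by auto
  then show "(i, j) \<in> P_set D k" using assms by (simp add: P_set_iff)
next
  assume P: "(i, j) \<in> P_set D k"
  \<comment> \<open>Take a as large as possible, so that b = k - i - j - a is as small as
    possible.\<close>
  define a where "a = min (D - k - 2 * i) (k - i - j)"
  have "a \<le> D - k - 2 * i \<and> k - i - j - a \<le> k - 2 * j \<and> i + j + a + (k - i - j - a) = k"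
    using P assms by (auto simp: P_set_iff a_def min_def)
  then show "LL_index (D - k - 2 * i) (k - 2 * j) (of_nat D - 2 * of_nat k) \<noteq> {}"
    unfolding LL_index_iff[OF assms] by blast
qed

text \<open>Label a pair of words by its heights. Over the label of (i, j) in P(k) lie m_i(D-k)
  m_j(k) pairs by \<open>card_words_height\<close>, which is the prescribed number of
  copies.\<close>

lemma ksubset_module_iso:
  fixes \<Omega> x0 :: "'a set"
  assumes fin: "finite \<Omega>" and D: "card \<Omega> = D" and k: "k \<le> D" and x0: "x0 \<in> ksubsets \<Omega> k"
  shows "ksubset_module \<Omega> k x0 \<cong>\<^sub>m
    dsum (P_set D k) (\<lambda>(i, j). copies (mult_m i (D - k) * mult_m j k)
      (LL (D - k - 2 * i) (k - 2 * j) (of_nat D - 2 * of_nat k)))"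
proof -
  let ?\<theta> = "of_nat D - 2 * of_nat k :: complex"
  let ?J = "words (D - k) \<times> words k"
  let ?J' = "Sigma (P_set D k) (\<lambda>p. {..<mult_m (fst p) (D - k) * mult_m (snd p) k})"
  define J0 where "J0 = {(q, r). (q, r) \<in> ?J \<and> LL_index (height q) (height r) ?\<theta> \<noteq> {}}"
  have "decomposes (ksubset_module \<Omega> k x0) ?J (\<lambda>(q, r). LL (height q) (height r) ?\<theta>)"
    using ksubset_module_decomposes[OF fin x0] by (simp add: D)
  then have d: "decomposes (ksubset_module \<Omega> k x0) J0 (\<lambda>(q, r). LL (height q) (height r) ?\<theta>)"
    by (rule decomposes_drop_zero) (auto simp: J0_def LL_zero)
  have d': "decomposes (dsum (P_set D k) (\<lambda>(i, j). copies (mult_m i (D - k) * mult_m j k)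
      (LL (D - k - 2 * i) (k - 2 * j) ?\<theta>))) ?J'
      (\<lambda>(p, t). LL (D - k - 2 * fst p) (k - 2 * snd p) ?\<theta>)"
    using k by (intro decomposes_Sigma[OF decomposes_dsum])
      (auto simp: split_beta finite_P_set intro!: decomposes_copies copies_module LL_module)
  show ?thesis
  proof (rule decomposes_iso_fibres[OF d d', where \<kappa> = "\<lambda>(q, r). (height q, height r)"
        and \<kappa>' = "\<lambda>(p, t). (D - k - 2 * fst p, k - 2 * snd p)" and L = "\<lambda>(m, n). LL m n ?\<theta>"])
    fix x :: "nat \<times> nat"
    show "card {j \<in> J0. (\<lambda>(q, r). (height q, height r)) j = x} =
        card {j \<in> ?J'. (\<lambda>(p, t). (D - k - 2 * fst p, k - 2 * snd p)) j = x}"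
    proof (cases "\<exists>i j. (i, j) \<in> P_set D k \<and> x = (D - k - 2 * i, k - 2 * j)")
      case True
      then obtain i j where ij: "(i, j) \<in> P_set D k" and x: "x = (D - k - 2 * i, k - 2 * j)" by blast
      have le: "2 * i \<le> D - k" "2 * j \<le> k" using ij k by (auto simp: P_set_iff)
      have "{j \<in> J0. (\<lambda>(q, r). (height q, height r)) j = x} =
          {q \<in> words (D - k). height q = D - k - 2 * i} \<times> {r \<in> words k. height r = k - 2 * j}"
        using ij LL_index_nonempty_iff[OF k le] by (auto simp: J0_def x)
      moreover have "{j \<in> ?J'. (\<lambda>(p, t). (D - k - 2 * fst p, k - 2 * snd p)) j = x} =
          {(i, j)} \<times> {..<mult_m i (D - k) * mult_m j k}" (is "?F = _")
      proof (intro equalityI subsetI)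
        fix y assume y: "y \<in> ?F"
        obtain a b t where abt: "y = ((a, b), t)" by (metis surj_pair)
        have P: "(a, b) \<in> P_set D k" and "D - k - 2 * a = D - k - 2 * i" "k - 2 * b = k - 2 * j"
          using y unfolding abt x by auto
        \<comment> \<open>The bounds of P(k) exclude truncation, so the subtractions can be
          cancelled.\<close>
        then have "a = i" "b = j" using le by (auto simp: P_set_iff[OF k])
        then show "y \<in> {(i, j)} \<times> {..<mult_m i (D - k) * mult_m j k}" using y by (auto simp: abt)
      qed (use ij in \<open>auto simp: x\<close>)
      ultimately show ?thesis
        by (simp add: card_cartesian_product card_words_height le del: diff_diff_left)
    next
      case False
      \<comment> \<open>Heights of words always have the form (D - k - 2i, k - 2j); if (i, j) is not
        in P(k), the weight space is zero and the pair was discarded from \<open>J0\<close>.\<close>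
      have "{j \<in> J0. (\<lambda>(q, r). (height q, height r)) j = x} = {}"
      proof (rule ccontr)
        assume "{j \<in> J0. (\<lambda>(q, r). (height q, height r)) j = x} \<noteq> {}"
        then obtain q r where qr: "q \<in> words (D - k)" "r \<in> words k" "LL_index (height q) (height r) ?\<theta> \<noteq> {}"
          and x: "x = (height q, height r)"
          by (auto simp: J0_def)
        obtain i j where ij: "2 * i \<le> D - k" "height q = D - k - 2 * i" "2 * j \<le> k" "height r = k - 2 * j"
          using words_height[OF qr(1)] words_height[OF qr(2)] by blast
        have "(i, j) \<in> P_set D k" using qr(3) LL_index_nonempty_iff[OF k ij(1,3)] by (simp add: ij)
        then show False using False x ij by blast
      qed
      moreover have "(\<lambda>(p, t). (D - k - 2 * fst p, k - 2 * snd p)) y \<noteq> x" if y: "y \<in> ?J'" for y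
      proof -
        obtain i j t where "y = ((i, j), t)" "(i, j) \<in> P_set D k" using y by (metis SigmaE surj_pair)
        then show ?thesis using False by auto
      qed
      then have "{j \<in> ?J'. (\<lambda>(p, t). (D - k - 2 * fst p, k - 2 * snd p)) j = x} = {}" by blast
      ultimately show ?thesis by (simp only: card.empty)
    qed
  qed (auto simp: mod_iso_refl)
qed

text \<open>Here a label is an unordered pair of heights, stored with the larger one first, and
  \<open>LL_swap\<close> identifies both orders with the representative. No summand vanishes, since
  i, j \<le> k/2 already gives i + j \<le> k.\<close>

lemma ksubset_module_iso_half:
  fixes \<Omega> x0 :: "'a set"
  assumes fin: "finite \<Omega>" and D: "card \<Omega> = 2 * k" and x0: "x0 \<in> ksubsets \<Omega> k"
  shows "ksubset_module \<Omega> k x0 \<cong>\<^sub>m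
    dsum {0..k div 2} (\<lambda>i. copies (mult_m i k ^ 2) (LL (k - 2 * i) (k - 2 * i) 0)) \<oplus>\<^sub>m
    dsum {0..k div 2} (\<lambda>i. dsum {i + 1..k div 2} (\<lambda>j.
      copies (2 * mult_m i k * mult_m j k) (LL (k - 2 * i) (k - 2 * j) 0)))"
proof -
  let ?J = "words k \<times> words k" and ?d = "k div 2"
  let ?J1 = "Sigma {0..?d} (\<lambda>i. {..<mult_m i k ^ 2})"
  let ?J2 = "Sigma {0..?d} (\<lambda>i. Sigma {i + 1..?d} (\<lambda>j. {..<2 * mult_m i k * mult_m j k}))"
  define \<kappa> where "\<kappa> = (\<lambda>(q, r). (max (height q) (height r), min (height q) (height r)))"
  define \<kappa>' :: "nat \<times> nat + nat \<times> nat \<times> nat \<Rightarrow> nat \<times> nat"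
    where "\<kappa>' = case_sum (\<lambda>(i, t). (k - 2 * i, k - 2 * i)) (\<lambda>(i, j, t). (k - 2 * i, k - 2 * j))"
  define L where "L = (\<lambda>(m, n). LL m n 0)"
  have d: "decomposes (ksubset_module \<Omega> k x0) ?J (\<lambda>(q, r). LL (height q) (height r) 0)"
    using ksubset_module_decomposes[OF fin x0] by (simp add: D)
  have d': "decomposes (dsum {0..?d} (\<lambda>i. copies (mult_m i k ^ 2) (LL (k - 2 * i) (k - 2 * i) 0)) \<oplus>\<^sub>m
      dsum {0..?d} (\<lambda>i. dsum {i + 1..?d} (\<lambda>j.
        copies (2 * mult_m i k * mult_m j k) (LL (k - 2 * i) (k - 2 * j) 0)))) (?J1 <+> ?J2)
     (case_sum (\<lambda>(i, t). LL (k - 2 * i) (k - 2 * i) 0)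
       (\<lambda>(i, p). (\<lambda>(j, t). LL (k - 2 * i) (k - 2 * j) 0) p))"
  proof (rule decomposes_dsum2)
    show "decomposes (dsum {0..?d} (\<lambda>i. copies (mult_m i k ^ 2) (LL (k - 2 * i) (k - 2 * i) 0))) ?J1
        (\<lambda>(i, t). LL (k - 2 * i) (k - 2 * i) 0)"
      by (rule decomposes_Sigma[OF decomposes_dsum]) (auto intro: decomposes_copies copies_module LL_module)
    have inner: "decomposes (dsum {i + 1..?d} (\<lambda>j. copies (2 * mult_m i k * mult_m j k) (LL (k - 2 * i) (k - 2 * j) 0)))
        (Sigma {i + 1..?d} (\<lambda>j. {..<2 * mult_m i k * mult_m j k})) (\<lambda>(j, t). LL (k - 2 * i) (k - 2 * j) 0)" for i
      by (rule decomposes_Sigma[OF decomposes_dsum]) (auto intro: decomposes_copies copies_module LL_module)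
    show "decomposes (dsum {0..?d} (\<lambda>i. dsum {i + 1..?d} (\<lambda>j.
        copies (2 * mult_m i k * mult_m j k) (LL (k - 2 * i) (k - 2 * j) 0)))) ?J2
        (\<lambda>(i, p). (\<lambda>(j, t). LL (k - 2 * i) (k - 2 * j) 0) p)"
      by (rule decomposes_Sigma[OF decomposes_dsum])
        (intro inner dsum_module copies_module LL_module finite_atLeastAtMost)+
  qed
  show ?thesis
  proof (rule decomposes_iso_fibres[OF d d', where \<kappa> = \<kappa> and \<kappa>' = \<kappa>' and L = L])
    fix p
    show "(case p of (q, r) \<Rightarrow> LL (height q) (height r) 0) \<cong>\<^sub>m L (\<kappa> p)"
      by (cases p) (auto simp: \<kappa>_def L_def max_def min_def LL_swap mod_iso_refl)
  next
    fix p assume "p \<in> ?J1 <+> ?J2"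
    then show "case_sum (\<lambda>(i, t). LL (k - 2 * i) (k - 2 * i) 0)
       (\<lambda>(i, p). (\<lambda>(j, t). LL (k - 2 * i) (k - 2 * j) 0) p) p = L (\<kappa>' p)"
      by (auto simp: \<kappa>'_def L_def)
  next
    fix x :: "nat \<times> nat"
    let ?A = "\<lambda>i. {q \<in> words k. height q = k - 2 * i}"
    show "card {j \<in> ?J. \<kappa> j = x} = card {j \<in> ?J1 <+> ?J2. \<kappa>' j = x}"
    proof (cases "\<exists>i j. i \<le> j \<and> j \<le> ?d \<and> x = (k - 2 * i, k - 2 * j)")
      case True
      then obtain i j where ij: "i \<le> j" "j \<le> ?d" and x: "x = (k - 2 * i, k - 2 * j)" by blast
      have le: "2 * i \<le> k" "2 * j \<le> k" using ij by auto
      have eq: "k - 2 * i' = k - 2 * i \<longleftrightarrow> i' = i" if "i' \<le> ?d" "2 * i \<le> k" for i i' using that by auto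
      show ?thesis
      proof (cases "i = j")
        case True
        have "{j \<in> ?J. \<kappa> j = x} = ?A i \<times> ?A i" by (auto simp: \<kappa>_def x True max_def min_def split: if_splits)
        moreover have "{p \<in> ?J1 <+> ?J2. \<kappa>' p = x} = Inl ` ({i} \<times> {..<mult_m i k ^ 2})"
          using ij le by (auto simp: \<kappa>'_def x True eq)
        ultimately show ?thesis
          by (simp add: card_cartesian_product card_words_height le card_image power2_eq_square)
      next
        case False
        then have lt: "k - 2 * j < k - 2 * i" using ij le by auto
        \<comment> \<open>Off the diagonal both orders of the two heights carry the same label,
          which is the origin of the factor 2.\<close>
        have "{j \<in> ?J. \<kappa> j = x} = ?A i \<times> ?A j \<union> ?A j \<times> ?A i"
          using lt by (auto simp: \<kappa>_def x max_def min_def split: if_splits)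
        moreover have "card \<dots> = card (?A i \<times> ?A j) + card (?A j \<times> ?A i)"
          using lt finite_words by (intro card_Un_disjoint) auto
        moreover have "{p \<in> ?J1 <+> ?J2. \<kappa>' p = x} = Inr ` ({i} \<times> {j} \<times> {..<2 * mult_m i k * mult_m j k})"
          using ij le False by (auto simp: \<kappa>'_def x eq)
        ultimately show ?thesis
          by (simp add: card_cartesian_product card_words_height le card_image)
      qed
    next
      case False
      have no: "x \<noteq> (k - 2 * i, k - 2 * j)" if "i \<le> j" "j \<le> ?d" for i j using False that by blast
      have "\<kappa> p \<noteq> x" if p: "p \<in> ?J" for p
      proof -
        obtain q r where qr: "p = (q, r)" "q \<in> words k" "r \<in> words k" using p by auto
        obtain i j where ij: "2 * i \<le> k" "height q = k - 2 * i" "2 * j \<le> k" "height r = k - 2 * j"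
          using words_height[OF qr(2)] words_height[OF qr(3)] by blast
        have "\<kappa> p = (k - 2 * min i j, k - 2 * max i j)"
          using ij by (auto simp: \<kappa>_def qr max_def min_def)
        moreover have "max i j \<le> ?d" "min i j \<le> max i j" using ij by auto
        ultimately show ?thesis using no by metis
      qed
      then have "{j \<in> ?J. \<kappa> j = x} = {}" by blast
      moreover have "\<kappa>' p \<noteq> x" if p: "p \<in> ?J1 <+> ?J2" for p
      proof -
        consider i t where "p = Inl (i, t)" "i \<le> ?d" | i j t where "p = Inr (i, j, t)" "i \<le> j" "j \<le> ?d"
          using p by auto
        then show ?thesis
        proof cases
          case 1
          then show ?thesis using no[of i i] by (auto simp: \<kappa>'_def)
        next
          case 2
          then show ?thesis using no[of i j] by (auto simp: \<kappa>'_def)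
        qed
      qed
      then have "{p \<in> ?J1 <+> ?J2. \<kappa>' p = x} = {}" by blast
      ultimately show ?thesis by (simp only: card.empty)
    qed
  qed
qed

theorem theorem5p7:
  fixes \<Omega> x0 :: "'a set" and D k :: nat
  assumes "finite \<Omega>" and "card \<Omega> = D" and "k \<le> D" and "x0 \<in> ksubsets \<Omega> k"
  shows "(real k \<noteq> real D / 2 \<longrightarrow>
      ksubset_module \<Omega> k x0 \<cong>\<^sub>m
        dsum (P_set D k) (\<lambda>(i, j). copies (mult_m i (D - k) * mult_m j k)
          (LL (D - k - 2 * i) (k - 2 * j) (of_nat D - 2 * of_nat k))) \<and>
      (\<forall>(i, j)\<in>P_set D k.
        irreducible_module (LL (D - k - 2 * i) (k - 2 * j) (of_nat D - 2 * of_nat k))) \<and>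
      (\<forall>(i, j)\<in>P_set D k. \<forall>(i', j')\<in>P_set D k. (i, j) \<noteq> (i', j') \<longrightarrow>
        \<not> LL (D - k - 2 * i) (k - 2 * j) (of_nat D - 2 * of_nat k) \<cong>\<^sub>m
          LL (D - k - 2 * i') (k - 2 * j') (of_nat D - 2 * of_nat k))) \<and>
    (real k = real D / 2 \<longrightarrow>
      ksubset_module \<Omega> k x0 \<cong>\<^sub>m
        dsum {0..D div 4} (\<lambda>i. copies (mult_m i (D div 2) ^ 2)
          (LL (D div 2 - 2 * i) (D div 2 - 2 * i) 0)) \<oplus>\<^sub>m
        dsum {0..D div 4} (\<lambda>i. dsum {i + 1..D div 4} (\<lambda>j.
          copies (2 * mult_m i (D div 2) * mult_m j (D div 2))
            (LL (D div 2 - 2 * i) (D div 2 - 2 * j) 0))) \<and>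
      (let I = {(i, i) | i. i \<in> {0..D div 4}} \<union>
          {(i, j). i \<in> {0..D div 4} \<and> j \<in> {i + 1..D div 4}} in
        (\<forall>(i, j)\<in>I. irreducible_module (LL (D div 2 - 2 * i) (D div 2 - 2 * j) 0)) \<and>
        (\<forall>(i, j)\<in>I. \<forall>(i', j')\<in>I. (i, j) \<noteq> (i', j') \<longrightarrow>
          \<not> LL (D div 2 - 2 * i) (D div 2 - 2 * j) 0 \<cong>\<^sub>m
            LL (D div 2 - 2 * i') (D div 2 - 2 * j') 0)))"
proof (intro conjI impI)
  let ?\<theta> = "of_nat D - 2 * of_nat k :: complex"
  assume "real k \<noteq> real D / 2"
  then have "of_nat D \<noteq> (of_nat (2 * k) :: complex)" unfolding of_nat_eq_iff by auto
  then have \<theta>: "?\<theta> \<noteq> 0" by simp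
  have ne: "LL_index (D - k - 2 * i) (k - 2 * j) ?\<theta> \<noteq> {}" if "(i, j) \<in> P_set D k" for i j
    using LL_index_nonempty_iff[OF assms(3), of i j] that by (simp add: P_set_iff[OF assms(3)])
  show "ksubset_module \<Omega> k x0 \<cong>\<^sub>m
        dsum (P_set D k) (\<lambda>(i, j). copies (mult_m i (D - k) * mult_m j k)
          (LL (D - k - 2 * i) (k - 2 * j) ?\<theta>))"
    by (rule ksubset_module_iso[OF assms])
  show "\<forall>(i, j)\<in>P_set D k. irreducible_module (LL (D - k - 2 * i) (k - 2 * j) ?\<theta>)"
    using ne LL_irreducible by blast
  show "\<forall>(i, j)\<in>P_set D k. \<forall>(i', j')\<in>P_set D k. (i, j) \<noteq> (i', j') \<longrightarrow>
        \<not> LL (D - k - 2 * i) (k - 2 * j) ?\<theta> \<cong>\<^sub>m LL (D - k - 2 * i') (k - 2 * j') ?\<theta>"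
  proof -
    have "i = i' \<and> j = j'" if P: "(i, j) \<in> P_set D k" "(i', j') \<in> P_set D k"
      and iso: "LL (D - k - 2 * i) (k - 2 * j) ?\<theta> \<cong>\<^sub>m LL (D - k - 2 * i') (k - 2 * j') ?\<theta>" for i j i' j'
    proof -
      have "D - k - 2 * i = D - k - 2 * i' \<and> k - 2 * j = k - 2 * j'"
        by (rule LL_iso_nonzero_weight[OF iso ne[OF P(1)] \<theta>])
      \<comment> \<open>From 2i \<le> D - k and 2j \<le> k, equal highest weights give equal
        indices.\<close>
      then show ?thesis using P by (auto simp: P_set_iff[OF assms(3)])
    qed
    then show ?thesis by blast
  qed
next
  assume "real k = real D / 2"
  then have "real (2 * k) = real D" by simp
  then have D: "D = 2 * k" by (simp only: of_nat_eq_iff)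
  have dv: "D div 2 = k" "D div 4 = k div 2" using D by auto
  show "ksubset_module \<Omega> k x0 \<cong>\<^sub>m
        dsum {0..D div 4} (\<lambda>i. copies (mult_m i (D div 2) ^ 2)
          (LL (D div 2 - 2 * i) (D div 2 - 2 * i) 0)) \<oplus>\<^sub>m
        dsum {0..D div 4} (\<lambda>i. dsum {i + 1..D div 4} (\<lambda>j.
          copies (2 * mult_m i (D div 2) * mult_m j (D div 2))
            (LL (D div 2 - 2 * i) (D div 2 - 2 * j) 0)))"
    unfolding dv by (rule ksubset_module_iso_half[OF assms(1) _ assms(4)]) (simp add: assms(2) D)
  define I where "I = {(i, i) | i. i \<in> {0..k div 2}} \<union> {(i, j). i \<in> {0..k div 2} \<and> j \<in> {i + 1..k div 2}}"
  have I: "i \<le> j" "2 * i \<le> k" "2 * j \<le> k" if "(i, j) \<in> I" for i j using that by (auto simp: I_def)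
  have ne: "LL_index (k - 2 * i) (k - 2 * j) 0 \<noteq> {}" if "(i, j) \<in> I" for i j
  proof -
    \<comment> \<open>The same extremal pure tensor as in \<open>LL_iso_zero_weight_le\<close>: its
      factors have H-weights k - 2j and -(k - 2j).\<close>
    have "(j - i, k - 2 * j) \<in> LL_index (k - 2 * i) (k - 2 * j) 0"
      using I[OF that] by (auto simp: LL_index_def of_nat_diff)
    then show ?thesis by blast
  qed
  have "(\<forall>(i, j)\<in>I. irreducible_module (LL (k - 2 * i) (k - 2 * j) 0))"
    using ne LL_irreducible by blast
  moreover have "\<forall>(i, j)\<in>I. \<forall>(i', j')\<in>I. (i, j) \<noteq> (i', j') \<longrightarrow>
      \<not> LL (k - 2 * i) (k - 2 * j) 0 \<cong>\<^sub>m LL (k - 2 * i') (k - 2 * j') 0"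
  proof -
    have "i = i' \<and> j = j'" if ij: "(i, j) \<in> I" "(i', j') \<in> I"
      and iso: "LL (k - 2 * i) (k - 2 * j) 0 \<cong>\<^sub>m LL (k - 2 * i') (k - 2 * j') 0" for i j i' j'
    proof -
      note le = I[OF ij(1)] I[OF ij(2)]
      have "k - 2 * i = k - 2 * i' \<and> k - 2 * j = k - 2 * j'"
        using le by (intro LL_iso_zero_weight[OF iso]) auto
      then show ?thesis using le by auto
    qed
    then show ?thesis by blast
  qed
  ultimately show "let I = {(i, i) | i. i \<in> {0..D div 4}} \<union>
          {(i, j). i \<in> {0..D div 4} \<and> j \<in> {i + 1..D div 4}} in
        (\<forall>(i, j)\<in>I. irreducible_module (LL (D div 2 - 2 * i) (D div 2 - 2 * j) 0)) \<and>
        (\<forall>(i, j)\<in>I. \<forall>(i', j')\<in>I. (i, j) \<noteq> (i', j') \<longrightarrow>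
          \<not> LL (D div 2 - 2 * i) (D div 2 - 2 * j) 0 \<cong>\<^sub>m
            LL (D div 2 - 2 * i') (D div 2 - 2 * j') 0)"
    unfolding dv I_def[symmetric] Let_def by blast
qed

end
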